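(* Let $d\ge2$ be an integer. There is no self-similar set $F\subset\mathbb{R}^d$, not contained in any $(d-1)$-dimensional hyperplane, such that $F$ fails the weak separation property, $\dim_H F=1$ and $\mathcal H^1(F)>0$. Moreover, for every self-similar set $F\subset\mathbb{R}^d$ not contained in any $(d-1)$-dimensional hyperplane and with $\dim_H F=1$, the following are equivalent: \begin{itemize} \item[(i)] there is an IFS with attractor $F$ satisfying the weak separation property; \item[(i')] every IFS with attractor $F$ satisfies the weak separation property; \item[(ii)] $\mathcal H^1(F)>0$; \item[(iii)] $\dim_H F=\dim_A F$. \end{itemize}
   Context: IFS and attractor: an IFS is a finite family $\mathcal S=\{S_1,\dots,S_m\}$ of contractive similitudes of $\mathbb{R}^d$, $S_i(x)=c_iO_ix+b_i$ with $c_i\in(0,1)$, $O_i$ a $d\times d$ orthogonal matrix, $b_i\in\mathbb{R}^d$. Its attractor is the unique nonempty compact $F$ with $F=\bigcup_{i=1}^m S_i(F)$; such an $F$ is called a self-similar set. $\mathcal I=\{1,\dots,m\}$, $\mathcal I^\ast=\bigcup_{k\ge1}\mathcal I^k$, and for $\alpha=(i_1,\dots,i_k)\in\mathcal I^\ast$, $S_\alpha=S_{i_1}\circ\cdots\circ S_{i_k}$. Weak separation property (WSP): let $\mathcal E=\{S_\alpha^{-1}\circ S_\beta:\alpha,\beta\in\mathcal I^\ast,\alpha\ne\beta\}$, inside the group of similitudes with the topology of pointwise convergence. For $F$ not contained in any $(d-1)$-dimensional hyperplane, $\mathcal S$ satisfies the WSP if $I\notin\overline{\mathcal E\setminus\{I\}}$,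 where $I$ is the identity. The set $F$ is said to satisfy the WSP if some IFS with attractor $F$ satisfies it, and to fail it otherwise. $\mathcal H^1$ is the one-dimensional Hausdorff measure and $\dim_H$ the Hausdorff dimension. Assouad dimension: $N_r(E)$ is the minimum number of closed balls of radius $r$ needed to cover $E$, $B(x,R)$ is the closed ball, and $\dim_A E$ is the infimum of the $\alpha$ for which there is a constant $c$ such that $\sup_{x\in E}N_r(B(x,R)\cap E)\le c(R/r)^\alpha$ for all $0<r<R$. *)

theory Defs
  imports "HOL-Analysis.Analysis"
begin

section \<open>Iterated function systems of similitudes\<close>

definition similitude_with :: "real \<Rightarrow> (real ^ 'n \<Rightarrow> real ^ 'n) \<Rightarrow> bool" where
  "similitude_with c f \<longleftrightarrow>
     (\<exists>Q b. orthogonal_matrix Q \<and> f = (\<lambda>x. c *\<^sub>R (Q *v x) + b))"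

definition similitudes :: "(real ^ 'n \<Rightarrow> real ^ 'n) set" where
  "similitudes = {f. \<exists>c>0. similitude_with c f}"

definition contractive_similitude :: "(real ^ 'n \<Rightarrow> real ^ 'n) \<Rightarrow> bool" where
  "contractive_similitude f \<longleftrightarrow> (\<exists>c. 0 < c \<and> c < 1 \<and> similitude_with c f)"

text \<open>An IFS is a family, given as a list; its index set is \<open>{..<length Ss}\<close>.\<close>

definition ifs :: "(real ^ 'n \<Rightarrow> real ^ 'n) list \<Rightarrow> bool" where
  "ifs Ss \<longleftrightarrow> Ss \<noteq> [] \<and> (\<forall>f\<in>set Ss. contractive_similitude f)"

definition is_attractor :: "(real ^ 'n \<Rightarrow> real ^ 'n) list \<Rightarrow> (real ^ 'n) set \<Rightarrow> bool" where
  "is_attractor Ss F \<longleftrightarrow> F \<noteq> {} \<and> compact F \<and> F = (\<Union>f\<in>set Ss. f ` F)"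

definition self_similar :: "(real ^ 'n) set \<Rightarrow> bool" where
  "self_similar F \<longleftrightarrow> (\<exists>Ss. ifs Ss \<and> is_attractor Ss F)"

definition in_hyperplane :: "(real ^ 'n) set \<Rightarrow> bool" where
  "in_hyperplane F \<longleftrightarrow>
     (\<exists>H. affine H \<and> aff_dim H = int CARD('n) - 1 \<and> F \<subseteq> H)"

section \<open>The weak separation property\<close>

definition words :: "'a list \<Rightarrow> nat list set" where
  "words Ss = {\<alpha>. \<alpha> \<noteq> [] \<and> set \<alpha> \<subseteq> {..<length Ss}}"

definition word_map :: "('a \<Rightarrow> 'a) list \<Rightarrow> nat list \<Rightarrow> 'a \<Rightarrow> 'a" where
  "word_map Ss \<alpha> = foldr (\<lambda>i g. (Ss ! i) \<circ> g) \<alpha> id"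

definition neighbour_maps ::
    "(real ^ 'n \<Rightarrow> real ^ 'n) list \<Rightarrow> (real ^ 'n \<Rightarrow> real ^ 'n) set" where
  "neighbour_maps Ss =
     {inv (word_map Ss \<alpha>) \<circ> word_map Ss \<beta> | \<alpha> \<beta>. \<alpha> \<in> words Ss \<and> \<beta> \<in> words Ss \<and> \<alpha> \<noteq> \<beta>}"

text \<open>The type class topology on a function type is the product topology, that is, the
  topology of pointwise convergence.\<close>

definition wsp :: "(real ^ 'n \<Rightarrow> real ^ 'n) list \<Rightarrow> bool" where
  "wsp Ss \<longleftrightarrow> id \<notin> (top_of_set similitudes) closure_of (neighbour_maps Ss - {id})"

definition set_wsp :: "(real ^ 'n) set \<Rightarrow> bool" where
  "set_wsp F \<longleftrightarrow> (\<exists>Ss. ifs Ss \<and> is_attractor Ss F \<and> wsp Ss)"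

section \<open>Hausdorff measure and dimension\<close>

text \<open>The exponent \<open>0\<close> follows the convention that nonempty sets, including singletons,
  contribute \<open>1\<close> and the empty set contributes \<open>0\<close>, whereas \<open>0 powr 0 = 0\<close>.\<close>

definition diam_pow :: "real \<Rightarrow> 'a::metric_space set \<Rightarrow> ennreal" where
  "diam_pow s U =
     (if U = {} then 0 else if s = 0 then 1 else ennreal (diameter U powr s))"

text \<open>Boundedness of the covering sets has to be required separately, because
  \<open>diameter U = 0\<close> for unbounded \<open>U\<close>. Finite covers are included, as
  covering sets may be empty.\<close>

definition hausdorff_premeasure :: "real \<Rightarrow> real \<Rightarrow> 'a::metric_space set \<Rightarrow> ennreal" where
  "hausdorff_premeasure s \<delta> E =
     Inf {(\<Sum>i. diam_pow s (U i)) | U :: nat \<Rightarrow> 'a set.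
            E \<subseteq> (\<Union>i. U i) \<and> (\<forall>i. bounded (U i) \<and> diameter (U i) \<le> \<delta>)}"

definition hausdorff_measure :: "real \<Rightarrow> 'a::metric_space set \<Rightarrow> ennreal" where
  "hausdorff_measure s E = (SUP \<delta>\<in>{0<..}. hausdorff_premeasure s \<delta> E)"

definition hausdorff_dim :: "'a::metric_space set \<Rightarrow> ereal" where
  "hausdorff_dim E = Inf {ereal s | s. 0 \<le> s \<and> hausdorff_measure s E = 0}"

section \<open>Assouad dimension\<close>

text \<open>The centres of the covering balls range over the whole space, not just over \<open>E\<close>.
  The value is \<open>\<infinity>\<close> if there is no finite cover.\<close>

definition covering_number :: "real \<Rightarrow> 'a::metric_space set \<Rightarrow> enat" where
  "covering_number r E =
     Inf {enat (card A) | A. finite A \<and> E \<subseteq> (\<Union>a\<in>A. cball a r)}"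

definition assouad_dim :: "'a::metric_space set \<Rightarrow> ereal" where
  "assouad_dim E =
     Inf {ereal \<alpha> | \<alpha>. \<exists>c::real. \<forall>r R. 0 < r \<and> r < R \<longrightarrow>
            (SUP x\<in>E. ereal_of_enat (covering_number r (cball x R \<inter> E)))
              \<le> ereal (c * (R / r) powr \<alpha>)}"

end

theory Submission
  imports Defs "HOL-Library.Sublist"
begin

text \<open>If some IFS of \<open>F\<close> satisfies the weak separation property, every ball of radius \<open>r\<close> meets
  boundedly many pieces of size \<open>r\<close>; a cover of small cost would then give finitely many
  contractions in the semigroup whose images of \<open>F\<close> cover \<open>F\<close> and whose ratios have sum less than
  1, contradicting \<open>dim F = 1\<close>. So \<open>F\<close> has positive measure.

  If \<open>F\<close> has positive content \<open>c\<close>, then \<open>c\<close> times the sum of the ratios of finitely many disjoint pieces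
  inside a ball of radius \<open>R\<close> is at most \<open>R\<close>, since a denser cluster of pieces, repeated all over \<open>F\<close>,
  would yield cheaper and cheaper covers. Hence the Assouad dimension is at most 1.

  If some IFS fails the property, there are neighbour maps arbitrarily close to, but different from,
  the identity. Rescaled and composed, they show that a magnified piece of \<open>F\<close> contains about
  \<open>1 / \<rho>\<close> copies of \<open>F\<close> translated, up to an error much smaller than \<open>\<rho>\<close>, by multiples of a vector \<open>z\<close>
  of length about \<open>\<rho>\<close>. As \<open>F\<close> is not contained in a hyperplane and the ambient dimension is at least 2, the
  projection of \<open>F\<close> along \<open>z\<close> contains at least a constant times \<open>\<rho> powr - \<epsilon>\<close> points separated by
  \<open>\<rho>\<close>, so that the Assouad dimension is at least \<open>1 + \<epsilon>\<close>.\<close>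

section \<open>Similitudes and attractors\<close>

text \<open>Pieces of \<open>F\<close> may overlap heavily, so pieces cannot be counted by a measure
  that gives each its natural share of mass. Two substitutes do the counting: positivity of a
  content defined by finite covers with open balls, and the packing bound that for pairwise disjoint
  images of \<open>F\<close> the ratios raised to the dimension sum to at most 1. When separation
  fails, the obstacle is that a neighbour map close to the identity may be dominated by its linear
  part, for instance by a rotation about a point near \<open>F\<close>. Conjugating by a map of
  ratio \<lambda> multiplies displacements by 1 / \<lambda> but keeps the norm of the linear part of
  the displacement; a small \<lambda> therefore turns the map into almost a translation. The
  constants are chosen in the order \<rho>, then an accuracy \<eta> proportional to \<rho>, then
  about 1 / \<rho> maps: each contributes an error of order \<eta> * \<rho>, so the total is of
  order \<eta> and stays a small fraction of \<rho>.\<close>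

definition ratio :: "(real ^ 'n \<Rightarrow> real ^ 'n) \<Rightarrow> real" where
  "ratio f = norm (f (axis undefined 1) - f 0)"

lemma similitude_with_diff:
  assumes "similitude_with c f"
  obtains L where "linear L" "\<And>x y. f x - f y = L (x - y)" "\<And>x. norm (L x) = \<bar>c\<bar> * norm x"
proof -
  obtain Q b where Q: "orthogonal_matrix Q" and f: "f = (\<lambda>x. c *\<^sub>R (Q *v x) + b)"
    using assms by (auto simp: similitude_with_def)
  have ot: "orthogonal_transformation ((*v) Q)"
    using Q by (simp add: orthogonal_transformation_matrix)
  show ?thesis
  proof
    show "linear (\<lambda>x. c *\<^sub>R (Q *v x))"
      by (intro linear_compose_scale_right) simp
    show "f x - f y = c *\<^sub>R (Q *v (x - y))" for x y
      by (simp add: f matrix_vector_mult_diff_distrib scaleR_diff_right)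
    show "norm (c *\<^sub>R (Q *v x)) = \<bar>c\<bar> * norm x" for x
      using ot by (simp add: orthogonal_transformation)
  qed
qed

text \<open>\<open>axis undefined 1\<close> is a unit vector whichever index
  \<open>undefined\<close> denotes, so \<open>ratio\<close> depends on the map alone. A norm sees
  only the absolute value of c, whence the sign condition.\<close>

lemma similitude_with_ratio:
  assumes "similitude_with c f" "c > 0"
  shows "ratio f = c"
proof -
  obtain L where "linear L" "\<And>x y. f x - f y = L (x - y)" "\<And>x. norm (L x) = \<bar>c\<bar> * norm x"
    using similitude_with_diff[OF assms(1)] by blast
  then show ?thesis
    using assms(2) by (simp add: ratio_def norm_axis_1)
qed

lemma similitudesE:
  assumes "f \<in> similitudes"
  obtains L where "linear L" "\<And>x y. f x - f y = L (x - y)" "\<And>x. norm (L x) = ratio f * norm x"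
    "ratio f > 0"
proof -
  obtain c where c: "c > 0" "similitude_with c f"
    using assms by (auto simp: similitudes_def)
  have "ratio f = c" using similitude_with_ratio c by blast
  with c similitude_with_diff[OF c(2)] that show ?thesis by (metis abs_of_pos)
qed

lemma ratio_pos: "f \<in> similitudes \<Longrightarrow> ratio f > 0"
  by (erule similitudesE)

lemma similitude_dist: "f \<in> similitudes \<Longrightarrow> dist (f x) (f y) = ratio f * dist x y"
  by (erule similitudesE) (simp add: dist_norm)

lemma similitude_with_comp:
  assumes "similitude_with c f" "similitude_with e g"
  shows "similitude_with (c * e) (f \<circ> g)"
proof -
  obtain Q b where Q: "orthogonal_matrix Q" and f: "f = (\<lambda>x. c *\<^sub>R (Q *v x) + b)"
    using assms by (auto simp: similitude_with_def)
  obtain R a where R: "orthogonal_matrix R" and g: "g = (\<lambda>x. e *\<^sub>R (R *v x) + a)"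
    using assms by (auto simp: similitude_with_def)
  have "f \<circ> g = (\<lambda>x. (c * e) *\<^sub>R ((Q ** R) *v x) + (c *\<^sub>R (Q *v a) + b))"
    by (rule ext) (simp add: f g matrix_vector_right_distrib matrix_vector_mul_assoc
        matrix_vector_mult_scaleR scaleR_add_right)
  then show ?thesis
    using orthogonal_matrix_mul[OF Q R] unfolding similitude_with_def by blast
qed

lemma similitudes_comp: "f \<in> similitudes \<Longrightarrow> g \<in> similitudes \<Longrightarrow> f \<circ> g \<in> similitudes"
  unfolding similitudes_def using similitude_with_comp mult_pos_pos by blast

lemma ratio_comp: "f \<in> similitudes \<Longrightarrow> g \<in> similitudes \<Longrightarrow> ratio (f \<circ> g) = ratio f * ratio g"
  unfolding similitudes_def 
  using similitude_with_comp mult_pos_pos similitude_with_ratio by (smt (verit) mem_Collect_eq)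

lemma similitude_with_id: "similitude_with 1 id"
  unfolding similitude_with_def
  by (intro exI[of _ "mat 1"] exI[of _ 0]) (auto simp: orthogonal_matrix_id id_def)

lemma similitudes_id [simp]: "id \<in> similitudes" and ratio_id [simp]: "ratio id = 1"
  using similitude_with_id similitude_with_ratio[of 1 id]
  by (auto simp: similitudes_def intro!: exI[of _ "1::real"])

lemma similitude_inverse:
  assumes "f \<in> similitudes"
  shows "bij f" and "inv f \<in> similitudes" and "ratio (inv f) = 1 / ratio f"
proof -
  obtain c where c: "c > 0" "similitude_with c f"
    using assms by (auto simp: similitudes_def)
  obtain Q b where Q: "orthogonal_matrix Q" and f: "f = (\<lambda>x. c *\<^sub>R (Q *v x) + b)"
    using c by (auto simp: similitude_with_def)
  define g where "g = (\<lambda>x. (1 / c) *\<^sub>R (transpose Q *v x) + (- ((1 / c) *\<^sub>R (transpose Q *v b))))"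
  have QQ: "transpose Q ** Q = mat 1" "Q ** transpose Q = mat 1"
    using Q by (auto simp: orthogonal_matrix_def)
  have gf: "g (f x) = x" and fg: "f (g x) = x" for x
    using c(1) by (simp_all add: f g_def matrix_vector_right_distrib matrix_vector_mul_assoc QQ
        scaleR_add_right matrix_vector_mult_diff_distrib scaleR_diff_right
        matrix_vector_mult_scaleR del: transpose_matrix_vector)
  show "bij f" using gf fg by (metis bijI')
  have ig: "inv f = g" using fg gf by (metis ext inv_equality)
  have "similitude_with (1 / c) g"
    unfolding similitude_with_def g_def
    using Q orthogonal_matrix_transpose by (metis (no_types))
  then show "inv f \<in> similitudes" "ratio (inv f) = 1 / ratio f"
    using c ig similitude_with_ratio[of c f] similitude_with_ratio[of "1/c" g]
    unfolding similitudes_def by (metis (mono_tags) divide_pos_pos mem_Collect_eq zero_less_one)+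
qed

lemma inv_similitude_cancel:
  assumes "f \<in> similitudes"
  shows "inv f (f x) = x" "f (inv f x) = x"
  using similitude_inverse(1)[OF assms] by (simp_all add: bij_is_inj bij_is_surj surj_f_inv_f)

lemma similitude_inj: "f \<in> similitudes \<Longrightarrow> inj f"
  using similitude_inverse(1) bij_is_inj by blast

lemma similitude_image_ball:
  assumes "f \<in> similitudes"
  shows "f ` ball x r = ball (f x) (ratio f * r)"
proof
  show "f ` ball x r \<subseteq> ball (f x) (ratio f * r)"
    using assms by (auto simp: similitude_dist ratio_pos)
  show "ball (f x) (ratio f * r) \<subseteq> f ` ball x r"
  proof
    fix y assume "y \<in> ball (f x) (ratio f * r)"
    then have "dist (f x) (f (inv f y)) < ratio f * r"
      using assms by (simp add: inv_similitude_cancel)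
    then have "dist x (inv f y) < r"
      using assms ratio_pos[OF assms] by (simp only: similitude_dist mult_less_cancel_left_pos)
    then show "y \<in> f ` ball x r"
      using assms by (intro image_eqI[of _ _ "inv f y"]) (auto simp: inv_similitude_cancel)
  qed
qed

lemma similitude_continuous: "f \<in> similitudes \<Longrightarrow> continuous_on S f"
  by (rule lipschitz_on_continuous_on[of "ratio f"])
    (auto simp: lipschitz_on_def similitude_dist ratio_pos less_imp_le)

text \<open>Unlike \<open>words\<close>, this admits the empty word, so it contains
  \<open>id\<close> and is closed under composition. Words with the same composed map are
  identified.\<close>

definition maps :: "(real ^ 'n \<Rightarrow> real ^ 'n) list \<Rightarrow> (real ^ 'n \<Rightarrow> real ^ 'n) set" where
  "maps Ss = {word_map Ss \<alpha> | \<alpha>. set \<alpha> \<subseteq> {..<length Ss}}"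

lemma word_map_Nil [simp]: "word_map Ss [] = id"
  by (simp add: word_map_def)

lemma word_map_Cons [simp]: "word_map Ss (i # \<alpha>) = Ss ! i \<circ> word_map Ss \<alpha>"
  by (simp add: word_map_def)

lemma word_map_append: "word_map Ss (\<alpha> @ \<beta>) = word_map Ss \<alpha> \<circ> word_map Ss \<beta>"
  by (induction \<alpha>) (auto simp: o_assoc)

lemma maps_id [simp]: "id \<in> maps Ss"
  unfolding maps_def by (auto intro!: exI[of _ "[]"])

lemma maps_comp: "f \<in> maps Ss \<Longrightarrow> g \<in> maps Ss \<Longrightarrow> f \<circ> g \<in> maps Ss"
  unfolding maps_def using word_map_append by (smt (verit) Un_least mem_Collect_eq set_append)

lemma set_subset_maps:
  assumes "f \<in> set Ss" shows "f \<in> maps Ss"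
proof -
  obtain i where "i < length Ss" "Ss ! i = f" using assms by (auto simp: in_set_conv_nth)
  then show ?thesis unfolding maps_def by (auto intro!: exI[of _ "[i]"])
qed

lemma maps_induct [consumes 1, case_names id comp]:
  assumes "f \<in> maps Ss" "P id" "\<And>f g. f \<in> set Ss \<Longrightarrow> g \<in> maps Ss \<Longrightarrow> P g \<Longrightarrow> P (f \<circ> g)"
  shows "P f"
proof -
  obtain \<alpha> where "set \<alpha> \<subseteq> {..<length Ss}" "f = word_map Ss \<alpha>"
    using assms(1) by (auto simp: maps_def)
  then show ?thesis
  proof (induction \<alpha> arbitrary: f)
    case (Cons i \<alpha>)
    then have "Ss ! i \<in> set Ss" "word_map Ss \<alpha> \<in> maps Ss" "P (word_map Ss \<alpha>)"
      by (auto simp: maps_def)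
    then show ?case using assms(3) Cons.prems(2) word_map_Cons by metis
  qed (use assms(2) in simp)
qed

section \<open>The attractor of a fixed IFS and its pieces\<close>

locale attractor =
  fixes Ss :: "(real ^ 'n \<Rightarrow> real ^ 'n) list" and F :: "(real ^ 'n) set"
  assumes ifs: "ifs Ss" and attr: "is_attractor Ss F"
begin

lemma F_nonempty: "F \<noteq> {}" and F_compact: "compact F" and F_eq: "F = (\<Union>f\<in>set Ss. f ` F)"
  using attr unfolding is_attractor_def by blast+

lemma generator_image: "f \<in> set Ss \<Longrightarrow> f ` F \<subseteq> F"
  using equalityD2[OF F_eq] by blast

lemma generatorE:
  assumes "x \<in> F"
  obtains f y where "f \<in> set Ss" "y \<in> F" "x = f y"
  using subsetD[OF equalityD1[OF F_eq] assms] by blast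

lemma generator:
  assumes "f \<in> set Ss"
  shows "f \<in> similitudes" "ratio f < 1"
proof -
  obtain c where "0 < c" "c < 1" "similitude_with c f"
    using assms ifs unfolding ifs_def contractive_similitude_def by blast
  then show "f \<in> similitudes" "ratio f < 1"
    using similitude_with_ratio[of c f] by (auto simp: similitudes_def)
qed

lemma maps_similitude: "f \<in> maps Ss \<Longrightarrow> f \<in> similitudes"
proof (induction rule: maps_induct)
  case id
  show ?case by (rule similitudes_id)
next
  case (comp f g)
  then show ?case by (blast intro: similitudes_comp generator)
qed

lemma maps_ratio_le_1: "f \<in> maps Ss \<Longrightarrow> ratio f \<le> 1"
proof (induction rule: maps_induct)
  case (comp f g)
  then show ?case
    using mult_le_one[of "ratio f" "ratio g"] ratio_comp[of f g] generator[of f]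
      maps_similitude[of g] ratio_pos[of g]
    by linarith
next
  case id
  show ?case by (simp only: ratio_id)
qed

lemma maps_image: "f \<in> maps Ss \<Longrightarrow> f ` F \<subseteq> F"
proof (induction rule: maps_induct)
  case (comp f g)
  then have "f ` F \<subseteq> F" by (simp add: generator_image)
  moreover have "(f \<circ> g) ` F = f ` g ` F" by (rule image_comp[symmetric])
  ultimately show ?case using comp by blast
qed simp

definition "cmin = Min (ratio ` set Ss)"

lemma cmin: "0 < cmin" "cmin < 1" "f \<in> set Ss \<Longrightarrow> cmin \<le> ratio f"
proof -
  have ne: "ratio ` set Ss \<noteq> {}" "finite (ratio ` set Ss)" using ifs by (auto simp: ifs_def)
  then have "cmin \<in> ratio ` set Ss" unfolding cmin_def by (intro Min_in)
  then obtain g where "g \<in> set Ss" "cmin = ratio g" by blast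
  then show "0 < cmin" "cmin < 1" using generator[of g] ratio_pos[of g] by simp_all
  show "cmin \<le> ratio f" if "f \<in> set Ss" using that ne unfolding cmin_def by auto
qed

text \<open>Follow an address of x letter by letter until the ratio is about r; the last letter
  costs at most the factor \<open>cmin\<close>. The inner induction passes to the preimage y and the
  scale r / ratio f, and q ^ n \<le> r bounds the number of letters.\<close>

lemma piece:
  assumes "x \<in> F" "0 < r" "r \<le> 1"
  obtains f where "f \<in> maps Ss" "x \<in> f ` F" "cmin * r \<le> ratio f" "ratio f \<le> r"
proof -
  define q where "q = Max (ratio ` set Ss)"
  have ne: "ratio ` set Ss \<noteq> {}" "finite (ratio ` set Ss)" using ifs by (auto simp: ifs_def)
  then have "q \<in> ratio ` set Ss" unfolding q_def by (intro Max_in)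
  then obtain g where "g \<in> set Ss" "q = ratio g" by blast
  then have q01: "0 < q" "q < 1" using generator[of g] ratio_pos[of g] by simp_all
  have q: "ratio f \<le> q" if "f \<in> set Ss" for f using that ne unfolding q_def by auto
  have main: "\<exists>f\<in>maps Ss. x \<in> f ` F \<and> cmin * r \<le> ratio f \<and> ratio f \<le> r"
    if "x \<in> F" "q ^ n \<le> r" "r \<le> 1" for n x r
    using that
  proof (induction n arbitrary: x r)
    case 0
    then have "r = 1" by simp
    moreover have "x \<in> id ` F" using 0 by simp
    moreover have "cmin \<le> ratio (id :: real ^ 'n \<Rightarrow> _)" "ratio (id :: real ^ 'n \<Rightarrow> _) \<le> 1"
      using cmin(2) by (simp_all only: ratio_id)
    ultimately show ?case using maps_id by (metis mult.right_neutral)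
  next
    case (Suc n)
    obtain f y where f: "f \<in> set Ss" "y \<in> F" "x = f y" using Suc.prems(1) by (rule generatorE)
    note rf = ratio_pos[OF generator(1)[OF f(1)]]
    have r0: "r > 0" using Suc.prems q01 by (smt (verit) zero_less_power)
    show ?case
    proof (cases "r \<le> ratio f")
      case True
      have "q ^ n * ratio f \<le> q ^ n * q" using q[OF f(1)] q01 by (intro mult_left_mono) auto
      then have "q ^ n \<le> r / ratio f" "r / ratio f \<le> 1" using Suc.prems True rf
        by (auto simp: field_simps)
      from Suc.IH[OF f(2) this] obtain g where g: "g \<in> maps Ss" "y \<in> g ` F"
        "cmin * (r / ratio f) \<le> ratio g" "ratio g \<le> r / ratio f" by blast
      have "ratio (f \<circ> g) = ratio f * ratio g"
        using f g by (intro ratio_comp) (auto intro: generator maps_similitude)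
      then have "cmin * r \<le> ratio (f \<circ> g)" "ratio (f \<circ> g) \<le> r"
        using g rf by (simp_all add: field_simps)
      moreover have "f \<circ> g \<in> maps Ss" using f g by (blast intro: maps_comp set_subset_maps)
      moreover have "x \<in> (f \<circ> g) ` F" using f g by (metis image_comp image_eqI)
      ultimately show ?thesis by blast
    next
      case False
      have "cmin * r \<le> cmin * 1" using Suc.prems cmin by (intro mult_left_mono) auto
      also have "\<dots> \<le> ratio f" using cmin f by simp
      finally have "cmin * r \<le> ratio f" "ratio f \<le> r" using False by simp_all
      moreover have "x \<in> f ` F" "f \<in> maps Ss" using f by (blast intro: set_subset_maps)+
      ultimately show ?thesis by blast
    qed
  qed
  obtain n where "q ^ n < r" using real_arch_pow_inv[OF assms(2) q01(2)] by blast
  then have "\<exists>f\<in>maps Ss. x \<in> f ` F \<and> cmin * r \<le> ratio f \<and> ratio f \<le> r"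
    by (intro main[OF assms(1) _ assms(3), of n]) simp
  then show ?thesis using that by blast
qed

text \<open>The origin need not lie in \<open>F\<close>, but displacements are later measured at 0.
  The third requirement therefore keeps all images of 0 in the same ball.\<close>

definition "rad = (SOME R. 1 \<le> R \<and> F \<subseteq> ball 0 R \<and> (\<forall>f\<in>maps Ss. norm (f 0) \<le> R))"

lemma rad: "1 \<le> rad" "F \<subseteq> ball 0 rad" "f \<in> maps Ss \<Longrightarrow> norm (f 0) \<le> rad"
proof -
  obtain R0 where R0: "\<And>x. x \<in> F \<Longrightarrow> norm x \<le> R0" using F_compact compact_imp_bounded bounded_iff by metis
  obtain p where p: "p \<in> F" using F_nonempty by blast
  have "1 \<le> 2 * \<bar>R0\<bar> + 1" "F \<subseteq> ball 0 (2 * \<bar>R0\<bar> + 1)" using R0 by fastforce+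
  moreover have "norm (f 0) \<le> 2 * \<bar>R0\<bar> + 1" if f: "f \<in> maps Ss" for f
  proof -
    have "dist (f 0) (f p) \<le> 1 * dist 0 p"
      using mult_right_mono[OF maps_ratio_le_1[OF f], of "dist 0 p"]
        similitude_dist[OF maps_similitude[OF f], of 0 p] by simp
    moreover have "norm (f p) \<le> R0" "norm p \<le> R0" using maps_image f p R0 by blast+
    moreover have "norm (f 0) \<le> norm (f p) + dist (f 0) (f p)"
      by (metis dist_norm norm_triangle_sub)
    ultimately show ?thesis by simp
  qed
  ultimately have "\<exists>R. 1 \<le> R \<and> F \<subseteq> ball 0 R \<and> (\<forall>f\<in>maps Ss. norm (f 0) \<le> R)" by blast
  from someI_ex[OF this, folded rad_def]
  show "1 \<le> rad" "F \<subseteq> ball 0 rad" "f \<in> maps Ss \<Longrightarrow> norm (f 0) \<le> rad" by auto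
qed

lemma F_dist: "x \<in> F \<Longrightarrow> y \<in> F \<Longrightarrow> dist x y < 2 * rad"
  using rad(2) by (smt (verit) dist_commute dist_triangle mem_ball subset_iff)

end

section \<open>Content and packings\<close>

text \<open>Finiteness permits induction on the number of balls. Covers are sets, so coinciding
  balls merge; this is why unions and images of covers satisfy only inequalities for the
  cost.\<close>

definition ball_cover :: "((real ^ 'n) \<times> real) set \<Rightarrow> (real ^ 'n) set \<Rightarrow> bool" where
  "ball_cover K E \<longleftrightarrow> finite K \<and> (\<forall>k\<in>K. 0 < snd k) \<and> E \<subseteq> (\<Union>k\<in>K. ball (fst k) (snd k))"

definition cost :: "real \<Rightarrow> ((real ^ 'n) \<times> real) set \<Rightarrow> real" where
  "cost s K = (\<Sum>k\<in>K. snd k powr s)"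

text \<open>Positivity of the Hausdorff content, with radii in place of diameters. The radii are not
  bounded in advance: for s > 0 a small cost forces small balls by itself.\<close>

definition pos_content :: "real \<Rightarrow> (real ^ 'n) set \<Rightarrow> bool" where
  "pos_content s E \<longleftrightarrow> (\<exists>c>0. \<forall>K. ball_cover K E \<longrightarrow> c \<le> cost s K)"

lemma cost_nonneg: "0 \<le> cost s K"
  by (auto simp: cost_def intro: sum_nonneg)

lemma cost_mono: "finite K \<Longrightarrow> K' \<subseteq> K \<Longrightarrow> cost s K' \<le> cost s K"
  unfolding cost_def by (rule sum_mono2) auto

lemma cost_Un: "finite K \<Longrightarrow> finite K' \<Longrightarrow> cost s (K \<union> K') \<le> cost s K + cost s K'"
  unfolding cost_def by (subst sum.union_inter[symmetric]) (auto intro: sum_nonneg)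

lemma radius_powr_le_cost: "finite K \<Longrightarrow> k \<in> K \<Longrightarrow> snd k powr s \<le> cost s K"
  unfolding cost_def by (rule member_le_sum) auto

lemma radius_less:
  assumes "ball_cover K E" "k \<in> K" "cost s K < d powr s" "0 < s" "0 \<le> d"
  shows "snd k < d"
proof (rule ccontr)
  assume "\<not> snd k < d"
  then have "d powr s \<le> snd k powr s" using assms by (intro powr_mono2) auto
  moreover have "snd k powr s \<le> cost s K"
    using assms by (auto simp: ball_cover_def intro: radius_powr_le_cost)
  ultimately show False using assms by simp
qed

lemma ball_cover_subset: "ball_cover K E \<Longrightarrow> E' \<subseteq> E \<Longrightarrow> ball_cover K E'"
  by (auto simp: ball_cover_def)

lemma ball_cover_UN:
  assumes "finite I" "\<And>i. i \<in> I \<Longrightarrow> ball_cover (K i) (E i)"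
  shows "ball_cover (\<Union>i\<in>I. K i) (\<Union>i\<in>I. E i)"
  unfolding ball_cover_def
proof (intro conjI)
  show "finite (\<Union>i\<in>I. K i)" "\<forall>k\<in>\<Union>i\<in>I. K i. 0 < snd k"
    using assms by (auto simp: ball_cover_def)
  show "(\<Union>i\<in>I. E i) \<subseteq> (\<Union>k\<in>\<Union>i\<in>I. K i. ball (fst k) (snd k))"
  proof
    fix x assume "x \<in> (\<Union>i\<in>I. E i)"
    then obtain i where i: "i \<in> I" "x \<in> E i" by blast
    then have "x \<in> (\<Union>k\<in>K i. ball (fst k) (snd k))"
      using assms(2)[OF i(1)] unfolding ball_cover_def by blast
    then show "x \<in> (\<Union>k\<in>\<Union>i\<in>I. K i. ball (fst k) (snd k))" using i(1) by blast
  qed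
qed

lemma sum_UN_le:
  fixes h :: "'b \<Rightarrow> real"
  assumes "finite I" "\<And>i. i \<in> I \<Longrightarrow> finite (A i)" "\<And>x. 0 \<le> h x"
  shows "sum h (\<Union>i\<in>I. A i) \<le> (\<Sum>i\<in>I. sum h (A i))"
  using assms
proof (induction I rule: finite_induct)
  case (insert i I)
  have "sum h (A i \<union> (\<Union>i\<in>I. A i)) \<le> sum h (A i) + sum h (\<Union>i\<in>I. A i)"
    using insert by (subst sum.union_inter[symmetric]) (auto intro: sum_nonneg)
  then show ?case using insert by force
qed simp

lemma cost_UN:
  assumes "finite I" "\<And>i. i \<in> I \<Longrightarrow> finite (K i)"
  shows "cost s (\<Union>i\<in>I. K i) \<le> (\<Sum>i\<in>I. cost s (K i))"
  unfolding cost_def by (rule sum_UN_le[OF assms]) auto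

definition img :: "(real ^ 'n \<Rightarrow> real ^ 'n) \<Rightarrow> ((real ^ 'n) \<times> real) set \<Rightarrow> ((real ^ 'n) \<times> real) set" where
  "img f K = (\<lambda>k. (f (fst k), ratio f * snd k)) ` K"

lemma ball_cover_img:
  assumes "f \<in> similitudes" "ball_cover K E"
  shows "ball_cover (img f K) (f ` E)"
proof -
  have "f ` E \<subseteq> (\<Union>k\<in>K. f ` ball (fst k) (snd k))"
    using assms(2) unfolding ball_cover_def by blast
  then show ?thesis
    using assms ratio_pos[OF assms(1)]
    by (auto simp: ball_cover_def img_def similitude_image_ball)
qed

lemma cost_img:
  assumes "f \<in> similitudes" "ball_cover K E"
  shows "cost s (img f K) \<le> ratio f powr s * cost s K"
proof -
  have "cost s (img f K) \<le> (\<Sum>k\<in>K. (ratio f * snd k) powr s)"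
    unfolding cost_def img_def
    by (rule order_trans[OF sum_image_le]) (use assms in \<open>auto simp: ball_cover_def o_def\<close>)
  also have "\<dots> = ratio f powr s * cost s K"
    unfolding cost_def sum_distrib_left
    using assms ratio_pos[OF assms(1)]
    by (intro sum.cong) (auto simp: ball_cover_def powr_mult)
  finally show ?thesis .
qed

text \<open>For radii below 1 the smaller exponent gives the larger power. A cover of cost less than
  1 has only such radii; the other covers are handled by the 1 in \<open>min c 1\<close>.\<close>

lemma pos_content_mono:
  assumes "pos_content t E" "0 < s" "s \<le> t"
  shows "pos_content s E"
proof -
  obtain c where c: "c > 0" "\<And>K. ball_cover K E \<Longrightarrow> c \<le> cost t K"
    using assms(1) unfolding pos_content_def by blast
  have "min c 1 \<le> cost s K" if K: "ball_cover K E" for K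
  proof (cases "cost s K < 1")
    case True
    have "snd k powr t \<le> snd k powr s" if "k \<in> K" for k
    proof (rule powr_mono')
      show "snd k \<le> 1" using radius_less[OF K that, of s 1] True assms(2) by simp
      show "0 \<le> snd k" using K that by (auto simp: ball_cover_def intro: less_imp_le)
    qed (rule assms)
    then have "cost t K \<le> cost s K" unfolding cost_def by (rule sum_mono)
    then show ?thesis using c(2)[OF K] by simp
  qed simp
  then show ?thesis unfolding pos_content_def using c(1) by (intro exI[of _ "min c 1"]) auto
qed

section \<open>Content, Hausdorff measure and Hausdorff dimension\<close>

lemma hausdorff_measure_pos:
  fixes F :: "(real ^ 'n) set"
  assumes F: "compact F" and pos: "pos_content s F" and s: "0 < s"
  shows "hausdorff_measure s F > 0"
proof -
  obtain c where c: "c > 0" "\<And>K. ball_cover K F \<Longrightarrow> c \<le> cost s K"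
    using pos unfolding pos_content_def by blast
  have "ennreal (c / 2) \<le> (\<Sum>i. diam_pow s (U i))"
    if U: "F \<subseteq> (\<Union>i. U i)" "\<And>i. bounded (U i)" for U :: "nat \<Rightarrow> (real ^ 'n) set"
  proof -
    define d where "d i = diameter (U i)" for i
    have d0: "0 \<le> d i" for i unfolding d_def using U(2) by (rule diameter_ge_0)
    \<comment> \<open>The sets are fattened to open balls so that compactness yields a finite cover.
      The extra costs add up to at most c / 2. Only right continuity of the power at
      \<open>d i\<close> is used, since \<open>d i\<close> may be 0.\<close>
    have "\<exists>e>0. (d i + e) powr s < d i powr s + c / 2 * (1 / 2) ^ Suc i" for i
    proof -
      have "((\<lambda>e. (d i + e) powr s) \<longlongrightarrow> (d i + 0) powr s) (at_right 0)"
        using s d0[of i]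
        by (intro tendsto_powr' tendsto_intros)
          (auto simp: eventually_at_right_field intro!: disjI2 exI[of _ 1])
      moreover have "(d i + 0) powr s < d i powr s + c / 2 * (1 / 2) ^ Suc i" using c by simp
      ultimately have "\<forall>\<^sub>F e in at_right 0. (d i + e) powr s < d i powr s + c / 2 * (1 / 2) ^ Suc i"
        by (rule order_tendstoD(2))
      moreover have "\<forall>\<^sub>F e in at_right (0::real). 0 < e" by (rule eventually_at_right_less)
      ultimately have "\<forall>\<^sub>F e in at_right 0. 0 < e \<and> (d i + e) powr s < d i powr s + c / 2 * (1 / 2) ^ Suc i"
        by eventually_elim simp
      then show ?thesis by (rule eventually_happens'[OF trivial_limit_at_right_real])
    qed
    then obtain e where e: "\<And>i. 0 < e i"
      "\<And>i. (d i + e i) powr s < d i powr s + c / 2 * (1 / 2) ^ Suc i" by metis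
    \<comment> \<open>For empty \<open>U i\<close> this value is arbitrary; the inclusion below is
      then vacuous, and only nonempty sets enter the finite subcover.\<close>
    define x where "x i = (SOME x. x \<in> U i)" for i
    have sub: "U i \<subseteq> ball (x i) (d i + e i)" for i
    proof
      fix y assume y: "y \<in> U i"
      then have "x i \<in> U i" unfolding x_def by (rule someI)
      then have "dist (x i) y \<le> d i" unfolding d_def using y U(2) by (intro diameter_bounded_bound)
      then show "y \<in> ball (x i) (d i + e i)" using e(1)[of i] by simp
    qed
    have "F \<subseteq> (\<Union>i\<in>{i. U i \<noteq> {}}. ball (x i) (d i + e i))" using U(1) sub by blast
    from compactE_image[OF F _ this] obtain I where I: "I \<subseteq> {i. U i \<noteq> {}}" "finite I"
      "F \<subseteq> (\<Union>i\<in>I. ball (x i) (d i + e i))" by auto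
    define K where "K = (\<lambda>i. (x i, d i + e i)) ` I"
    have "ball_cover K F"
      using I e(1) d0 unfolding ball_cover_def K_def by (auto intro: add_nonneg_pos)
    then have "c \<le> cost s K" by (rule c)
    also have "\<dots> \<le> (\<Sum>i\<in>I. (d i + e i) powr s)"
      unfolding cost_def K_def by (rule order_trans[OF sum_image_le]) (use I in \<open>auto simp: o_def\<close>)
    also have "\<dots> \<le> (\<Sum>i\<in>I. d i powr s + c / 2 * (1 / 2) ^ Suc i)"
      using e(2) by (intro sum_mono less_imp_le)
    also have "\<dots> = (\<Sum>i\<in>I. d i powr s) + c / 2 * (\<Sum>i\<in>I. (1 / 2) ^ Suc i)"
      by (simp add: sum.distrib sum_distrib_left)
    also have "(\<Sum>i\<in>I. (1 / 2 :: real) ^ Suc i) \<le> 1"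
      using sum_le_suminf[OF sums_summable[OF power_half_series] I(2)]
        sums_unique[OF power_half_series] by simp
    finally have "c / 2 \<le> (\<Sum>i\<in>I. d i powr s)" using c(1) by simp
    then have "ennreal (c / 2) \<le> ennreal (\<Sum>i\<in>I. d i powr s)" by (rule ennreal_leI)
    also have "\<dots> = (\<Sum>i\<in>I. diam_pow s (U i))"
    proof -
      have "(\<Sum>i\<in>I. diam_pow s (U i)) = (\<Sum>i\<in>I. ennreal (d i powr s))"
        using I(1) s by (intro sum.cong) (auto simp: diam_pow_def d_def)
      then show ?thesis by simp
    qed
    also have "\<dots> \<le> (\<Sum>i. diam_pow s (U i))" using I(2) by (intro sum_le_suminf) auto
    finally show ?thesis .
  qed
  then have "ennreal (c / 2) \<le> hausdorff_premeasure s 1 F"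
    unfolding hausdorff_premeasure_def by (intro Inf_greatest) auto
  also have "\<dots> \<le> hausdorff_measure s F"
    unfolding hausdorff_measure_def by (rule SUP_upper) simp
  finally show ?thesis using c(1) by (metis ennreal_less_zero_iff half_gt_zero order_less_le_trans)
qed

lemma hausdorff_measure_eq_0:
  fixes F :: "(real ^ 'n) set"
  assumes not_pos: "\<not> pos_content s F" and s: "0 < s"
  shows "hausdorff_measure s F = 0"
proof -
  have "hausdorff_premeasure s \<delta> F \<le> 0" if \<delta>: "\<delta> > 0" for \<delta>
  proof (rule ennreal_le_epsilon)
    fix \<epsilon> :: real assume \<epsilon>: "0 < \<epsilon>"
    \<comment> \<open>The first bound brings the sum of the powers of 2 * radius below \<epsilon>;
      the second forces every radius below \<delta> / 2, which gives the mesh condition.\<close>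
    have "0 < min (\<epsilon> / 2 powr s) ((\<delta> / 2) powr s)" using \<epsilon> \<delta> by auto
    then obtain K where K0: "ball_cover K F" "\<not> min (\<epsilon> / 2 powr s) ((\<delta> / 2) powr s) \<le> cost s K"
      using not_pos unfolding pos_content_def by blast
    then have K: "ball_cover K F" "cost s K < \<epsilon> / 2 powr s" "cost s K < (\<delta> / 2) powr s"
      by simp_all
    then have fin: "finite K" by (simp add: ball_cover_def)
    from ex_bij_betw_nat_finite[OF fin] obtain h where h: "bij_betw h {0..<card K} K" by blast
    define U where "U i = (if i < card K then ball (fst (h i)) (snd (h i)) else {})" for i
    have hK: "h i \<in> K" if "i < card K" for i using h that by (auto simp: bij_betw_def)
    have r: "0 < snd k" "snd k < \<delta> / 2" if "k \<in> K" for k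
      using K(1) that radius_less[OF K(1) that K(3) s] \<delta> by (auto simp: ball_cover_def)
    have "F \<subseteq> (\<Union>i. U i)"
    proof
      fix x assume "x \<in> F"
      then obtain k where k: "k \<in> K" "x \<in> ball (fst k) (snd k)" using K(1) by (auto simp: ball_cover_def)
      then have "k \<in> h ` {0..<card K}" using h by (simp add: bij_betw_def)
      then obtain i where "i < card K" "h i = k" by auto
      then show "x \<in> (\<Union>i. U i)" using k by (intro UN_I[of i]) (auto simp: U_def)
    qed
    moreover have "bounded (U i) \<and> diameter (U i) \<le> \<delta>" for i
      using \<delta> r[of "h i"] hK[of i] by (auto simp: U_def)
    ultimately have "hausdorff_premeasure s \<delta> F \<le> (\<Sum>i. diam_pow s (U i))"
      unfolding hausdorff_premeasure_def by (intro Inf_lower) blast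
    also have "\<dots> = (\<Sum>i<card K. diam_pow s (U i))"
      by (intro suminf_finite) (auto simp: U_def diam_pow_def)
    also have "\<dots> = (\<Sum>i<card K. ennreal ((2 * snd (h i)) powr s))"
      using r(1)[OF hK] s by (intro sum.cong) (force simp: U_def diam_pow_def)+
    also have "\<dots> = ennreal (\<Sum>i<card K. (2 * snd (h i)) powr s)" by (intro sum_ennreal) auto
    also have "(\<Sum>i<card K. (2 * snd (h i)) powr s) = (\<Sum>k\<in>K. (2 * snd k) powr s)"
      using sum.reindex_bij_betw[OF h, of "\<lambda>k. (2 * snd k) powr s"] by (simp add: lessThan_atLeast0)
    also have "\<dots> = 2 powr s * cost s K"
      unfolding cost_def sum_distrib_left
      by (intro sum.cong powr_mult) (use r in \<open>auto intro: less_imp_le\<close>)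
    also have "ennreal (2 powr s * cost s K) \<le> 0 + ennreal \<epsilon>"
      using K(2) by (simp add: field_simps ennreal_leI)
    finally show "hausdorff_premeasure s \<delta> F \<le> 0 + ennreal \<epsilon>" .
  qed
  then show ?thesis
    unfolding hausdorff_measure_def by (metis SUP_least greaterThan_iff le_zero_eq)
qed

lemma pos_content_below_dim:
  fixes F :: "(real ^ 'n) set"
  assumes "hausdorff_dim F = ereal s" "0 < t" "t < s"
  shows "pos_content t F"
proof (rule ccontr)
  assume "\<not> pos_content t F"
  then have "hausdorff_measure t F = 0" using assms(2) by (rule hausdorff_measure_eq_0)
  then have "hausdorff_dim F \<le> ereal t"
    unfolding hausdorff_dim_def using assms(2) by (intro Inf_lower) (auto intro: less_imp_le)
  then show False using assms by simp
qed

text \<open>Some exponent u < t has measure zero, and u > 0 because u is at least the dimension.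
  Positive content at t would descend to u and give positive measure there.\<close>

lemma not_pos_content_above_dim:
  fixes F :: "(real ^ 'n) set"
  assumes "hausdorff_dim F = ereal s" "0 < s" "s < t" "compact F"
  shows "\<not> pos_content t F"
proof
  assume pos: "pos_content t F"
  have "hausdorff_dim F < ereal t" using assms by simp
  then obtain u where u: "u < t" "hausdorff_measure u F = 0" "0 \<le> u"
    unfolding hausdorff_dim_def Inf_less_iff by auto
  have "hausdorff_dim F \<le> ereal u"
    unfolding hausdorff_dim_def using u by (intro Inf_lower) auto
  then have "0 < u" using assms by simp
  then have "hausdorff_measure u F > 0"
    using pos u by (intro hausdorff_measure_pos pos_content_mono[OF pos] assms) auto
  then show False using u by simp
qed

section \<open>Packing bound for disjoint pieces\<close>

lemma compact_disjoint_gap: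
  fixes A :: "'i \<Rightarrow> (real ^ 'n) set"
  assumes "finite I" "\<And>i. i \<in> I \<Longrightarrow> compact (A i)"
    and "\<And>i j. i \<in> I \<Longrightarrow> j \<in> I \<Longrightarrow> i \<noteq> j \<Longrightarrow> A i \<inter> A j = {}"
  obtains g where "g > 0"
    "\<And>i j x y. i \<in> I \<Longrightarrow> j \<in> I \<Longrightarrow> i \<noteq> j \<Longrightarrow> x \<in> A i \<Longrightarrow> y \<in> A j \<Longrightarrow> g \<le> dist x y"
proof -
  have "\<forall>p\<in>{p\<in>I \<times> I. fst p \<noteq> snd p}. \<exists>d>0. \<forall>x\<in>A (fst p). \<forall>y\<in>A (snd p). d \<le> dist x y"
    using assms by (auto intro!: separate_compact_closed compact_imp_closed)
  from bchoice[OF this] obtain d where d: "\<forall>p\<in>{p\<in>I \<times> I. fst p \<noteq> snd p}.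
      d p > 0 \<and> (\<forall>x\<in>A (fst p). \<forall>y\<in>A (snd p). d p \<le> dist x y)" by blast
  \<comment> \<open>The element 1 keeps the minimum meaningful when \<open>I\<close> has fewer than
    two elements.\<close>
  define D where "D = insert 1 (d ` {p\<in>I \<times> I. fst p \<noteq> snd p})"
  have D: "finite D" "D \<noteq> {}" unfolding D_def using assms(1) by auto
  show ?thesis
  proof
    show "Min D > 0" using D d by (subst Min_gr_iff) (auto simp: D_def)
    show "Min D \<le> dist x y" if "i \<in> I" "j \<in> I" "i \<noteq> j" "x \<in> A i" "y \<in> A j" for i j x y
    proof -
      have "Min D \<le> d (i, j)" using D(1) that by (intro Min_le) (auto simp: D_def)
      also have "\<dots> \<le> dist x y" using d that by fastforce
      finally show ?thesis .
    qed
  qed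
qed

context attractor
begin

text \<open>The maps in \<open>J\<close> satisfy the strong separation condition. A cover of cost below the
  separation distance splits into covers of the pieces, and rescaling the cheapest of them gives a
  cover with fewer balls, so that descent on the number of balls applies.\<close>

lemma packing:
  assumes s: "0 < s" and dim: "\<And>t. s < t \<Longrightarrow> \<not> pos_content t F"
    and J: "finite J" "J \<subseteq> maps Ss"
    and disj: "\<And>f g. f \<in> J \<Longrightarrow> g \<in> J \<Longrightarrow> f \<noteq> g \<Longrightarrow> f ` F \<inter> g ` F = {}"
  shows "(\<Sum>f\<in>J. ratio f powr s) \<le> 1"
proof (rule ccontr)
  assume gt: "\<not> (\<Sum>f\<in>J. ratio f powr s) \<le> 1"
  have sim: "f \<in> similitudes" "ratio f > 0" "ratio f \<le> 1" if "f \<in> J" for f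
    using that J maps_similitude ratio_pos maps_ratio_le_1 by (blast, blast, blast)
  \<comment> \<open>An excess over 1 at s survives at a slightly larger t, where the content of
    \<open>F\<close> is not positive. The contradiction will be the lower bound (g / 2) powr t for
    that content.\<close>
  have "((\<lambda>t. \<Sum>f\<in>J. ratio f powr t) \<longlongrightarrow> (\<Sum>f\<in>J. ratio f powr s)) (at_right s)"
    by (intro tendsto_intros) (use sim in force)
  moreover have "1 < (\<Sum>f\<in>J. ratio f powr s)" using gt by simp
  ultimately have "\<forall>\<^sub>F t in at_right s. 1 < (\<Sum>f\<in>J. ratio f powr t)" by (rule order_tendstoD(1))
  moreover have "\<forall>\<^sub>F t in at_right s. s < t" by (rule eventually_at_right_less)
  ultimately have "\<forall>\<^sub>F t in at_right s. s < t \<and> 1 < (\<Sum>f\<in>J. ratio f powr t)"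
    by eventually_elim simp
  then have "\<exists>t. s < t \<and> 1 < (\<Sum>f\<in>J. ratio f powr t)"
    by (rule eventually_happens'[OF trivial_limit_at_right_real])
  then obtain t where t: "s < t" "1 < (\<Sum>f\<in>J. ratio f powr t)" by blast
  \<comment> \<open>A second map makes the descent strict: the balls meeting its image are not among
    those meeting the image under f.\<close>
  have two: "\<exists>h\<in>J. h \<noteq> f" if f: "f \<in> J" for f
  proof (rule ccontr)
    assume "\<not> (\<exists>h\<in>J. h \<noteq> f)"
    then have "J = {f}" using f by blast
    moreover have "ratio f powr t \<le> 1" using sim[OF f] s t by (intro powr_le1) auto
    ultimately show False using t by simp
  qed
  obtain g where g: "g > 0"
    "\<And>f h x y. f \<in> J \<Longrightarrow> h \<in> J \<Longrightarrow> f \<noteq> h \<Longrightarrow> x \<in> f ` F \<Longrightarrow> y \<in> h ` F \<Longrightarrow> g \<le> dist x y"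
  proof (rule compact_disjoint_gap[of J "\<lambda>f. f ` F"])
    show "compact (f ` F)" if "f \<in> J" for f
      by (intro compact_continuous_image similitude_continuous sim that F_compact)
  qed (use J disj in auto)
  have "(g / 2) powr t \<le> cost t K" if "ball_cover K F" for K
    using that
  proof (induction "card K" arbitrary: K rule: less_induct)
    case less
    show ?case
    proof (rule ccontr)
      assume "\<not> ?case"
      then have small: "cost t K < (g / 2) powr t" by simp
      have finK: "finite K" using less.prems by (simp add: ball_cover_def)
      define Kf where "Kf f = {k\<in>K. ball (fst k) (snd k) \<inter> f ` F \<noteq> {}}" for f
      have cov: "ball_cover (Kf f) (f ` F)" if "f \<in> J" for f
      proof -
        have "f ` F \<subseteq> F" using that J maps_image by blast
        have "f ` F \<subseteq> (\<Union>k\<in>Kf f. ball (fst k) (snd k))"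
        proof
          fix y assume y: "y \<in> f ` F"
          then have "y \<in> (\<Union>k\<in>K. ball (fst k) (snd k))"
            using \<open>f ` F \<subseteq> F\<close> less.prems unfolding ball_cover_def by blast
          then obtain k where "k \<in> K" "y \<in> ball (fst k) (snd k)" by blast
          then show "y \<in> (\<Union>k\<in>Kf f. ball (fst k) (snd k))" using y unfolding Kf_def by blast
        qed
        then show ?thesis using less.prems by (auto simp: ball_cover_def Kf_def)
      qed
      have dis: "Kf f \<inter> Kf h = {}" if "f \<in> J" "h \<in> J" "f \<noteq> h" for f h
      proof (rule ccontr)
        assume "Kf f \<inter> Kf h \<noteq> {}"
        then obtain k where k: "k \<in> K" "ball (fst k) (snd k) \<inter> f ` F \<noteq> {}"
          "ball (fst k) (snd k) \<inter> h ` F \<noteq> {}" by (auto simp: Kf_def)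
        then obtain x y where "x \<in> f ` F" "x \<in> ball (fst k) (snd k)"
          "y \<in> h ` F" "y \<in> ball (fst k) (snd k)" by blast
        then have xy: "x \<in> f ` F" "dist (fst k) x < snd k" "y \<in> h ` F" "dist (fst k) y < snd k"
          by simp_all
        have "snd k < g / 2"
          using radius_less[OF less.prems k(1) small] s t g by simp
        then have "dist x y < g" using xy dist_triangle3[of x y "fst k"] by simp
        then show False using g(2)[OF that xy(1,3)] by simp
      qed
      have "(\<Sum>f\<in>J. cost t (Kf f)) = cost t (\<Union>f\<in>J. Kf f)"
        unfolding cost_def
        by (rule sum.UNION_disjoint[symmetric]) (use J finK dis in \<open>auto simp: Kf_def\<close>)
      also have "\<dots> \<le> cost t K" using finK by (intro cost_mono) (auto simp: Kf_def)
      also have "\<dots> < (g / 2) powr t" by (rule small)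
      also have "\<dots> \<le> (\<Sum>f\<in>J. ratio f powr t) * (g / 2) powr t"
          using mult_right_mono[of 1 "\<Sum>f\<in>J. ratio f powr t" "(g / 2) powr t"] t by simp
      also have "\<dots> = (\<Sum>f\<in>J. ratio f powr t * (g / 2) powr t)" by (rule sum_distrib_right)
      finally obtain f where f: "f \<in> J" "cost t (Kf f) < ratio f powr t * (g / 2) powr t"
        by (metis (no_types, lifting) not_le sum_mono)
      obtain h where h: "h \<in> J" "h \<noteq> f" using two[OF f(1)] by blast
      have "Kf h \<noteq> {}" using cov[OF h(1)] F_nonempty by (auto simp: ball_cover_def)
      moreover have "Kf f \<inter> Kf h = {}" using dis[OF f(1) h(1)] h(2) by simp
      moreover have "Kf f \<subseteq> K" "Kf h \<subseteq> K" by (auto simp: Kf_def)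
      ultimately have "Kf f \<subset> K" by blast
      then have "card (Kf f) < card K" using finK by (intro psubset_card_mono)
      moreover have "card (img (inv f) (Kf f)) \<le> card (Kf f)"
        unfolding img_def using finK by (intro card_image_le) (auto simp: Kf_def)
      ultimately have "card (img (inv f) (Kf f)) < card K" by simp
      moreover have inv: "inv f \<in> similitudes" "ratio (inv f) = 1 / ratio f"
        using similitude_inverse sim f(1) by blast+
      moreover have "inv f ` f ` F = F"
        using similitude_inj[OF sim(1)[OF f(1)]] by (rule image_inv_f_f)
      then have "ball_cover (img (inv f) (Kf f)) F"
        using ball_cover_img[OF inv(1) cov[OF f(1)]] by simp
      ultimately have "(g / 2) powr t \<le> cost t (img (inv f) (Kf f))" using less.hyps by blast
      also have "\<dots> \<le> (1 / ratio f) powr t * cost t (Kf f)"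
        using cost_img[OF inv(1) cov[OF f(1)], of t] inv(2) by simp
      also have "\<dots> < (1 / ratio f) powr t * (ratio f powr t * (g / 2) powr t)"
        using f sim(2)[OF f(1)] by (intro mult_strict_left_mono) auto
      also have "\<dots> = (g / 2) powr t" using sim(2)[OF f(1)] by (simp add: powr_divide)
      finally show False by simp
    qed
  qed
  then have "pos_content t F" unfolding pos_content_def using g(1) by (intro exI[of _ "(g/2) powr t"]) auto
  then show False using dim t(1) by blast
qed

end

section \<open>Bounds for the Assouad dimension\<close>

lemma separated_card:
  fixes X :: "'a::metric_space set"
  assumes sep: "\<And>x y. x \<in> X \<Longrightarrow> y \<in> X \<Longrightarrow> x \<noteq> y \<Longrightarrow> d \<le> dist x y"
    and cov: "X \<subseteq> (\<Union>a\<in>A. cball a r)" and A: "finite A" and r: "2 * r < d"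
  shows "finite X" "card X \<le> card A"
proof -
  have "\<forall>x\<in>X. \<exists>a. a \<in> A \<and> x \<in> cball a r" using cov by blast
  from bchoice[OF this] obtain h where h: "\<forall>x\<in>X. h x \<in> A \<and> x \<in> cball (h x) r" by blast
  have inj: "inj_on h X"
  proof (rule inj_onI, rule ccontr)
    fix x y assume xy: "x \<in> X" "y \<in> X" "h x = h y" "x \<noteq> y"
    have "dist x y \<le> dist (h x) x + dist (h x) y" by (rule dist_triangle3)
    also have "\<dots> \<le> r + r" using h xy by (intro add_mono) (metis mem_cball)+
    finally show False using sep[OF xy(1,2,4)] r by simp
  qed
  have "h ` X \<subseteq> A" using h by blast
  then show "finite X" "card X \<le> card A"
    using inj A inj_on_finite card_inj_on_le by blast+
qed

text \<open>A separated subset of largest cardinality is a net, since an uncovered point could be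
  added. Cardinalities are bounded because a ball of radius d / 3 holds at most one point of a
  d-separated set.\<close>

lemma separated_net:
  fixes E :: "(real ^ 'n) set"
  assumes E: "bounded E" and d: "0 < d"
  obtains X where "finite X" "X \<subseteq> E" "\<forall>x\<in>X. \<forall>y\<in>X. x \<noteq> y \<longrightarrow> d \<le> dist x y"
    "E \<subseteq> (\<Union>x\<in>X. ball x d)"
proof -
  define P where "P X \<longleftrightarrow> X \<subseteq> E \<and> (\<forall>x\<in>X. \<forall>y\<in>X. x \<noteq> y \<longrightarrow> d \<le> dist x y)" for X
  have comp: "compact (closure E)" using E by simp
  have "closure E \<subseteq> (\<Union>a\<in>closure E. ball a (d / 3))" using d by auto
  from compactE_image[OF comp _ this]
  obtain A where A: "finite A" "closure E \<subseteq> (\<Union>a\<in>A. ball a (d / 3))"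
    by (metis open_ball)
  have EA: "E \<subseteq> (\<Union>a\<in>A. cball a (d / 3))"
  proof
    fix x assume "x \<in> E"
    then have "x \<in> (\<Union>a\<in>A. ball a (d / 3))" using A(2) closure_subset by blast
    then obtain a where "a \<in> A" "dist a x < d / 3" by auto
    then show "x \<in> (\<Union>a\<in>A. cball a (d / 3))" by (intro UN_I[of a]) auto
  qed
  have bd: "finite X \<and> card X < Suc (card A)" if "P X" for X
    using separated_card[where X = X and d = d and A = A and r = "d / 3"] that EA A(1) d unfolding P_def by force
  have "P {}" by (simp add: P_def)
  then obtain X where X: "P X" "\<And>Y. P Y \<Longrightarrow> card Y \<le> card X"
    using ex_has_greatest_nat[of P "{}" card "Suc (card A)"] bd by blast
  have "E \<subseteq> (\<Union>x\<in>X. ball x d)"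
  proof (rule ccontr)
    assume "\<not> ?thesis"
    then obtain y where y: "y \<in> E" "\<And>x. x \<in> X \<Longrightarrow> d \<le> dist x y" by force
    have "y \<notin> X" using y(2)[of y] d by auto
    have "P (insert y X)" using X(1) y unfolding P_def by (simp add: dist_commute)
    then have "card (insert y X) \<le> card X" by (rule X(2))
    then show False using \<open>y \<notin> X\<close> bd[OF X(1)] by simp
  qed
  then show ?thesis using that[of X] X(1) bd[OF X(1)] unfolding P_def by blast
qed

text \<open>The infimum in \<open>covering_number\<close> is taken over extended naturals: it is
  attained by an actual cover unless no finite cover exists, and then it is infinite, which the real
  bound excludes.\<close>

lemma assouad_dim_lessD:
  fixes E :: "'a::metric_space set"
  assumes "assouad_dim E < ereal b"
  obtains \<alpha> c where "\<alpha> < b"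
    "\<And>r R x. 0 < r \<Longrightarrow> r < R \<Longrightarrow> x \<in> E \<Longrightarrow>
      \<exists>A. finite A \<and> cball x R \<inter> E \<subseteq> (\<Union>a\<in>A. cball a r) \<and> real (card A) \<le> c * (R / r) powr \<alpha>"
proof -
  obtain \<alpha> c where \<alpha>: "\<alpha> < b"
    and c: "\<And>r R. 0 < r \<and> r < R \<Longrightarrow>
      (SUP x\<in>E. ereal_of_enat (covering_number r (cball x R \<inter> E))) \<le> ereal (c * (R / r) powr \<alpha>)"
  proof -
    obtain y where "y < ereal b" "y \<in> {ereal \<alpha> | \<alpha>. \<exists>c::real. \<forall>r R. 0 < r \<and> r < R \<longrightarrow>
        (SUP x\<in>E. ereal_of_enat (covering_number r (cball x R \<inter> E))) \<le> ereal (c * (R / r) powr \<alpha>)}"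
      using assms unfolding assouad_dim_def Inf_less_iff by blast
    then obtain \<alpha> c where "y = ereal \<alpha>" "\<forall>r R. 0 < r \<and> r < R \<longrightarrow>
        (SUP x\<in>E. ereal_of_enat (covering_number r (cball x R \<inter> E))) \<le> ereal (c * (R / r) powr \<alpha>)"
      by blast
    then show ?thesis using that[of \<alpha> c] \<open>y < ereal b\<close> by simp
  qed
  have "\<exists>A. finite A \<and> cball x R \<inter> E \<subseteq> (\<Union>a\<in>A. cball a r) \<and> real (card A) \<le> c * (R / r) powr \<alpha>"
    if "0 < r" "r < R" "x \<in> E" for r R x
  proof -
    let ?S = "{enat (card A) | A. finite A \<and> cball x R \<inter> E \<subseteq> (\<Union>a\<in>A. cball a r)}"
    have le: "ereal_of_enat (covering_number r (cball x R \<inter> E)) \<le> ereal (c * (R / r) powr \<alpha>)"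
      using c[of r R] that by (simp add: SUP_le_iff)
    have "?S \<noteq> {}"
    proof
      assume "?S = {}"
      then have "covering_number r (cball x R \<inter> E) = \<infinity>"
        unfolding covering_number_def by (simp add: Inf_enat_def)
      then show False using le by simp
    qed
    moreover from this have "Inf ?S = (LEAST k. k \<in> ?S)" by (simp only: Inf_enat_def if_False)
    ultimately have "covering_number r (cball x R \<inter> E) \<in> ?S"
      unfolding covering_number_def by (metis (no_types, lifting) LeastI ex_in_conv)
    then obtain A where "finite A" "cball x R \<inter> E \<subseteq> (\<Union>a\<in>A. cball a r)"
      "covering_number r (cball x R \<inter> E) = enat (card A)" by blast
    then show ?thesis using le by (intro exI[of _ A]) simp
  qed
  then show ?thesis using that \<alpha> by blast
qed

lemma assouad_dim_le:
  fixes E :: "'a::metric_space set"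
  assumes "\<And>r R x. 0 < r \<Longrightarrow> r < R \<Longrightarrow> x \<in> E \<Longrightarrow>
      \<exists>A. finite A \<and> cball x R \<inter> E \<subseteq> (\<Union>a\<in>A. cball a r) \<and> real (card A) \<le> c * (R / r) powr \<alpha>"
  shows "assouad_dim E \<le> ereal \<alpha>"
proof -
  have "(SUP x\<in>E. ereal_of_enat (covering_number r (cball x R \<inter> E))) \<le> ereal (c * (R / r) powr \<alpha>)"
    if rR: "0 < r" "r < R" for r R :: real
  proof (rule SUP_least)
    fix x assume x: "x \<in> E"
    obtain A where A: "finite A" "cball x R \<inter> E \<subseteq> (\<Union>a\<in>A. cball a r)"
      "real (card A) \<le> c * (R / r) powr \<alpha>"
      using assms[OF rR x] by blast
    have "covering_number r (cball x R \<inter> E) \<le> enat (card A)"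
      unfolding covering_number_def using A by (intro Inf_lower) blast
    then have "ereal_of_enat (covering_number r (cball x R \<inter> E)) \<le> ereal_of_enat (enat (card A))"
      by (simp only: ereal_of_enat_le_iff)
    also have "\<dots> \<le> ereal (c * (R / r) powr \<alpha>)" using A(3) by simp
    finally show "ereal_of_enat (covering_number r (cball x R \<inter> E)) \<le> ereal (c * (R / r) powr \<alpha>)" .
  qed
  then show ?thesis unfolding assouad_dim_def by (intro Inf_lower) blast
qed

context attractor
begin

lemma map_dist:
  assumes "f \<in> maps Ss" "x \<in> f ` F" "y \<in> f ` F"
  shows "dist x y < 2 * rad * ratio f"
proof -
  obtain a b where "a \<in> F" "b \<in> F" "x = f a" "y = f b" using assms by blast
  then show ?thesis
    using F_dist[of a b] similitude_dist[OF maps_similitude[OF assms(1)], of a b]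
      ratio_pos[OF maps_similitude[OF assms(1)]] by simp
qed

text \<open>Take a finite family \<open>J\<close> for which the images \<open>(b \<circ> f) ` F\<close> are pairwise disjoint and
  the packing sum is almost maximal. Replacing the pieces \<open>b ` f ` F\<close>, \<open>f \<in> J0\<close>, by the single
  ball \<open>b ` ball z R\<close> covers \<open>F\<close> up to a set of small content, since otherwise small pieces of
  \<open>F\<close> meeting the uncovered compact set could be added to \<open>J\<close>.\<close>

lemma disjoint_pieces_in_ball:
  assumes s: "0 < s" and dim: "\<And>t. s < t \<Longrightarrow> \<not> pos_content t F"
    and c: "\<And>K. ball_cover K F \<Longrightarrow> c \<le> cost s K"
    and J0: "finite J0" "J0 \<subseteq> maps Ss"
    and disj: "\<And>f g. f \<in> J0 \<Longrightarrow> g \<in> J0 \<Longrightarrow> f \<noteq> g \<Longrightarrow> f ` F \<inter> g ` F = {}"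
    and ball: "\<And>f. f \<in> J0 \<Longrightarrow> f ` F \<subseteq> ball z R"
  shows "c * (\<Sum>f\<in>J0. ratio f powr s) \<le> R powr s"
proof (cases "J0 = {}")
  case False
  then obtain f0 where f0: "f0 \<in> J0" by blast
  obtain p0 where p0: "p0 \<in> F" using F_nonempty by blast
  have "f0 p0 \<in> ball z R" using ball f0 p0 by blast
  then have R: "0 < R" by (metis ball_eq_empty empty_iff not_le)
  define \<sigma> where "\<sigma> = (\<Sum>f\<in>J0. ratio f powr s)"
  have sim: "f \<in> similitudes" "ratio f > 0" if "f \<in> maps Ss" for f
    using that maps_similitude ratio_pos by blast+
  have \<sigma>: "0 < \<sigma>" unfolding \<sigma>_def using J0 f0 sim(2) by (intro sum_pos) force+
  define S where "S J = (\<Sum>b\<in>J. ratio b powr s)" for J :: "(real ^ 'n \<Rightarrow> real ^ 'n) set"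
  define good where "good J \<longleftrightarrow> finite J \<and> J \<subseteq> maps Ss \<and>
    (\<forall>b\<in>J. \<forall>f\<in>J0. \<forall>b'\<in>J. \<forall>f'\<in>J0. (b, f) \<noteq> (b', f') \<longrightarrow> b ` f ` F \<inter> b' ` f' ` F = {})" for J
  \<comment> \<open>The maps b \<circ> f have pairwise disjoint images, so the packing bound applies
    to the product family and gives S J * \<sigma> \<le> 1. In particular the supremum used below is
    finite.\<close>
  have bound: "S J \<le> 1 / \<sigma>" if J: "good J" for J
  proof -
    let ?h = "\<lambda>(b, f). b \<circ> f"
    have dj: "?h p ` F \<inter> ?h q ` F = {}" if "p \<in> J \<times> J0" "q \<in> J \<times> J0" "p \<noteq> q" for p q
    proof -
      obtain b f b' f' where pq: "p = (b, f)" "q = (b', f')" by (metis surj_pair)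
      then have "b ` f ` F \<inter> b' ` f' ` F = {}" using J that unfolding good_def by blast
      then show ?thesis unfolding pq split image_comp .
    qed
    have inj: "inj_on ?h (J \<times> J0)"
    proof (rule inj_onI, rule ccontr)
      fix p q assume pq: "p \<in> J \<times> J0" "q \<in> J \<times> J0" "?h p = ?h q" "p \<noteq> q"
      have "?h p ` F = {}" using dj[OF pq(1,2,4)] unfolding pq(3) by blast
      then show False using F_nonempty by blast
    qed
    have "(\<Sum>g\<in>?h ` (J \<times> J0). ratio g powr s) \<le> 1"
    proof (rule packing[OF s dim])
      show "finite (?h ` (J \<times> J0))" using J J0 by (simp add: good_def)
      have "b \<circ> f \<in> maps Ss" if "b \<in> J" "f \<in> J0" for b f
      proof (rule maps_comp)
        have "J \<subseteq> maps Ss" using J by (simp add: good_def)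
        then show "b \<in> maps Ss" using that by blast
        show "f \<in> maps Ss" using that J0 by blast
      qed
      then show "?h ` (J \<times> J0) \<subseteq> maps Ss" by auto
      show "f ` F \<inter> g ` F = {}"
        if "f \<in> ?h ` (J \<times> J0)" "g \<in> ?h ` (J \<times> J0)" "f \<noteq> g" for f g
        using that dj by blast
    qed
    also have "(\<Sum>g\<in>?h ` (J \<times> J0). ratio g powr s) = (\<Sum>p\<in>J \<times> J0. ratio (fst p) powr s * ratio (snd p) powr s)"
      unfolding sum.reindex[OF inj]
    proof (rule sum.cong[OF refl])
      fix p assume "p \<in> J \<times> J0"
      then have "fst p \<in> maps Ss" "snd p \<in> maps Ss" using J J0 by (auto simp: good_def)
      then show "((\<lambda>g. ratio g powr s) \<circ> ?h) p = ratio (fst p) powr s * ratio (snd p) powr s"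
        using sim ratio_comp[of "fst p" "snd p"]
        by (simp add: case_prod_beta powr_mult less_imp_le)
    qed
    also have "\<dots> = S J * \<sigma>"
      unfolding S_def \<sigma>_def sum_product sum.cartesian_product by (simp add: case_prod_beta)
    finally show ?thesis using \<sigma> by (simp add: field_simps)
  qed
  have "c \<le> R powr s / \<sigma> + \<epsilon>" if \<epsilon>: "0 < \<epsilon>" for \<epsilon>
  proof -
    \<comment> \<open>This converts gains into costs: an added piece contributes at least (cmin * r)
      powr s, which is d powr s * (cmin / (5 * rad)) powr s for the net distance d below. A gain
      less than \<kappa> thus means that the balls of the net cost less than \<epsilon>.\<close>
    define \<kappa> where "\<kappa> = \<epsilon> * (cmin / (5 * rad)) powr s"
    have \<kappa>: "0 < \<kappa>" using \<epsilon> cmin(1) rad(1) by (simp add: \<kappa>_def)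
    have ne: "S ` {J. good J} \<noteq> {}" by (auto simp: good_def intro!: exI[of _ "{}"])
    have bdd: "bdd_above (S ` {J. good J})" using bound by (intro bdd_aboveI[of _ "1 / \<sigma>"]) auto
    have "Sup (S ` {J. good J}) - \<kappa> < Sup (S ` {J. good J})" using \<kappa> by simp
    then obtain J where J: "good J" "Sup (S ` {J. good J}) - \<kappa> < S J"
      using less_cSupE[OF _ ne] by (smt (verit) image_iff mem_Collect_eq)
    have max: "S J' < S J + \<kappa>" if "good J'" for J'
      using cSup_upper[OF _ bdd, of "S J'"] that J(2) by fastforce
    have Jm: "J \<subseteq> maps Ss" "finite J" using J(1) by (auto simp: good_def)
    define V where "V = F - (\<Union>b\<in>J. ball (b z) (ratio b * R))"
    define W where "W = (\<Union>b\<in>J. \<Union>f\<in>J0. b ` f ` F)"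
    have cF: "compact (f ` F)" if "f \<in> maps Ss" for f
      by (intro compact_continuous_image similitude_continuous sim that F_compact)
    have V: "compact V" unfolding V_def by (intro compact_diff F_compact) auto
    have W: "compact W" unfolding W_def
      by (intro compact_UN Jm J0 compact_continuous_image similitude_continuous sim cF)
        (use Jm J0 in auto)
    have "V \<inter> W = {}"
    proof -
      have "b ` f ` F \<subseteq> ball (b z) (ratio b * R)" if "b \<in> J" "f \<in> J0" for b f
        using similitude_image_ball[of b z R] sim that Jm ball[OF that(2)] by (metis image_mono subsetD)
      then show ?thesis unfolding V_def W_def by blast
    qed
    then obtain g where g: "g > 0" "\<And>x y. x \<in> V \<Longrightarrow> y \<in> W \<Longrightarrow> g \<le> dist x y"
      using separate_compact_closed[OF V compact_imp_closed[OF W]] by blast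
    \<comment> \<open>Two points of a piece of ratio at most r are less than 2 * rad * r \<le> g
      apart, so a piece meeting V misses W.\<close>
    define r where "r = min 1 (g / (2 * rad))"
    have r: "0 < r" "r \<le> 1" "2 * rad * r \<le> g"
      using g(1) rad(1) by (auto simp: r_def min_def field_simps)
    have "\<forall>x\<in>V. \<exists>f. f \<in> maps Ss \<and> x \<in> f ` F \<and> cmin * r \<le> ratio f \<and> ratio f \<le> r"
    proof
      fix x assume "x \<in> V"
      then have "x \<in> F" by (simp add: V_def)
      then obtain f where "f \<in> maps Ss" "x \<in> f ` F" "cmin * r \<le> ratio f" "ratio f \<le> r"
        by (rule piece[OF _ r(1,2)])
      then show "\<exists>f. f \<in> maps Ss \<and> x \<in> f ` F \<and> cmin * r \<le> ratio f \<and> ratio f \<le> r" by blast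
    qed
    from bchoice[OF this] obtain p where
      p: "\<And>x. x \<in> V \<Longrightarrow> p x \<in> maps Ss" "\<And>x. x \<in> V \<Longrightarrow> x \<in> p x ` F"
        "\<And>x. x \<in> V \<Longrightarrow> cmin * r \<le> ratio (p x)" "\<And>x. x \<in> V \<Longrightarrow> ratio (p x) \<le> r" by blast
    have near: "dist x y < 2 * rad * r" if "x \<in> V" "y \<in> p x ` F" for x y
    proof -
      have "dist x y < 2 * rad * ratio (p x)" using p that by (intro map_dist) auto
      also have "\<dots> \<le> 2 * rad * r" using p(4)[OF that(1)] rad(1) by (intro mult_left_mono) auto
      finally show ?thesis .
    qed
    \<comment> \<open>Pieces that met would have base points less than 4 * rad * r apart; the factor
      5 excludes this.\<close>
    define d where "d = 5 * rad * r"
    have d: "0 < d" using r rad(1) by (simp add: d_def)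
    obtain X where X: "finite X" "X \<subseteq> V" "\<forall>x\<in>X. \<forall>y\<in>X. x \<noteq> y \<longrightarrow> d \<le> dist x y"
      "V \<subseteq> (\<Union>x\<in>X. ball x d)"
      by (rule separated_net[OF compact_imp_bounded[OF V] d])
    have pp: "p x ` F \<inter> p y ` F = {}" if "x \<in> X" "y \<in> X" "x \<noteq> y" for x y
    proof (rule ccontr)
      assume "p x ` F \<inter> p y ` F \<noteq> {}"
      then obtain u where "u \<in> p x ` F" "u \<in> p y ` F" by blast
      then have "dist x u < 2 * rad * r" "dist y u < 2 * rad * r" using near X(2) that by blast+
      then have "dist x y < 2 * rad * r + 2 * rad * r" using dist_triangle2[of x y u] by linarith
      moreover have "2 * rad * r + 2 * rad * r \<le> d" using r(1) rad(1) by (simp add: d_def)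
      ultimately show False using X(3) that by force
    qed
    have pW: "p x ` F \<inter> W = {}" if "x \<in> X" for x
    proof (rule ccontr)
      assume "p x ` F \<inter> W \<noteq> {}"
      then obtain u where u: "u \<in> p x ` F" "u \<in> W" by blast
      have "x \<in> V" using X(2) that by blast
      then show False using near[OF _ u(1)] g(2)[OF _ u(2)] r(3) by force
    qed
    have inj: "inj_on p X"
    proof (rule inj_onI, rule ccontr)
      fix x y assume xy: "x \<in> X" "y \<in> X" "p x = p y" "x \<noteq> y"
      have "p x ` F = {}" using pp[OF xy(1,2,4)] unfolding xy(3) by blast
      then show False using F_nonempty by blast
    qed
    have JX: "J \<inter> p ` X = {}"
    proof (rule ccontr)
      assume "J \<inter> p ` X \<noteq> {}"
      then obtain x where x: "x \<in> X" "p x \<in> J" by blast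
      have "f0 p0 \<in> F" using maps_image f0 p0 J0 by blast
      then have "p x (f0 p0) \<in> p x ` F \<inter> W" unfolding W_def using x f0 p0 by blast
      then show False using pW[OF x(1)] by blast
    qed
    have pX: "p ` X \<subseteq> maps Ss" using X(2) p(1) by blast
    have "good (J \<union> p ` X)"
      unfolding good_def
    proof (intro conjI ballI impI)
      show "finite (J \<union> p ` X)" "J \<union> p ` X \<subseteq> maps Ss" using Jm X(1) pX by auto
      fix b f b' f' assume *: "b \<in> J \<union> p ` X" "f \<in> J0" "b' \<in> J \<union> p ` X" "f' \<in> J0" "(b, f) \<noteq> (b', f')"
      have fF: "f ` F \<subseteq> F" "f' ` F \<subseteq> F" using * J0 maps_image by blast+
      consider "b = b'" | "b \<noteq> b'" "b \<in> J" "b' \<in> J" | "b \<in> J" "b' \<in> p ` X"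
        | "b \<in> p ` X" "b' \<in> J" | "b \<noteq> b'" "b \<in> p ` X" "b' \<in> p ` X"
        using *(1,3) by (cases "b = b'") auto
      then show "b ` f ` F \<inter> b' ` f' ` F = {}"
      proof cases
        case 1
        have "b \<in> maps Ss" using *(1) Jm(1) pX by blast
        then have "b \<in> similitudes" by (rule sim)
        then have "b ` (f ` F) \<inter> b ` (f' ` F) = b ` (f ` F \<inter> f' ` F)"
          by (intro image_Int[symmetric] similitude_inj)
        then show ?thesis using 1 * disj by simp
      next
        case 2
        then show ?thesis using J(1) *(2,4) unfolding good_def by blast
      next
        case 3
        then have "b ` f ` F \<subseteq> W" using *(2) unfolding W_def by blast
        moreover have "b' ` F \<inter> W = {}" using 3 pW by blast
        ultimately show ?thesis using fF by blast
      next
        case 4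
        then have "b' ` f' ` F \<subseteq> W" using *(4) unfolding W_def by blast
        moreover have "b ` F \<inter> W = {}" using 4 pW by blast
        ultimately show ?thesis using fF by blast
      next
        case 5
        then have "b ` F \<inter> b' ` F = {}" using pp by blast
        then show ?thesis using fF by blast
      qed
    qed
    then have "S (J \<union> p ` X) < S J + \<kappa>" by (rule max)
    moreover have "S (J \<union> p ` X) = S J + (\<Sum>x\<in>X. ratio (p x) powr s)"
      unfolding S_def by (subst sum.union_disjoint) (use Jm X JX inj in \<open>auto simp: sum.reindex\<close>)
    moreover have "real (card X) * (cmin * r) powr s \<le> (\<Sum>x\<in>X. ratio (p x) powr s)"
    proof -
      have "(\<Sum>x\<in>X. (cmin * r) powr s) \<le> (\<Sum>x\<in>X. ratio (p x) powr s)"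
        using p(3) X(2) s r(1) cmin(1) by (intro sum_mono powr_mono2) auto
      then show ?thesis by simp
    qed
    ultimately have "real (card X) * (cmin * r) powr s < \<kappa>" by simp
    moreover have "(cmin * r) powr s = d powr s * (cmin / (5 * rad)) powr s"
      using r(1) cmin(1) rad(1) by (subst powr_mult[symmetric]) (auto simp: d_def field_simps)
    ultimately have "(real (card X) * d powr s) * (cmin / (5 * rad)) powr s
        < \<epsilon> * (cmin / (5 * rad)) powr s" by (simp add: \<kappa>_def mult.assoc)
    then have small: "real (card X) * d powr s < \<epsilon>" by (rule mult_right_less_imp_less) simp
    define K where "K = (\<lambda>x. (x, d)) ` X \<union> (\<lambda>b. (b z, ratio b * R)) ` J"
    have "ball_cover K F"
    proof -
      have "F \<subseteq> (\<Union>k\<in>K. ball (fst k) (snd k))"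
        using X(4) unfolding V_def K_def by auto
      moreover have "0 < snd k" if "k \<in> K" for k
        using that d R Jm sim(2) unfolding K_def by auto
      ultimately show ?thesis using X(1) Jm by (simp add: ball_cover_def K_def)
    qed
    then have "c \<le> cost s K" by (rule c)
    also have "\<dots> \<le> cost s ((\<lambda>x. (x, d)) ` X) + cost s ((\<lambda>b. (b z, ratio b * R)) ` J)"
      unfolding K_def using X(1) Jm by (intro cost_Un) auto
    also have "\<dots> \<le> (\<Sum>x\<in>X. d powr s) + (\<Sum>b\<in>J. (ratio b * R) powr s)"
      unfolding cost_def
      by (intro add_mono order_trans[OF sum_image_le]) (use X(1) Jm in \<open>auto simp: o_def\<close>)
    also have "(\<Sum>b\<in>J. (ratio b * R) powr s) = S J * R powr s"
      unfolding S_def sum_distrib_right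
      by (intro sum.cong powr_mult) (use R Jm sim(2) in \<open>auto intro: less_imp_le\<close>)
    also have "\<dots> \<le> 1 / \<sigma> * R powr s" using bound[OF J(1)] by (intro mult_right_mono) auto
    finally show "c \<le> R powr s / \<sigma> + \<epsilon>" using small by simp
  qed
  then have "c \<le> R powr s / \<sigma>" by (rule field_le_epsilon)
  then show ?thesis using \<sigma> by (simp add: field_simps \<sigma>_def)
qed simp

text \<open>An r-separated net of \<open>F\<close> inside a ball of radius R carries pairwise
  disjoint pieces of ratio comparable to r, all within the concentric ball of radius 2 * R. The
  bound for such clusters limits the size of the net.\<close>

lemma assouad_dim_upper:
  assumes s: "0 < s" and dim: "\<And>t. s < t \<Longrightarrow> \<not> pos_content t F" and pos: "pos_content s F"
  shows "assouad_dim F \<le> ereal s"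
proof -
  obtain c where c: "c > 0" "\<And>K. ball_cover K F \<Longrightarrow> c \<le> cost s K"
    using pos unfolding pos_content_def by blast
  define C where "C = max 1 ((10 * rad / cmin) powr s / c)"
  show ?thesis
  proof (rule assouad_dim_le)
    fix r R :: real and x assume r: "0 < r" "r < R" and x: "x \<in> F"
    show "\<exists>A. finite A \<and> cball x R \<inter> F \<subseteq> (\<Union>a\<in>A. cball a r) \<and> real (card A) \<le> C * (R / r) powr s"
    proof (cases "2 * rad \<le> r")
      case True
      \<comment> \<open>At this scale one ball covers \<open>F\<close>; the 1 in the definition of
        \<open>C\<close> serves this case.\<close>
      have "F \<subseteq> cball x r" using F_dist[OF x] True by (force intro: less_imp_le)
      moreover have "1 \<le> C * (R / r) powr s"
      proof -
        have "1 * 1 \<le> C * (R / r) powr s"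
          using s r by (intro mult_mono ge_one_powr_ge_zero) (auto simp: C_def)
        then show ?thesis by simp
      qed
      ultimately show ?thesis by (intro exI[of _ "{x}"]) auto
    next
      case False
      \<comment> \<open>A piece through a net point stays within 2 * rad * r' = 2 * r / 5 < r / 2 of
        it, so pieces through different net points are disjoint.\<close>
      define r' where "r' = r / (5 * rad)"
      have r': "0 < r'" "r' \<le> 1" "2 * rad * r' < r / 2" "r = 5 * rad * r'"
        using r rad(1) False by (auto simp: r'_def field_simps)
      have "bounded (cball x R \<inter> F)" by (simp add: bounded_Int)
      then obtain X where X: "finite X" "X \<subseteq> cball x R \<inter> F"
        "\<forall>x\<in>X. \<forall>y\<in>X. x \<noteq> y \<longrightarrow> r \<le> dist x y"
        "cball x R \<inter> F \<subseteq> (\<Union>x\<in>X. ball x r)"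
        using r(1) by (rule separated_net)
      have "\<forall>y\<in>X. \<exists>f. f \<in> maps Ss \<and> y \<in> f ` F \<and> cmin * r' \<le> ratio f \<and> ratio f \<le> r'"
      proof
        fix y assume "y \<in> X"
        then have "y \<in> F" using X(2) by blast
        then obtain f where "f \<in> maps Ss" "y \<in> f ` F" "cmin * r' \<le> ratio f" "ratio f \<le> r'"
          by (rule piece[OF _ r'(1,2)])
        then show "\<exists>f. f \<in> maps Ss \<and> y \<in> f ` F \<and> cmin * r' \<le> ratio f \<and> ratio f \<le> r'" by blast
      qed
      from bchoice[OF this] obtain p where
        p: "\<And>y. y \<in> X \<Longrightarrow> p y \<in> maps Ss" "\<And>y. y \<in> X \<Longrightarrow> y \<in> p y ` F"
          "\<And>y. y \<in> X \<Longrightarrow> cmin * r' \<le> ratio (p y)" "\<And>y. y \<in> X \<Longrightarrow> ratio (p y) \<le> r'" by blast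
      have near: "dist y u < r / 2" if "y \<in> X" "u \<in> p y ` F" for y u
      proof -
        have "dist y u < 2 * rad * ratio (p y)" using p that by (intro map_dist) auto
        also have "\<dots> \<le> 2 * rad * r'" using p(4)[OF that(1)] rad(1) by (intro mult_left_mono) auto
        finally show ?thesis using r'(3) by simp
      qed
      have pp: "p y ` F \<inter> p y' ` F = {}" if "y \<in> X" "y' \<in> X" "y \<noteq> y'" for y y'
      proof (rule ccontr)
        assume "p y ` F \<inter> p y' ` F \<noteq> {}"
        then obtain u where "u \<in> p y ` F" "u \<in> p y' ` F" by blast
        then have "dist y u < r / 2" "dist y' u < r / 2" using near that by blast+
        then have "dist y y' < r" using dist_triangle2[of y y' u] by simp
        then show False using X(3) that by force
      qed
      have inj: "inj_on p X"
      proof (rule inj_onI, rule ccontr)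
      fix x y assume xy: "x \<in> X" "y \<in> X" "p x = p y" "x \<noteq> y"
      have "p x ` F = {}" using pp[OF xy(1,2,4)] unfolding xy(3) by blast
      then show False using F_nonempty by blast
    qed
      have "c * (\<Sum>f\<in>p ` X. ratio f powr s) \<le> (2 * R) powr s"
      proof (rule disjoint_pieces_in_ball[OF s dim c(2)])
        show "finite (p ` X)" "p ` X \<subseteq> maps Ss" using X p by auto
        show "f ` F \<inter> g ` F = {}" if "f \<in> p ` X" "g \<in> p ` X" "f \<noteq> g" for f g
          using that pp by blast
        show "f ` F \<subseteq> ball x (2 * R)" if f: "f \<in> p ` X" for f
        proof
          fix u assume u: "u \<in> f ` F"
          obtain y where y: "y \<in> X" "f = p y" using f by blast
          then have "dist y u < r / 2" "dist x y \<le> R" using near u X(2) by auto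
          then show "u \<in> ball x (2 * R)" using dist_triangle[of x u y] r by simp
        qed
      qed
      moreover have "real (card X) * (cmin * r') powr s \<le> (\<Sum>f\<in>p ` X. ratio f powr s)"
      proof -
        have "(\<Sum>x\<in>X. (cmin * r') powr s) \<le> (\<Sum>x\<in>X. ratio (p x) powr s)"
          using p(3) s r'(1) cmin(1) by (intro sum_mono powr_mono2) auto
        then show ?thesis by (simp add: sum.reindex[OF inj] o_def)
      qed
      ultimately have "c * (real (card X) * (cmin * r') powr s) \<le> (2 * R) powr s"
        using c(1) by (meson mult_left_mono less_imp_le order_trans)
      moreover have "(2 * R) powr s = (10 * rad / cmin) powr s * (R / r) powr s * (cmin * r') powr s"
        using r r' rad(1) cmin(1) by (simp add: powr_mult[symmetric] field_simps)
      moreover have "0 < (cmin * r') powr s" using r' cmin(1) by simp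
      ultimately have "c * real (card X) \<le> (10 * rad / cmin) powr s * (R / r) powr s"
        by (metis (no_types, lifting) mult.assoc mult_le_cancel_right_pos)
      then have "real (card X) \<le> (10 * rad / cmin) powr s / c * (R / r) powr s"
        using c(1) by (simp add: field_simps)
      also have "\<dots> \<le> C * (R / r) powr s" by (intro mult_right_mono) (auto simp: C_def)
      finally have "real (card X) \<le> C * (R / r) powr s" .
      moreover have "cball x R \<inter> F \<subseteq> (\<Union>a\<in>X. cball a r)" using X(4) ball_subset_cball by blast
      ultimately show ?thesis using X(1) by blast
    qed
  qed
qed

text \<open>Covers by balls of a single radius suffice: an Assouad exponent \<alpha> < t would cover
  \<open>F\<close> at cost C * r powr (t - \<alpha>), which tends to 0 with r although the content
  at t is positive.\<close>

lemma assouad_dim_lower: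
  assumes s: "0 < s" and dim: "\<And>t. 0 < t \<Longrightarrow> t < s \<Longrightarrow> pos_content t F"
  shows "ereal s \<le> assouad_dim F"
proof (rule ccontr)
  assume "\<not> ?thesis"
  then have "assouad_dim F < ereal s" by simp
  then obtain \<alpha> c where \<alpha>: "\<alpha> < s" and c: "\<And>r R x. 0 < r \<Longrightarrow> r < R \<Longrightarrow> x \<in> F \<Longrightarrow>
      \<exists>A. finite A \<and> cball x R \<inter> F \<subseteq> (\<Union>a\<in>A. cball a r) \<and> real (card A) \<le> c * (R / r) powr \<alpha>"
    using assouad_dim_lessD[of F s] by metis
  obtain t where t: "max \<alpha> 0 < t" "t < s" using dense[of "max \<alpha> 0" s] \<alpha> s by auto
  then obtain c0 where c0: "c0 > 0" "\<And>K. ball_cover K F \<Longrightarrow> c0 \<le> cost t K"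
    using dim[of t] unfolding pos_content_def by auto
  obtain p where p: "p \<in> F" using F_nonempty by blast
  have Fp: "F \<subseteq> cball p (2 * rad)" using F_dist[OF p] by (force intro: less_imp_le)
  define C where "C = c * (2 * rad) powr \<alpha> * 2 powr t"
  have le: "c0 \<le> C * r powr (t - \<alpha>)" if r: "0 < r" "r < 2 * rad" for r
  proof -
    obtain A where A: "finite A" "cball p (2 * rad) \<inter> F \<subseteq> (\<Union>a\<in>A. cball a r)"
      "real (card A) \<le> c * (2 * rad / r) powr \<alpha>" using c[OF r p] by blast
    have "F \<subseteq> (\<Union>a\<in>A. ball a (2 * r))"
    proof
      fix x assume "x \<in> F"
      then obtain a where "a \<in> A" "dist a x \<le> r" using A(2) Fp by (auto simp: subset_iff)
      then show "x \<in> (\<Union>a\<in>A. ball a (2 * r))" using r by (intro UN_I[of a]) auto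
    qed
    then have "ball_cover ((\<lambda>a. (a, 2 * r)) ` A) F" using A(1) r by (simp add: ball_cover_def)
    then have "c0 \<le> cost t ((\<lambda>a. (a, 2 * r)) ` A)" by (rule c0)
    also have "\<dots> \<le> (\<Sum>a\<in>A. (2 * r) powr t)"
      unfolding cost_def by (rule order_trans[OF sum_image_le]) (use A in \<open>auto simp: o_def\<close>)
    also have "\<dots> = real (card A) * (2 * r) powr t" by simp
    also have "\<dots> \<le> c * (2 * rad / r) powr \<alpha> * (2 * r) powr t"
      using A(3) by (intro mult_right_mono) auto
    also have "\<dots> = C * r powr (t - \<alpha>)"
      using r rad(1) by (simp add: C_def powr_divide powr_mult powr_diff)
    finally show ?thesis .
  qed
  have "((\<lambda>r. C * r powr (t - \<alpha>)) \<longlongrightarrow> C * 0 powr (t - \<alpha>)) (at_right 0)"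
    using t by (intro tendsto_intros tendsto_powr') (auto simp: eventually_at_right_less eventually_at_right_field intro!: exI[of _ 1])
  then have "\<forall>\<^sub>F r in at_right 0. C * r powr (t - \<alpha>) < c0"
    using c0(1) t by (intro order_tendstoD(2)) auto
  moreover have "\<forall>\<^sub>F r in at_right 0. 0 < r \<and> r < 2 * rad"
    using rad(1) by (auto simp: eventually_at_right_field intro!: exI[of _ "2 * rad"])
  ultimately have "\<forall>\<^sub>F r in at_right (0::real). False"
  proof eventually_elim
    case (elim r)
    then show ?case using le[of r] by simp
  qed
  then show False by simp
qed

end

section \<open>Weak separation implies positive content\<close>

context attractor
begin

lemma neighbour_similitude:
  assumes "f \<in> maps Ss" "g \<in> maps Ss"
  shows "inv f \<circ> g \<in> similitudes"
  using assms by (intro similitudes_comp similitude_inverse(2) maps_similitude)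

text \<open>A basic neighbourhood of \<open>id\<close> for pointwise convergence restricts the
  values at finitely many points only; these form \<open>X\<close>. A neighbour map other than
  \<open>id\<close> must move one of them by at least \<epsilon>, and applying f multiplies this
  distance by its ratio.\<close>

lemma wsp_separation:
  assumes "wsp Ss"
  obtains X \<epsilon> where "finite X" "0 < \<epsilon>"
    "\<forall>f\<in>maps Ss. \<forall>g\<in>maps Ss. ratio f < 1 \<longrightarrow> ratio g < 1 \<longrightarrow> f \<noteq> g \<longrightarrow>
       (\<exists>x\<in>X. \<epsilon> * ratio f \<le> dist (f x) (g x))"
proof -
  have "id \<in> topspace (top_of_set similitudes)" by simp
  then obtain T where T: "id \<in> T" "openin (top_of_set similitudes) T"
    "T \<inter> (neighbour_maps Ss - {id}) = {}"
    using assms unfolding wsp_def in_closure_of by blast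
  then obtain U where U: "open U" "T = similitudes \<inter> U" by (auto simp: openin_open)
  have "openin (product_topology (\<lambda>i. euclidean) UNIV) U" using U(1) by (simp add: open_fun_def)
  moreover have "id \<in> U" using T U by blast
  ultimately obtain B where B: "id \<in> Pi\<^sub>E UNIV B" "\<And>i. open (B i)" "finite {i. B i \<noteq> UNIV}"
    "Pi\<^sub>E UNIV B \<subseteq> U"
    by (rule product_topology_open_contains_basis[where I = UNIV, elim_format]) auto
  define X where "X = {i. B i \<noteq> UNIV}"
  have "\<forall>x\<in>X. \<exists>e>0. ball x e \<subseteq> B x"
  proof
    fix x assume "x \<in> X"
    have "x \<in> B x" using B(1) by (auto simp: PiE_iff)
    then show "\<exists>e>0. ball x e \<subseteq> B x" using B(2) open_contains_ball by blast
  qed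
  from bchoice[OF this] obtain e where e: "\<forall>x\<in>X. 0 < e x \<and> ball x (e x) \<subseteq> B x" by blast
  define \<epsilon> where "\<epsilon> = Min (insert 1 (e ` X))"
  have X: "finite X" using B(3) by (simp add: X_def)
  have \<epsilon>: "0 < \<epsilon>" unfolding \<epsilon>_def using X e by (subst Min_gr_iff) auto
  have \<epsilon>le: "\<epsilon> \<le> e x" if "x \<in> X" for x unfolding \<epsilon>_def using X that by (intro Min_le) auto
  have "\<exists>x\<in>X. \<epsilon> * ratio f \<le> dist (f x) (g x)"
    if fg: "f \<in> maps Ss" "g \<in> maps Ss" "ratio f < 1" "ratio g < 1" "f \<noteq> g" for f g
  proof (rule ccontr)
    assume *: "\<not> ?thesis"
    have sf: "f \<in> similitudes" using fg maps_similitude by blast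
    obtain \<alpha> \<beta> where ab: "set \<alpha> \<subseteq> {..<length Ss}" "f = word_map Ss \<alpha>"
      "set \<beta> \<subseteq> {..<length Ss}" "g = word_map Ss \<beta>"
      using fg(1,2) unfolding maps_def by blast
    \<comment> \<open>Ratios below 1 exclude the empty word, which \<open>words\<close> does not
      contain.\<close>
    have "\<alpha> \<noteq> []" "\<beta> \<noteq> []" using fg(3,4) ab by (metis less_irrefl ratio_id word_map_Nil)+
    moreover have "\<alpha> \<noteq> \<beta>" using ab fg(5) by blast
    ultimately have "inv f \<circ> g \<in> neighbour_maps Ss"
      unfolding neighbour_maps_def words_def using ab by blast
    moreover have "inv f \<circ> g \<noteq> id"
    proof
      assume id: "inv f \<circ> g = id"
      have "g x = f x" for x
        using fun_cong[OF id, of x] inv_similitude_cancel(2)[OF sf, of "g x"] by simp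
      then have "g = f" by (rule ext)
      then show False using fg(5) by simp
    qed
    moreover have "inv f \<circ> g \<in> U"
    proof -
      have "(inv f \<circ> g) x \<in> B x" for x
      proof (cases "x \<in> X")
        case True
        then have "dist (f x) (g x) < \<epsilon> * ratio f" using * by force
        moreover have "dist (f x) (g x) = ratio f * dist x (inv f (g x))"
          using similitude_dist[OF sf, of x "inv f (g x)"] inv_similitude_cancel(2)[OF sf] by simp
        ultimately have "dist x (inv f (g x)) < \<epsilon>" using ratio_pos[OF sf] by (simp add: mult.commute)
        then have "inv f (g x) \<in> ball x (e x)" using \<epsilon>le[OF True] by simp
        then have "inv f (g x) \<in> B x" using e True by blast
        then show ?thesis by simp
      qed (auto simp: X_def)
      then show ?thesis using B(4) by (auto simp: PiE_iff)
    qed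
    ultimately have "inv f \<circ> g \<in> T \<inter> (neighbour_maps Ss - {id})"
      using U(2) neighbour_similitude[OF fg(1,2)] by blast
    then show False using T(3) by blast
  qed
  then have "\<forall>f\<in>maps Ss. \<forall>g\<in>maps Ss. ratio f < 1 \<longrightarrow> ratio g < 1 \<longrightarrow> f \<noteq> g \<longrightarrow>
       (\<exists>x\<in>X. \<epsilon> * ratio f \<le> dist (f x) (g x))" by (intro ballI impI)
  then show ?thesis by (rule that[OF X \<epsilon>])
qed

text \<open>A piece of ratio about r meeting the ball is encoded by recording, for each of the
  finitely many test points, a cell of a fixed net that contains its magnified image. Two maps with
  the same code would be too close at every test point. So the number of codes, which depends on
  neither z nor r, bounds the number of maps.\<close>

lemma wsp_bounded_overlap:
  assumes "wsp Ss"
  obtains L where "\<forall>z r. 0 < r \<and> r < 1 \<longrightarrow> (\<exists>T\<subseteq>maps Ss. finite T \<and> card T \<le> L \<and>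
    (\<forall>f\<in>T. ratio f \<le> r) \<and> F \<inter> ball z r \<subseteq> (\<Union>f\<in>T. f ` F))"
proof -
  obtain X \<epsilon> where X: "finite X" and \<epsilon>: "0 < \<epsilon>" and sep:
    "\<forall>f\<in>maps Ss. \<forall>g\<in>maps Ss. ratio f < 1 \<longrightarrow> ratio g < 1 \<longrightarrow> f \<noteq> g \<longrightarrow>
       (\<exists>x\<in>X. \<epsilon> * ratio f \<le> dist (f x) (g x))"
    using assms by (rule wsp_separation)
  \<comment> \<open>\<open>m\<close> bounds the magnified images (f x - z) / r, with the summand 1
    for the radius of the ball. Two points in one cell of radius \<epsilon> * cmin / 2 are less than
    \<epsilon> * cmin apart.\<close>
  define m where "m = (\<Sum>x\<in>X. norm x) + rad + 1"
  define \<rho> where "\<rho> = \<epsilon> * cmin / 2"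
  have \<rho>: "0 < \<rho>" using \<epsilon> cmin(1) by (simp add: \<rho>_def)
  obtain Z where Z: "finite Z" "cball (0 :: real ^ 'n) m \<subseteq> (\<Union>z\<in>Z. ball z \<rho>)"
    using separated_net[OF bounded_cball \<rho>, of 0 m] by metis
  have main: "\<exists>T\<subseteq>maps Ss. finite T \<and> card T \<le> card (PiE X (\<lambda>_. Z)) \<and>
      (\<forall>f\<in>T. ratio f \<le> r) \<and> F \<inter> ball z r \<subseteq> (\<Union>f\<in>T. f ` F)"
    if r: "0 < r" "r < 1" for z r
  proof -
    define T where "T = {f\<in>maps Ss. cmin * r \<le> ratio f \<and> ratio f \<le> r \<and> f ` F \<inter> ball z r \<noteq> {}}"
    define code where "code f x = (SOME \<zeta>. \<zeta> \<in> Z \<and> (1 / r) *\<^sub>R (f x - z) \<in> ball \<zeta> \<rho>)"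
      for f :: "real ^ 'n \<Rightarrow> real ^ 'n" and x
    have code: "code f x \<in> Z \<and> (1 / r) *\<^sub>R (f x - z) \<in> ball (code f x) \<rho>" if fT: "f \<in> T" and xX: "x \<in> X" for f x
    proof -
      obtain p where p: "p \<in> F" "dist z (f p) < r" using fT unfolding T_def by auto
      have f: "f \<in> similitudes" "ratio f \<le> r" using fT maps_similitude by (auto simp: T_def)
      have "dist (f x) z \<le> dist (f x) (f p) + dist z (f p)" by (rule dist_triangle2)
      also have "\<dots> \<le> r * dist x p + r"
        using p f by (simp add: similitude_dist add_mono mult_right_mono less_imp_le)
      also have "\<dots> \<le> r * m"
      proof -
        have "norm p \<le> rad" using rad(2) p(1) by (auto simp: subset_iff intro: less_imp_le)
        moreover have "norm x \<le> (\<Sum>x\<in>X. norm x)" using X xX by (intro member_le_sum) auto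
        moreover have "dist x p \<le> norm x + norm p" by (simp add: dist_norm norm_triangle_ineq4)
        ultimately have "dist x p + 1 \<le> m" by (simp add: m_def)
        then have "r * (dist x p + 1) \<le> r * m" using r by (intro mult_left_mono) auto
        then show ?thesis by (simp add: algebra_simps)
      qed
      finally have "norm (f x - z) \<le> r * m" by (simp add: dist_norm)
      then have "norm ((1 / r) *\<^sub>R (f x - z)) \<le> m"
        using r by (simp only: norm_scaleR) (simp add: field_simps)
      then have "(1 / r) *\<^sub>R (f x - z) \<in> cball 0 m" by (simp only: mem_cball_0)
      then have "\<exists>\<zeta>. \<zeta> \<in> Z \<and> (1 / r) *\<^sub>R (f x - z) \<in> ball \<zeta> \<rho>" using Z(2) by blast
      then show ?thesis unfolding code_def by (rule someI_ex)
    qed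
    have inj: "inj_on (\<lambda>f. restrict (code f) X) T"
    proof (rule inj_onI, rule ccontr)
      fix f g assume fg: "f \<in> T" "g \<in> T" "restrict (code f) X = restrict (code g) X" "f \<noteq> g"
      have "ratio f < 1" "ratio g < 1" "f \<in> maps Ss" "g \<in> maps Ss" "cmin * r \<le> ratio f"
        using fg r by (auto simp: T_def)
      then obtain x where x: "x \<in> X" "\<epsilon> * ratio f \<le> dist (f x) (g x)"
        using sep fg(4) by blast
      have "code f x = code g x" using fun_cong[OF fg(3), of x] x(1) by simp
      then have "dist ((1 / r) *\<^sub>R (f x - z)) ((1 / r) *\<^sub>R (g x - z)) < \<rho> + \<rho>"
        using code[OF fg(1) x(1)] code[OF fg(2) x(1)]
          dist_triangle3[of "(1 / r) *\<^sub>R (f x - z)" "(1 / r) *\<^sub>R (g x - z)" "code f x"]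
        by simp
      moreover have "dist ((1 / r) *\<^sub>R (f x - z)) ((1 / r) *\<^sub>R (g x - z)) = dist (f x) (g x) / r"
      proof -
        have "(1 / r) *\<^sub>R (f x - z) - (1 / r) *\<^sub>R (g x - z) = (1 / r) *\<^sub>R (f x - g x)"
          by (simp add: scaleR_diff_right)
        then show ?thesis using r by (simp add: dist_norm)
      qed
      ultimately have "dist (f x) (g x) / r < \<epsilon> * cmin" unfolding \<rho>_def by linarith
      then have "dist (f x) (g x) < \<epsilon> * (cmin * r)" using r by (simp add: field_simps)
      also have "\<dots> \<le> \<epsilon> * ratio f" using \<open>cmin * r \<le> ratio f\<close> \<epsilon> by (intro mult_left_mono) auto
      finally show False using x(2) by simp
    qed
    have sub: "(\<lambda>f. restrict (code f) X) ` T \<subseteq> PiE X (\<lambda>_. Z)" using code by auto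
    have fin: "finite (PiE X (\<lambda>_. Z))" using X Z(1) by (intro finite_PiE)
    have "F \<inter> ball z r \<subseteq> (\<Union>f\<in>T. f ` F)"
    proof
      fix x assume x: "x \<in> F \<inter> ball z r"
      then obtain f where f: "f \<in> maps Ss" "x \<in> f ` F" "cmin * r \<le> ratio f" "ratio f \<le> r"
        using piece[of x r] r by auto
      then have "f \<in> T" using x unfolding T_def by blast
      then show "x \<in> (\<Union>f\<in>T. f ` F)" using f(2) by blast
    qed
    moreover have "finite T" using inj_on_finite[OF inj sub fin] .
    moreover have "card T \<le> card (PiE X (\<lambda>_. Z))" using card_inj_on_le[OF inj sub fin] .
    moreover have "T \<subseteq> maps Ss" "\<forall>f\<in>T. ratio f \<le> r" by (auto simp: T_def)
    ultimately show ?thesis by blast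
  qed
  show ?thesis
    by (rule that[of "card (PiE X (\<lambda>_. Z))"], intro allI impI, elim conjE) (rule main)
qed

text \<open>Taking the images of a cover of \<open>F\<close> under all maps in \<open>T\<close>
  gives again a cover and multiplies the cost by at most the sum q < 1. Iteration drives the cost to
  0.\<close>

lemma not_pos_content_if_small_cover:
  assumes T: "finite T" "T \<subseteq> maps Ss" "F \<subseteq> (\<Union>f\<in>T. f ` F)"
    and small: "(\<Sum>f\<in>T. ratio f powr t) < 1"
  shows "\<not> pos_content t F"
proof
  assume "pos_content t F"
  then obtain c where c: "c > 0" "\<And>K. ball_cover K F \<Longrightarrow> c \<le> cost t K"
    unfolding pos_content_def by blast
  define q where "q = (\<Sum>f\<in>T. ratio f powr t)"
  define K0 where "K0 = {(0 :: real ^ 'n, rad)}"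
  have q: "0 \<le> q" unfolding q_def by (intro sum_nonneg) auto
  have "\<exists>K. ball_cover K F \<and> cost t K \<le> q ^ n * cost t K0" for n
  proof (induction n)
    case 0
    have "ball_cover K0 F" using rad by (simp add: ball_cover_def K0_def)
    then show ?case by auto
  next
    case (Suc n)
    then obtain K where K: "ball_cover K F" "cost t K \<le> q ^ n * cost t K0" by blast
    have sim: "f \<in> similitudes" if "f \<in> T" for f using that T maps_similitude by blast
    have "ball_cover (\<Union>f\<in>T. img f K) (\<Union>f\<in>T. f ` F)"
      using T(1) sim K(1) by (intro ball_cover_UN ball_cover_img)
    then have cov: "ball_cover (\<Union>f\<in>T. img f K) F" using T(3) by (rule ball_cover_subset)
    have "cost t (\<Union>f\<in>T. img f K) \<le> (\<Sum>f\<in>T. cost t (img f K))"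
      using T(1) K(1) by (intro cost_UN) (auto simp: img_def ball_cover_def)
    also have "\<dots> \<le> (\<Sum>f\<in>T. ratio f powr t * cost t K)"
      using sim K(1) by (intro sum_mono cost_img)
    also have "\<dots> = q * cost t K" by (simp add: q_def sum_distrib_right)
    also have "\<dots> \<le> q * (q ^ n * cost t K0)" using K(2) q by (intro mult_left_mono)
    also have "\<dots> = q ^ Suc n * cost t K0" by simp
    finally show ?case using cov by blast
  qed
  then have "c \<le> q ^ n * cost t K0" for n using c(2) order_trans by blast
  moreover have "(\<lambda>n. q ^ n * cost t K0) \<longlonglongrightarrow> 0 * cost t K0"
    using q small by (intro tendsto_intros LIMSEQ_power_zero) (simp add: q_def)
  ultimately have "c \<le> 0" by (intro LIMSEQ_le_const[where X = "\<lambda>n. q ^ n * cost t K0"]) auto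
  then show False using c(1) by simp
qed

text \<open>By bounded overlap, a cover of \<open>F\<close> by balls of small cost yields a finite cover by pieces
  with \<open>(\<Sum>f\<in>T. ratio f powr s) < 1\<close>, which forces the dimension of \<open>F\<close> below \<open>s\<close>.\<close>

lemma wsp_imp_pos_content:
  assumes wsp: "wsp Ss" and s: "0 < s" and dim: "\<And>t. 0 < t \<Longrightarrow> t < s \<Longrightarrow> pos_content t F"
  shows "pos_content s F"
proof -
  obtain L where L: "\<forall>z r. 0 < r \<and> r < 1 \<longrightarrow> (\<exists>T\<subseteq>maps Ss. finite T \<and> card T \<le> L \<and>
    (\<forall>f\<in>T. ratio f \<le> r) \<and> F \<inter> ball z r \<subseteq> (\<Union>f\<in>T. f ` F))"
    using wsp by (rule wsp_bounded_overlap)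
  \<comment> \<open>L + 1 avoids a zero denominator. The threshold is at most 1, so all radii of a
    cheaper cover are below 1, as the overlap bound requires.\<close>
  have "1 / real (L + 1) \<le> cost s K" if K: "ball_cover K F" for K
  proof (rule ccontr)
    assume "\<not> ?thesis"
    then have small: "cost s K < 1 / real (L + 1)" by simp
    also have "\<dots> \<le> 1 powr s" by simp
    finally have lt1: "snd k < 1" if "k \<in> K" for k using that radius_less[OF K, of _ s 1] s by simp
    have "\<forall>k\<in>K. \<exists>T. T \<subseteq> maps Ss \<and> finite T \<and> card T \<le> L \<and>
        (\<forall>f\<in>T. ratio f \<le> snd k) \<and> F \<inter> ball (fst k) (snd k) \<subseteq> (\<Union>f\<in>T. f ` F)"
    proof
      fix k assume k: "k \<in> K"
      then have "0 < snd k \<and> snd k < 1" using K lt1 by (simp add: ball_cover_def)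
      with L have "\<exists>T\<subseteq>maps Ss. finite T \<and> card T \<le> L \<and> (\<forall>f\<in>T. ratio f \<le> snd k) \<and>
          F \<inter> ball (fst k) (snd k) \<subseteq> (\<Union>f\<in>T. f ` F)" by simp
      then show "\<exists>T. T \<subseteq> maps Ss \<and> finite T \<and> card T \<le> L \<and>
        (\<forall>f\<in>T. ratio f \<le> snd k) \<and> F \<inter> ball (fst k) (snd k) \<subseteq> (\<Union>f\<in>T. f ` F)" by simp
    qed
    from bchoice[OF this] obtain T where T: "\<forall>k\<in>K. T k \<subseteq> maps Ss \<and> finite (T k) \<and> card (T k) \<le> L \<and>
        (\<forall>f\<in>T k. ratio f \<le> snd k) \<and> F \<inter> ball (fst k) (snd k) \<subseteq> (\<Union>f\<in>T k. f ` F)" by blast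
    define TT where "TT = (\<Union>k\<in>K. T k)"
    have finK: "finite K" using K by (simp add: ball_cover_def)
    have TT: "finite TT" "TT \<subseteq> maps Ss" using T finK by (auto simp: TT_def)
    have cov: "F \<subseteq> (\<Union>f\<in>TT. f ` F)"
    proof
      fix x assume x: "x \<in> F"
      then obtain k where k: "k \<in> K" "x \<in> ball (fst k) (snd k)"
        using K unfolding ball_cover_def by blast
      then have "x \<in> (\<Union>f\<in>T k. f ` F)" using T x by blast
      then show "x \<in> (\<Union>f\<in>TT. f ` F)" unfolding TT_def using k(1) by blast
    qed
    have sim: "0 < ratio f" if "f \<in> TT" for f using that TT maps_similitude ratio_pos by blast
    have "(\<Sum>f\<in>TT. ratio f powr s) \<le> (\<Sum>k\<in>K. \<Sum>f\<in>T k. ratio f powr s)"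
      unfolding TT_def using finK T by (intro sum_UN_le) auto
    also have "\<dots> \<le> (\<Sum>k\<in>K. \<Sum>f\<in>T k. snd k powr s)"
    proof (intro sum_mono powr_mono2)
      fix k f assume "k \<in> K" "f \<in> T k"
      then have "f \<in> TT" by (auto simp: TT_def)
      then show "0 \<le> ratio f" using sim[of f] by simp
      show "ratio f \<le> snd k" using T \<open>k \<in> K\<close> \<open>f \<in> T k\<close> by blast
    qed (use s in simp)
    also have "\<dots> \<le> (\<Sum>k\<in>K. real L * snd k powr s)"
      using T by (intro sum_mono) (simp add: mult_right_mono)
    also have "\<dots> = real L * cost s K" by (simp add: cost_def sum_distrib_left)
    also have "\<dots> \<le> real (L + 1) * cost s K" by (intro mult_right_mono cost_nonneg) simp
    also have "\<dots> < 1" using small by (simp add: field_simps)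
    finally have lt: "(\<Sum>f\<in>TT. ratio f powr s) < 1" .
    \<comment> \<open>The strict inequality at s persists at a slightly smaller t, where the content
      is positive by assumption.\<close>
    have "((\<lambda>t. \<Sum>f\<in>TT. ratio f powr t) \<longlongrightarrow> (\<Sum>f\<in>TT. ratio f powr s)) (at_left s)"
      by (intro tendsto_intros) (use sim in force)
    then have "\<forall>\<^sub>F t in at_left s. (\<Sum>f\<in>TT. ratio f powr t) < 1" using lt by (rule order_tendstoD(2))
    moreover have "\<forall>\<^sub>F t in at_left s. 0 < t \<and> t < s"
      using s by (auto simp: eventually_at_left_field)
    ultimately have "\<forall>\<^sub>F t in at_left s. 0 < t \<and> t < s \<and> (\<Sum>f\<in>TT. ratio f powr t) < 1"
      by eventually_elim simp
    then have "\<exists>t. 0 < t \<and> t < s \<and> (\<Sum>f\<in>TT. ratio f powr t) < 1"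
      by (rule eventually_happens'[OF trivial_limit_at_left_real])
    then obtain t where "0 < t" "t < s" "(\<Sum>f\<in>TT. ratio f powr t) < 1" by blast
    then show False using not_pos_content_if_small_cover[OF TT cov, of t] dim by blast
  qed
  then show ?thesis unfolding pos_content_def by (intro exI[of _ "1 / real (L + 1)"]) simp
qed

end

section \<open>Failure of weak separation\<close>

text \<open>Differences of points of \<open>F\<close> span the space, as otherwise a nonzero linear
  functional would be constant on \<open>F\<close>. A linear map is controlled by its largest value
  on a basis of such differences. \<open>K\<close> depends on that basis only, the pair p, q also on
  A.\<close>

lemma linear_bound_by_differences:
  fixes F :: "(real ^ 'n) set"
  assumes F: "F \<noteq> {}" and nh: "\<not> in_hyperplane F"
  obtains K where "1 \<le> K"
    "\<And>A :: real ^ 'n \<Rightarrow> real ^ 'n. linear A \<Longrightarrow>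
       \<exists>p\<in>F. \<exists>q\<in>F. \<forall>x. norm (A x) \<le> K * norm x * norm (A (p - q))"
proof -
  define D where "D = {p - q | p q. p \<in> F \<and> q \<in> F}"
  obtain p0 where p0: "p0 \<in> F" using F by blast
  have "span D = UNIV"
  proof (rule ccontr)
    assume "span D \<noteq> UNIV"
    then obtain a where a: "a \<noteq> 0" "span D \<subseteq> {x. a \<bullet> x = 0}"
      using span_not_univ_subset_hyperplane by blast
    have "F \<subseteq> {x. a \<bullet> x = a \<bullet> p0}"
    proof
      fix p assume "p \<in> F"
      then have "p - p0 \<in> span D" using p0 by (intro span_base) (auto simp: D_def)
      then have "a \<bullet> (p - p0) = 0" using a(2) by blast
      then show "p \<in> {x. a \<bullet> x = a \<bullet> p0}" by (simp add: inner_diff_right)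
    qed
    moreover have "aff_dim {x. a \<bullet> x = a \<bullet> p0} = int CARD('n) - 1"
      using aff_dim_hyperplane[OF a(1)] by simp
    ultimately have "in_hyperplane F" unfolding in_hyperplane_def using affine_hyperplane by blast
    then show False using nh by blast
  qed
  moreover obtain V where V: "V \<subseteq> D" "independent V" "D \<subseteq> span V"
    using maximal_independent_subset by blast
  ultimately have spanV: "span V = UNIV" using span_mono[OF V(3)] by (simp add: span_span top.extremum_unique)
  have finV: "finite V" using V(2) by (rule independent_imp_finite)
  have neV: "V \<noteq> {}"
  proof
    assume "V = {}"
    then have "axis undefined 1 \<in> {0 :: real ^ 'n}" using spanV by auto
    then show False by (simp add: axis_eq_0_iff)
  qed
  have "\<forall>x. \<exists>C\<ge>0. \<forall>A :: real ^ 'n \<Rightarrow> real ^ 'n. \<forall>m. linear A \<longrightarrow> (\<forall>v\<in>V. norm (A v) \<le> m) \<longrightarrow> norm (A x) \<le> C * m"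
  proof
    fix x
    have "x \<in> range (\<lambda>u. \<Sum>v\<in>V. u v *\<^sub>R v)" using spanV span_finite[OF finV] by blast
    then obtain u where u: "x = (\<Sum>v\<in>V. u v *\<^sub>R v)" by blast
    have "norm (A x) \<le> (\<Sum>v\<in>V. \<bar>u v\<bar>) * m"
      if A: "linear A" and m: "\<forall>v\<in>V. norm (A v) \<le> m" for A :: "real ^ 'n \<Rightarrow> real ^ 'n" and m
    proof -
      have "A x = (\<Sum>v\<in>V. u v *\<^sub>R A v)" using A by (simp add: u linear_sum linear_scale)
      also have "norm \<dots> \<le> (\<Sum>v\<in>V. \<bar>u v\<bar> * m)"
        using m by (intro order_trans[OF norm_sum] sum_mono) (auto intro: mult_left_mono)
      finally show ?thesis by (simp add: sum_distrib_right)
    qed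
    then show "\<exists>C\<ge>0. \<forall>A :: real ^ 'n \<Rightarrow> real ^ 'n. \<forall>m. linear A \<longrightarrow> (\<forall>v\<in>V. norm (A v) \<le> m) \<longrightarrow> norm (A x) \<le> C * m"
      by (intro exI[of _ "\<Sum>v\<in>V. \<bar>u v\<bar>"] conjI sum_nonneg) auto
  qed
  from choice[OF this] obtain C where C: "\<forall>x. 0 \<le> C x \<and> (\<forall>A :: real ^ 'n \<Rightarrow> real ^ 'n. \<forall>m.
      linear A \<longrightarrow> (\<forall>v\<in>V. norm (A v) \<le> m) \<longrightarrow> norm (A x) \<le> C x * m)" by blast
  define K where "K = 1 + (\<Sum>b\<in>Basis. C b)"
  have K: "1 \<le> K" unfolding K_def using C by (simp add: sum_nonneg)
  have "\<exists>p\<in>F. \<exists>q\<in>F. \<forall>x. norm (A x) \<le> K * norm x * norm (A (p - q))"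
    if A: "linear A" for A :: "real ^ 'n \<Rightarrow> real ^ 'n"
  proof -
    define m where "m = Max ((\<lambda>v. norm (A v)) ` V)"
    have "m \<in> (\<lambda>v. norm (A v)) ` V" unfolding m_def using finV neV by (intro Max_in) auto
    then obtain v where v: "v \<in> V" "m = norm (A v)" by blast
    have m: "\<forall>v\<in>V. norm (A v) \<le> m" unfolding m_def using finV by auto
    have m0: "0 \<le> m" using v by simp
    obtain p q where pq: "p \<in> F" "q \<in> F" "v = p - q" using v V(1) unfolding D_def by blast
    have "norm (A x) \<le> K * norm x * m" for x
    proof -
      have "A x = A (\<Sum>b\<in>Basis. (x \<bullet> b) *\<^sub>R b)" by (simp add: euclidean_representation)
      also have "\<dots> = (\<Sum>b\<in>Basis. (x \<bullet> b) *\<^sub>R A b)" using A by (simp add: linear_sum linear_scale)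
      also have "norm \<dots> \<le> (\<Sum>b\<in>Basis. norm x * (C b * m))"
      proof (intro order_trans[OF norm_sum] sum_mono)
        fix b :: "real ^ 'n" assume b: "b \<in> Basis"
        have "norm (A b) \<le> C b * m" using C A m by blast
        then have "\<bar>x \<bullet> b\<bar> * norm (A b) \<le> norm x * (C b * m)"
          using Basis_le_norm[OF b, of x] by (intro mult_mono) auto
        then show "norm ((x \<bullet> b) *\<^sub>R A b) \<le> norm x * (C b * m)" by simp
      qed
      also have "\<dots> = (K - 1) * norm x * m" by (simp add: K_def sum_distrib_left sum_distrib_right algebra_simps)
      also have "\<dots> \<le> K * norm x * m" using m0 by (intro mult_right_mono) auto
      finally show ?thesis .
    qed
    then show ?thesis using pq v(2) by blast
  qed
  then show ?thesis using that K by blast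
qed

section \<open>Displacement fields and their conjugates\<close>

definition disp :: "(real ^ 'n \<Rightarrow> real ^ 'n) \<Rightarrow> real ^ 'n \<Rightarrow> real ^ 'n" where
  "disp f x = f x - x"

text \<open>The field is affine, and \<open>A\<close> vanishes exactly when the map is a
  translation; its size measures the deviation from one.\<close>

lemma disp_linear:
  assumes "f \<in> similitudes"
  obtains A where "linear A" "\<And>x y. disp f x - disp f y = A (x - y)"
proof -
  obtain L where L: "linear L" "\<And>x y. f x - f y = L (x - y)"
    "\<And>x. norm (L x) = ratio f * norm x" "ratio f > 0"
    using similitudesE[OF assms] by blast
  show ?thesis
  proof
    show "linear (\<lambda>x. L x - x)" using L(1) by (intro linear_compose_sub linear_ident)
    show "disp f x - disp f y = L (x - y) - (x - y)" for x y
      unfolding disp_def L(2)[symmetric] by simp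
  qed
qed

text \<open>Conjugation reads the field at h x and magnifies it by 1 / ratio h. As h scales the
  distance of the arguments by ratio h, the linear part keeps its norm, while for contracting h the
  displacement grows.\<close>

lemma disp_conjugate:
  assumes h: "h \<in> similitudes"
  shows "norm (disp (inv h \<circ> f \<circ> h) x) = norm (disp f (h x)) / ratio h"
    and "norm (disp (inv h \<circ> f \<circ> h) x - disp (inv h \<circ> f \<circ> h) y)
      = norm (disp f (h x) - disp f (h y)) / ratio h"
proof -
  have "inv h \<in> similitudes" using similitude_inverse h by blast
  from similitudesE[OF this] obtain M where M: "linear M" "\<And>x y. inv h x - inv h y = M (x - y)"
    "\<And>x. norm (M x) = ratio (inv h) * norm x" "ratio (inv h) > 0"
    by blast
  have r: "ratio (inv h) = 1 / ratio h" using similitude_inverse h by blast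
  have d: "disp (inv h \<circ> f \<circ> h) u = M (disp f (h u))" for u
  proof -
    have "disp (inv h \<circ> f \<circ> h) u = inv h (f (h u)) - inv h (h u)"
      by (simp add: disp_def inv_similitude_cancel(1)[OF h, of u])
    then show ?thesis unfolding M(2) disp_def .
  qed
  show "norm (disp (inv h \<circ> f \<circ> h) x) = norm (disp f (h x)) / ratio h"
    unfolding d M(3) r by simp
  show "norm (disp (inv h \<circ> f \<circ> h) x - disp (inv h \<circ> f \<circ> h) y)
      = norm (disp f (h x) - disp f (h y)) / ratio h"
    unfolding d linear_diff[OF M(1), symmetric] M(3) r by simp
qed

text \<open>Appending h to both maps conjugates the neighbour map, so conjugates by maps of the
  semigroup are again quotients of two of its elements.\<close>

lemma neighbour_comp:
  assumes "f \<in> similitudes" "h \<in> similitudes"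
  shows "inv (f \<circ> h) \<circ> (g \<circ> h) = inv h \<circ> (inv f \<circ> g) \<circ> h"
  using o_inv_distrib[OF similitude_inverse(1)[OF assms(1)] similitude_inverse(1)[OF assms(2)]]
  by (simp add: o_assoc)

text \<open>On the ball of radius R each factor shifts by z up to e * (1 + R): e for the error at 0
  and e * R for the variation of the field. R has room for the start B, the total drift M and an
  accumulated error of 1, so no intermediate point leaves the ball and the errors merely add
  up.\<close>

lemma foldr_disp:
  fixes z :: "real ^ 'n"
  assumes e: "0 \<le> e" and R: "R = B + M + 1" and n: "real n * norm z \<le> M" "real n * (e * (1 + R)) \<le> 1"
    and x: "norm x \<le> B" and xs: "length xs \<le> n"
    and step: "\<And>f. f \<in> set xs \<Longrightarrow> norm (disp f 0 - z) \<le> e"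
      "\<And>f u v. f \<in> set xs \<Longrightarrow> norm (disp f u - disp f v) \<le> e * norm (u - v)"
  shows "norm (foldr (\<circ>) xs id x - x - real (length xs) *\<^sub>R z) \<le> real (length xs) * (e * (1 + R))"
  using xs step
proof (induction xs)
  case (Cons f xs)
  define y where "y = foldr (\<circ>) xs id x"
  define l where "l = real (length xs)"
  have IH: "norm (y - x - l *\<^sub>R z) \<le> l * (e * (1 + R))"
    unfolding y_def l_def
    by (rule Cons.IH) (use Cons.prems(1) in simp, (rule Cons.prems, simp)+)
  have B: "0 \<le> B" using x norm_ge_zero order_trans by blast
  have M: "0 \<le> M" using n(1) by (meson mult_nonneg_nonneg norm_ge_zero of_nat_0_le_iff order_trans)
  have ln: "l \<le> real n" using Cons.prems(1) by (simp add: l_def)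
  have "norm y \<le> norm (y - x - l *\<^sub>R z) + norm (x + l *\<^sub>R z)"
    using norm_triangle_ineq[of "y - x - l *\<^sub>R z" "x + l *\<^sub>R z"] by (simp add: algebra_simps)
  also have "norm (x + l *\<^sub>R z) \<le> norm x + l * norm z"
    using norm_triangle_ineq[of x "l *\<^sub>R z"] by (simp add: l_def)
  finally have "norm y \<le> l * (e * (1 + R)) + (norm x + l * norm z)" using IH by linarith
  moreover have "l * (e * (1 + R)) \<le> real n * (e * (1 + R))"
    using ln e B M R by (intro mult_right_mono) auto
  moreover have "l * norm z \<le> real n * norm z" using ln by (intro mult_right_mono) auto
  ultimately have y: "norm y \<le> R" using n x R by linarith
  have "norm (disp f y - z) \<le> norm (disp f y - disp f 0) + norm (disp f 0 - z)"
    using norm_triangle_ineq[of "disp f y - disp f 0" "disp f 0 - z"] by simp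
  also have "\<dots> \<le> e * norm y + e" using Cons.prems(2)[of f] Cons.prems(3)[of f y 0] by simp
  also have "\<dots> \<le> e * (1 + R)" using mult_left_mono[OF y e] by (simp add: algebra_simps)
  finally have d: "norm (disp f y - z) \<le> e * (1 + R)" .
  have "foldr (\<circ>) (f # xs) id x - x - real (length (f # xs)) *\<^sub>R z
      = (disp f y - z) + (y - x - l *\<^sub>R z)"
    by (simp add: y_def l_def disp_def algebra_simps)
  then have "norm (foldr (\<circ>) (f # xs) id x - x - real (length (f # xs)) *\<^sub>R z)
      \<le> norm (disp f y - z) + norm (y - x - l *\<^sub>R z)"
    by (metis norm_triangle_ineq)
  also have "\<dots> \<le> e * (1 + R) + l * (e * (1 + R))" using d IH by linarith
  also have "\<dots> = real (length (f # xs)) * (e * (1 + R))" by (simp add: l_def algebra_simps)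
  finally show ?case .
qed simp

lemma filter_pigeonhole:
  assumes "finite Z" "\<And>x. x \<in> set xs \<Longrightarrow> \<exists>z\<in>Z. P z x" "card Z * n < length xs"
  obtains z where "z \<in> Z" "n < length (filter (P z) xs)"
proof -
  have "length xs \<le> (\<Sum>z\<in>Z. length (filter (P z) xs))"
    using assms(2)
  proof (induction xs)
    case (Cons x xs)
    then obtain z where z: "z \<in> Z" "P z x" by auto
    have "(\<Sum>z\<in>Z. length (filter (P z) xs)) < (\<Sum>z\<in>Z. length (filter (P z) (x # xs)))"
      using assms(1) z by (intro sum_strict_mono_ex1) auto
    moreover have "length xs \<le> (\<Sum>z\<in>Z. length (filter (P z) xs))" using Cons by simp
    ultimately show ?case by simp
  qed simp
  moreover have "(\<Sum>z\<in>Z. length (filter (P z) xs)) \<le> card Z * n"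
    if "\<And>z. z \<in> Z \<Longrightarrow> length (filter (P z) xs) \<le> n"
    using sum_bounded_above[of Z "\<lambda>z. length (filter (P z) xs)" n] that by simp
  ultimately show ?thesis using assms(3) that by (meson leD leI order_trans)
qed

text \<open>Orthogonal projection onto the complement of z; for z = 0 the division by zero yields
  the identity, so linearity needs no case distinction.\<close>

definition perp :: "real ^ 'n \<Rightarrow> real ^ 'n \<Rightarrow> real ^ 'n" where
  "perp z x = x - ((x \<bullet> z) / (z \<bullet> z)) *\<^sub>R z"

lemma perp_linear: "linear (perp z)"
  by (rule linearI)
    (simp_all add: perp_def inner_add_left add_divide_distrib scaleR_add_left scaleR_diff_right)

text \<open>The projection ignores multiples of z and does not increase norms. As t is arbitrary,
  points separated after projection stay separated under any shifts along z.\<close>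

lemma norm_perp_le:
  assumes "z \<noteq> 0"
  shows "norm (perp z x) \<le> norm (x + t *\<^sub>R z)"
proof -
  define y where "y = x + t *\<^sub>R z"
  have "perp z y = perp z x"
    using assms by (simp add: perp_def y_def inner_add_left add_divide_distrib scaleR_add_left)
  moreover have "z \<bullet> perp z y = 0" using assms by (simp add: perp_def inner_diff_right inner_commute)
  moreover have "y \<bullet> perp z y = (perp z y + ((y \<bullet> z) / (z \<bullet> z)) *\<^sub>R z) \<bullet> perp z y"
    by (simp add: perp_def)
  ultimately have *: "perp z y = perp z x" "perp z y \<bullet> perp z y = y \<bullet> perp z y"
    by (simp_all add: inner_add_left)
  then have "norm (perp z y) * norm (perp z y) \<le> norm y * norm (perp z y)"
    using norm_cauchy_schwarz[of y "perp z y"] *(2) by (simp add: power2_norm_eq_inner[symmetric] power2_eq_square)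
  then have "norm (perp z y) \<le> norm y"
    using mult_right_le_imp_le[of "norm (perp z y)" "norm (perp z y)" "norm y"]
    by (cases "perp z y = 0") simp_all
  then show ?thesis using *(1) by (simp add: y_def)
qed

section \<open>Near translations from failure of weak separation\<close>

context attractor
begin

text \<open>Closeness at 0 and at the basis vectors is an open condition for pointwise convergence,
  and it bounds the affine displacement field on all of \<open>F\<close>.\<close>

lemma not_wsp_neighbour:
  assumes nw: "\<not> wsp Ss" and e: "0 < e"
  obtains f g where "f \<in> maps Ss" "g \<in> maps Ss" "inv f \<circ> g \<noteq> id"
    "\<forall>x\<in>F. norm (disp (inv f \<circ> g) x) \<le> e"
proof -
  \<comment> \<open>The 1 stands for the displacement at 0. Each basis direction adds at most rad *
    (2 * e'), because the linear part at a basis vector is a difference of two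
    displacements.\<close>
  define e' where "e' = e / (1 + 2 * real DIM(real ^ 'n) * rad)"
  have pos: "0 < 1 + 2 * real DIM(real ^ 'n) * rad" using rad(1) by (simp add: add_pos_nonneg)
  have e': "0 < e'" using e pos unfolding e'_def by (rule divide_pos_pos)
  define X where "X = insert 0 (Basis :: (real ^ 'n) set)"
  define U where "U = {h :: real ^ 'n \<Rightarrow> real ^ 'n. \<forall>x\<in>X. h x \<in> ball x e'}"
  have "open U" unfolding U_def
    by (rule product_topology_basis') (auto simp: X_def)
  then have "openin (top_of_set similitudes) (similitudes \<inter> U)" by blast
  moreover have "id \<in> similitudes \<inter> U" using e' by (simp add: U_def)
  moreover have "id \<in> (top_of_set similitudes) closure_of (neighbour_maps Ss - {id})"
    using nw by (simp add: wsp_def)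
  ultimately obtain \<phi> where \<phi>: "\<phi> \<in> neighbour_maps Ss" "\<phi> \<noteq> id" "\<phi> \<in> similitudes" "\<phi> \<in> U"
    unfolding in_closure_of by blast
  then obtain \<alpha> \<beta> where "\<alpha> \<in> words Ss" "\<beta> \<in> words Ss" "\<phi> = inv (word_map Ss \<alpha>) \<circ> word_map Ss \<beta>"
    unfolding neighbour_maps_def by blast
  then obtain f g where fg: "f \<in> maps Ss" "g \<in> maps Ss" "\<phi> = inv f \<circ> g"
    unfolding words_def maps_def by blast
  obtain A where A: "linear A" "\<And>x y. disp \<phi> x - disp \<phi> y = A (x - y)"
    using disp_linear[OF \<phi>(3)] by blast
  have small: "norm (disp \<phi> x) \<le> e'" if "x \<in> X" for x
  proof -
    have "\<phi> x \<in> ball x e'" using \<phi>(4) that unfolding U_def by blast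
    then show ?thesis by (simp add: disp_def dist_norm norm_minus_commute)
  qed
  have "norm (disp \<phi> x) \<le> e" if x: "x \<in> F" for x
  proof -
    have nx: "norm x \<le> rad" using rad(2) x by (auto simp: subset_iff intro: less_imp_le)
    have "A x = A (\<Sum>b\<in>Basis. (x \<bullet> b) *\<^sub>R b)" by (simp add: euclidean_representation)
    also have "\<dots> = (\<Sum>b\<in>Basis. (x \<bullet> b) *\<^sub>R A b)" using A(1) by (simp add: linear_sum linear_scale)
    also have "norm \<dots> \<le> (\<Sum>b\<in>(Basis :: (real ^ 'n) set). rad * (2 * e'))"
    proof (intro order_trans[OF norm_sum] sum_mono)
      fix b :: "real ^ 'n" assume b: "b \<in> Basis"
      have "A b = disp \<phi> b - disp \<phi> 0" using A(2)[of b 0] by simp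
      then have "norm (A b) \<le> norm (disp \<phi> b) + norm (disp \<phi> 0)" by (simp add: norm_triangle_ineq4)
      also have "\<dots> \<le> 2 * e'" using small[of b] small[of 0] b by (simp add: X_def)
      finally have "norm (A b) \<le> 2 * e'" .
      then have "\<bar>x \<bullet> b\<bar> * norm (A b) \<le> rad * (2 * e')"
        using Basis_le_norm[OF b, of x] nx rad(1) by (intro mult_mono) auto
      then show "norm ((x \<bullet> b) *\<^sub>R A b) \<le> rad * (2 * e')" by simp
    qed
    also have "\<dots> = 2 * real DIM(real ^ 'n) * rad * e'" by simp
    finally have "norm (A x) \<le> 2 * real DIM(real ^ 'n) * rad * e'" .
    moreover have "disp \<phi> x = disp \<phi> 0 + A x" using A(2)[of x 0] by (simp add: algebra_simps)
    ultimately have "norm (disp \<phi> x) \<le> e' + 2 * real DIM(real ^ 'n) * rad * e'"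
      using norm_triangle_ineq[of "disp \<phi> 0" "A x"] small[of 0] by (simp add: X_def)
    also have "\<dots> = (1 + 2 * real DIM(real ^ 'n) * rad) * e'" by (simp add: algebra_simps)
    also have "\<dots> = e" using pos by (simp add: e'_def)
    finally show ?thesis .
  qed
  then show ?thesis using that[OF fg(1,2)] \<phi>(2) unfolding fg(3) by blast
qed

text \<open>Conjugating with a small piece at a point where the affine displacement field is large makes
  the field nearly constant.\<close>

lemma almost_translation:
  assumes nw: "\<not> wsp Ss" and nh: "\<not> in_hyperplane F" and \<eta>: "0 < \<eta>" and \<delta>: "0 < \<delta>"
  obtains f g D q where "f \<in> maps Ss" "g \<in> maps Ss" "0 < D" "D < \<delta>" "q \<in> F"
    "norm (disp (inv f \<circ> g) q) = D"
    "\<forall>x y. norm (disp (inv f \<circ> g) x - disp (inv f \<circ> g) y) \<le> \<eta> * D * norm (x - y)"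
proof -
  obtain K where K: "1 \<le> K" "\<And>A :: real ^ 'n \<Rightarrow> real ^ 'n. linear A \<Longrightarrow>
       \<exists>p\<in>F. \<exists>q\<in>F. \<forall>x. norm (A x) \<le> K * norm x * norm (A (p - q))"
    using linear_bound_by_differences[OF F_nonempty nh] by blast
  \<comment> \<open>The linear part is at most 2 * K times the displacement at p. After conjugation
    by a map of ratio at most \<tau> it is at most \<eta> times the magnified displacement
    D.\<close>
  define \<tau> where "\<tau> = min 1 (\<eta> / (2 * K))"
  have \<tau>: "0 < \<tau>" "\<tau> \<le> 1" "2 * K * \<tau> \<le> \<eta>"
    using \<eta> K(1) by (auto simp: \<tau>_def min_def field_simps)
  \<comment> \<open>Conjugation magnifies by at most 1 / (cmin * \<tau>), so D \<le> \<delta> /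
    2.\<close>
  define e where "e = \<delta> * (cmin * \<tau>) / 2"
  have e: "0 < e" using \<delta> cmin(1) \<tau>(1) by (simp add: e_def)
  obtain f g where fg: "f \<in> maps Ss" "g \<in> maps Ss" "inv f \<circ> g \<noteq> id"
    "\<forall>x\<in>F. norm (disp (inv f \<circ> g) x) \<le> e"
    using nw e by (rule not_wsp_neighbour)
  define \<phi> where "\<phi> = inv f \<circ> g"
  have sim: "\<phi> \<in> similitudes" unfolding \<phi>_def using fg(1,2) by (rule neighbour_similitude)
  obtain A where A: "linear A" "\<And>x y. disp \<phi> x - disp \<phi> y = A (x - y)"
    using disp_linear[OF sim] by blast
  obtain p1 p2 where p12: "p1 \<in> F" "p2 \<in> F" "\<forall>x. norm (A x) \<le> K * norm x * norm (A (p1 - p2))"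
    using K(2)[OF A(1)] by blast
  \<comment> \<open>Of the two points the one that is displaced more: the difference of both
    displacements is at most twice as long.\<close>
  define p where "p = (if norm (disp \<phi> p2) \<le> norm (disp \<phi> p1) then p1 else p2)"
  have p: "p \<in> F" using p12 by (simp add: p_def)
  have "norm (A (p1 - p2)) \<le> norm (disp \<phi> p1) + norm (disp \<phi> p2)"
    unfolding A(2)[symmetric] by (rule norm_triangle_ineq4)
  also have "\<dots> \<le> 2 * norm (disp \<phi> p)" by (simp add: p_def)
  finally have Ap: "norm (A (p1 - p2)) \<le> 2 * norm (disp \<phi> p)" .
  have Ax: "norm (A x) \<le> 2 * K * norm x * norm (disp \<phi> p)" for x
  proof -
    have "norm (A x) \<le> K * norm x * norm (A (p1 - p2))" using p12(3) by blast
    also have "\<dots> \<le> K * norm x * (2 * norm (disp \<phi> p))" using Ap K(1) by (intro mult_left_mono) auto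
    finally show ?thesis by (simp add: algebra_simps)
  qed
  have v: "0 < norm (disp \<phi> p)"
  proof (rule ccontr)
    assume "\<not> 0 < norm (disp \<phi> p)"
    then have p0: "disp \<phi> p = 0" by simp
    have "disp \<phi> x = 0" for x using A(2)[of x p] Ax[of "x - p"] p0 by simp
    then have "\<phi> x = id x" for x by (simp add: disp_def)
    then have "\<phi> = id" by (rule ext)
    then show False using fg(3) by (simp add: \<phi>_def)
  qed
  obtain c where c: "c \<in> maps Ss" "p \<in> c ` F" "cmin * \<tau> \<le> ratio c" "ratio c \<le> \<tau>"
    using p \<tau>(1,2) by (rule piece)
  obtain q where q: "q \<in> F" "p = c q" using c(2) by blast
  have sc: "c \<in> similitudes" "0 < ratio c" using c(1) maps_similitude ratio_pos by blast+
  define D where "D = norm (disp \<phi> p) / ratio c"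
  have D: "0 < D" using v sc(2) by (simp add: D_def)
  have "norm (disp \<phi> p) \<le> e" using fg(4) p unfolding \<phi>_def by blast
  also have "\<dots> \<le> \<delta> * ratio c / 2" using c(3) \<delta> by (simp add: e_def)
  finally have "D \<le> \<delta> / 2" using sc(2) by (simp add: D_def field_simps)
  then have D\<delta>: "D < \<delta>" using \<delta> by simp
  have eq: "inv (f \<circ> c) \<circ> (g \<circ> c) = inv c \<circ> \<phi> \<circ> c"
    unfolding \<phi>_def using maps_similitude[OF fg(1)] sc(1) by (rule neighbour_comp)
  show ?thesis
  proof (rule that[of "f \<circ> c" "g \<circ> c" D q])
    show "f \<circ> c \<in> maps Ss" "g \<circ> c \<in> maps Ss" using fg c maps_comp by blast+
    show "norm (disp (inv (f \<circ> c) \<circ> (g \<circ> c)) q) = D"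
      unfolding eq disp_conjugate[OF sc(1)] D_def q(2) ..
    show "\<forall>x y. norm (disp (inv (f \<circ> c) \<circ> (g \<circ> c)) x - disp (inv (f \<circ> c) \<circ> (g \<circ> c)) y)
        \<le> \<eta> * D * norm (x - y)"
    proof (intro allI)
      fix x y
      have "dist (c x) (c y) \<le> \<tau> * dist x y"
        unfolding similitude_dist[OF sc(1)] using c(4) by (intro mult_right_mono) auto
      then have cxy: "norm (c x - c y) \<le> \<tau> * norm (x - y)" by (simp add: dist_norm)
      have "norm (disp \<phi> (c x) - disp \<phi> (c y)) \<le> 2 * K * norm (c x - c y) * norm (disp \<phi> p)"
        unfolding A(2) by (rule Ax)
      also have "\<dots> \<le> 2 * K * (\<tau> * norm (x - y)) * norm (disp \<phi> p)"
        using cxy K(1) by (intro mult_right_mono mult_left_mono) auto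
      also have "\<dots> = (2 * K * \<tau>) * (norm (x - y) * norm (disp \<phi> p))" by simp
      also have "\<dots> \<le> \<eta> * (norm (x - y) * norm (disp \<phi> p))" using \<tau>(3) by (intro mult_right_mono) auto
      finally have "norm (disp \<phi> (c x) - disp \<phi> (c y)) / ratio c
          \<le> \<eta> * (norm (x - y) * norm (disp \<phi> p)) / ratio c"
        using sc(2) by (intro divide_right_mono) auto
      then show "norm (disp (inv (f \<circ> c) \<circ> (g \<circ> c)) x - disp (inv (f \<circ> c) \<circ> (g \<circ> c)) y)
          \<le> \<eta> * D * norm (x - y)"
        unfolding eq disp_conjugate[OF sc(1)] D_def by (simp add: algebra_simps)
    qed
  qed (use D D\<delta> q in auto)
qed

lemma maps_power: "\<sigma> \<in> set Ss \<Longrightarrow> \<exists>s\<in>maps Ss. ratio s = ratio \<sigma> ^ j"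
proof (induction j)
  case 0
  have "ratio (id :: real ^ 'n \<Rightarrow> _) = ratio \<sigma> ^ 0" by (simp only: ratio_id power_0)
  then show ?case using maps_id by blast
next
  case (Suc j)
  then obtain s where s: "s \<in> maps Ss" "ratio s = ratio \<sigma> ^ j" by blast
  have "ratio (\<sigma> \<circ> s) = ratio \<sigma> ^ Suc j"
    using ratio_comp[OF generator(1)[OF Suc.prems] maps_similitude[OF s(1)]] s(2) by simp
  moreover have "\<sigma> \<circ> s \<in> maps Ss" using Suc.prems s(1) set_subset_maps maps_comp by blast
  ultimately show ?case by blast
qed

text \<open>In the lower bound, \<open>cmin\<close> is the loss from magnifying only by powers of
  one generator, and 1 / 4 leaves room for the variation of the field between the point where its
  size is known and the point where it is used.\<close>

definition near_translation :: "real \<Rightarrow> real \<Rightarrow> (real ^ 'n \<Rightarrow> real ^ 'n) \<Rightarrow> bool" where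
  "near_translation \<eta> \<rho> f \<longleftrightarrow> cmin / 4 * \<rho> \<le> norm (disp f 0) \<and> norm (disp f 0) \<le> \<rho> \<and>
     (\<forall>x y. norm (disp f x - disp f y) \<le> \<eta> * \<rho> * norm (x - y))"

text \<open>Composing on the right with powers of one generator rescales the displacement to the
  prescribed scale \<open>\<rho>\<close>, even relative to an arbitrary map \<open>h\<close>.\<close>

lemma translation_at_scale:
  assumes nw: "\<not> wsp Ss" and nh: "\<not> in_hyperplane F" and \<eta>: "0 < \<eta>" and \<rho>: "0 < \<rho>"
    and h: "h \<in> maps Ss"
  obtains f g where "f \<in> maps Ss" "g \<in> maps Ss"
    "near_translation \<eta> \<rho> (inv (f \<circ> h) \<circ> (g \<circ> h))"
proof -
  \<comment> \<open>The points k 0 and q below are at most 2 * rad apart, so the field varies by at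
    most D / 2 between them.\<close>
  define \<eta>' where "\<eta>' = min \<eta> (1 / (4 * rad))"
  have \<eta>': "0 < \<eta>'" "\<eta>' \<le> \<eta>" "\<eta>' * (2 * rad) \<le> 1 / 2"
    using \<eta> rad(1) by (auto simp: \<eta>'_def min_def field_simps)
  have sh: "h \<in> similitudes" "0 < ratio h" "ratio h \<le> 1"
    using h maps_similitude ratio_pos maps_ratio_le_1 by blast+
  have "0 < ratio h * \<rho> / 2" using sh \<rho> by simp
  with nw nh \<eta>'(1) obtain f g D q where fg: "f \<in> maps Ss" "g \<in> maps Ss" and
    D: "0 < D" "D < ratio h * \<rho> / 2" and q: "q \<in> F" "norm (disp (inv f \<circ> g) q) = D" and
    lip: "\<forall>x y. norm (disp (inv f \<circ> g) x - disp (inv f \<circ> g) y) \<le> \<eta>' * D * norm (x - y)"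
    by (rule almost_translation)
  define \<phi> where "\<phi> = inv f \<circ> g"
  \<comment> \<open>Conjugating by a map of ratio t * ratio h would magnify D to exactly \<rho> / 2.
    Below, c ^ j is the last power that is not smaller than t; D < ratio h * \<rho> / 2 ensures that
    it exists.\<close>
  define t where "t = 2 * D / (ratio h * \<rho>)"
  have t: "0 < t" "t < 1" using D sh(2) \<rho> by (auto simp: t_def field_simps)
  obtain \<sigma> where \<sigma>: "\<sigma> \<in> set Ss" using ifs by (metis ifs_def last_in_set)
  define c where "c = ratio \<sigma>"
  have c: "0 < c" "c < 1" "cmin \<le> c"
    using generator[OF \<sigma>] ratio_pos cmin(3)[OF \<sigma>] by (auto simp: c_def)
  obtain n where n: "c ^ n < t" using real_arch_pow_inv[OF t(1) c(2)] by blast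
  define N where "N = (LEAST n. c ^ n < t)"
  have N: "c ^ N < t" unfolding N_def using n by (rule LeastI)
  then have "N \<noteq> 0" using t(2) by (metis less_asym power_0)
  then obtain j where j: "N = Suc j" by (cases N) auto
  have cj: "t \<le> c ^ j"
    using not_less_Least[of j "\<lambda>n. c ^ n < t"] j by (simp add: N_def)
  have cj1: "c * c ^ j < t" using N j by simp
  obtain s where s: "s \<in> maps Ss" "ratio s = c ^ j" using maps_power[OF \<sigma>] unfolding c_def by blast
  define k where "k = s \<circ> h"
  have k: "k \<in> maps Ss" unfolding k_def using s(1) h by (rule maps_comp)
  have sk: "k \<in> similitudes" using k by (rule maps_similitude)
  have rk: "ratio k = c ^ j * ratio h"
    unfolding k_def ratio_comp[OF maps_similitude[OF s(1)] sh(1)] s(2) ..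
  have rk0: "0 < ratio k" using sk by (rule ratio_pos)
  have eq: "inv ((f \<circ> s) \<circ> h) \<circ> ((g \<circ> s) \<circ> h) = inv k \<circ> \<phi> \<circ> k"
    using neighbour_comp[OF maps_similitude[OF fg(1)] sk, of g] by (simp add: k_def \<phi>_def o_assoc)
  have "norm (k 0) \<le> rad" using k by (rule rad(3))
  moreover have "norm q \<le> rad" using rad(2) q(1) by (auto simp: subset_iff intro: less_imp_le)
  ultimately have "norm (k 0 - q) \<le> 2 * rad" using norm_triangle_ineq4[of "k 0" q] by simp
  then have "\<eta>' * D * norm (k 0 - q) \<le> \<eta>' * D * (2 * rad)"
    using \<eta>'(1) D(1) by (intro mult_left_mono) auto
  also have "\<dots> = \<eta>' * (2 * rad) * D" by simp
  also have "\<dots> \<le> 1 / 2 * D" using \<eta>'(3) D(1) by (intro mult_right_mono) auto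
  finally have "norm (disp \<phi> (k 0) - disp \<phi> q) \<le> D / 2"
    using lip unfolding \<phi>_def by (metis (no_types, lifting) mult.commute mult_1 order_trans times_divide_eq_right)
  moreover have "norm (disp \<phi> q) = D" using q(2) by (simp add: \<phi>_def)
  ultimately have v: "D / 2 \<le> norm (disp \<phi> (k 0))" "norm (disp \<phi> (k 0)) \<le> 3 / 2 * D"
    using norm_triangle_ineq2[of "disp \<phi> q" "disp \<phi> (k 0)"]
      norm_triangle_ineq2[of "disp \<phi> (k 0)" "disp \<phi> q"]
      norm_minus_commute[of "disp \<phi> (k 0)" "disp \<phi> q"] by linarith+
  have Dt: "D = t * ratio h * \<rho> / 2" using sh(2) \<rho> by (simp add: t_def)
  have "near_translation \<eta> \<rho> (inv k \<circ> \<phi> \<circ> k)"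
    unfolding near_translation_def disp_conjugate[OF sk]
  proof (intro conjI allI)
    have "cmin / 4 * \<rho> * ratio k \<le> c / 4 * \<rho> * (c ^ j * ratio h)"
      unfolding rk using c \<rho> sh(2) by (intro mult_right_mono) auto
    also have "\<dots> = c * c ^ j * (\<rho> * ratio h / 4)" by simp
    also have "\<dots> \<le> t * (\<rho> * ratio h / 4)" using cj1 \<rho> sh(2) by (intro mult_right_mono) auto
    also have "\<dots> = D / 2" by (simp add: Dt)
    also have "\<dots> \<le> norm (disp \<phi> (k 0))" by (rule v(1))
    finally show "cmin / 4 * \<rho> \<le> norm (disp \<phi> (k 0)) / ratio k"
      unfolding pos_le_divide_eq[OF rk0] .
    have "3 / 2 * D \<le> t * (ratio h * \<rho>)" using t(1) sh(2) \<rho> by (simp add: Dt)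
    also have "\<dots> \<le> c ^ j * (ratio h * \<rho>)" using cj sh(2) \<rho> by (intro mult_right_mono) auto
    also have "\<dots> = \<rho> * ratio k" by (simp add: rk)
    finally have "norm (disp \<phi> (k 0)) \<le> \<rho> * ratio k" using v(2) by linarith
    then show "norm (disp \<phi> (k 0)) / ratio k \<le> \<rho>" unfolding pos_divide_le_eq[OF rk0] .
    fix x y
    have "norm (disp \<phi> (k x) - disp \<phi> (k y)) \<le> \<eta>' * D * norm (k x - k y)"
      using lip unfolding \<phi>_def by blast
    also have "norm (k x - k y) = ratio k * norm (x - y)"
      using similitude_dist[OF sk, of x y] by (simp add: dist_norm)
    finally have "norm (disp \<phi> (k x) - disp \<phi> (k y)) / ratio k \<le> \<eta>' * D * norm (x - y)"
      using rk0 by (simp add: pos_divide_le_eq mult.commute mult.left_commute)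
    also have "\<dots> \<le> \<eta> * \<rho> * norm (x - y)"
    proof (intro mult_right_mono mult_mono)
      have "ratio h * \<rho> \<le> 1 * \<rho>" using sh \<rho> by (intro mult_right_mono) auto
      then show "D \<le> \<rho>" using D \<rho> by linarith
    qed (use \<eta>' \<eta> D in auto)
    finally show "norm (disp \<phi> (k x) - disp \<phi> (k y)) / ratio k \<le> \<eta> * \<rho> * norm (x - y)" .
  qed
  moreover have "f \<circ> s \<in> maps Ss" "g \<circ> s \<in> maps Ss" using fg s(1) maps_comp by blast+
  ultimately show ?thesis using that[of "f \<circ> s" "g \<circ> s"] unfolding eq by blast
qed

text \<open>If \<open>\<psi> = inv (f \<circ> h) \<circ> (g \<circ> h)\<close>, then \<open>f \<circ> h \<circ> \<psi> = g \<circ> h\<close>; hence a new letter, placed in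
  front of the word of \<open>h\<close>, realises an additional displacement that may be used or not.\<close>

lemma translation_chain:
  assumes nw: "\<not> wsp Ss" and nh: "\<not> in_hyperplane F" and \<eta>: "0 < \<eta>" and \<rho>: "0 < \<rho>"
  shows "\<exists>h \<psi>s. length \<psi>s = N \<and> (\<forall>\<psi>\<in>set \<psi>s. near_translation \<eta> \<rho> \<psi>) \<and>
    (\<forall>xs. subseq xs \<psi>s \<longrightarrow> h \<circ> foldr (\<circ>) xs id \<in> maps Ss)"
proof (induction N)
  case 0
  have "id \<circ> foldr (\<circ>) xs id \<in> maps Ss" if "subseq xs []" for xs :: "(real ^ 'n \<Rightarrow> real ^ 'n) list"
  proof -
    have "xs = []" using that by (cases xs) simp_all
    then show ?thesis using maps_id by (simp only: foldr.simps id_o id_apply)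
  qed
  then show ?case by (intro exI[of _ id] exI[of _ "[]"]) (simp only: list.size list.set, blast)
next
  case (Suc N)
  then obtain h \<psi>s where h: "length \<psi>s = N" "\<forall>\<psi>\<in>set \<psi>s. near_translation \<eta> \<rho> \<psi>"
    "\<forall>xs. subseq xs \<psi>s \<longrightarrow> h \<circ> foldr (\<circ>) xs id \<in> maps Ss" by blast
  have "h \<circ> foldr (\<circ>) [] id \<in> maps Ss" using h(3) list_emb_Nil by blast
  then have hm: "h \<in> maps Ss" by (simp only: foldr.simps comp_id id_apply)
  obtain f g where fg: "f \<in> maps Ss" "g \<in> maps Ss" "near_translation \<eta> \<rho> (inv (f \<circ> h) \<circ> (g \<circ> h))"
    using nw nh \<eta> \<rho> hm by (rule translation_at_scale)
  define \<psi> where "\<psi> = inv (f \<circ> h) \<circ> (g \<circ> h)"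
  have "f \<circ> h \<in> similitudes" using fg(1) hm maps_comp maps_similitude by blast
  then have cancel: "f \<circ> h \<circ> \<psi> = g \<circ> h"
    unfolding \<psi>_def using similitude_inverse(1)[of "f \<circ> h"] by (metis bij_is_surj fun.map_id o_assoc surj_iff id_o)
  have "(f \<circ> h) \<circ> foldr (\<circ>) xs id \<in> maps Ss" if xs: "subseq xs (\<psi> # \<psi>s)" for xs
  proof (cases "\<exists>xs'. xs = \<psi> # xs' \<and> subseq xs' \<psi>s")
    case True
    then obtain xs' where xs': "xs = \<psi> # xs'" "subseq xs' \<psi>s" by blast
    have "(f \<circ> h) \<circ> foldr (\<circ>) xs id = (f \<circ> h \<circ> \<psi>) \<circ> foldr (\<circ>) xs' id"
      unfolding xs'(1) by (simp only: foldr.simps o_apply o_assoc)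
    also have "\<dots> = g \<circ> (h \<circ> foldr (\<circ>) xs' id)" unfolding cancel by (simp only: o_assoc)
    finally show ?thesis using h(3) xs'(2) fg(2) maps_comp by metis
  next
    case False
    then have "subseq xs \<psi>s" using xs by (cases xs) (auto split: if_splits)
    then have "f \<circ> (h \<circ> foldr (\<circ>) xs id) \<in> maps Ss" using h(3) fg(1) maps_comp by blast
    then show ?thesis by (simp only: o_assoc)
  qed
  then show ?case using h fg(3) unfolding \<psi>_def[symmetric]
    by (intro exI[of _ "f \<circ> h"] exI[of _ "\<psi> # \<psi>s"]) (simp only: length_Cons list.set ball_simps simp_thms insert_iff, blast)
qed

end

lemma norm_diff_add_le: "norm (a - b + c) \<le> norm a + norm b + norm (c :: 'a::real_normed_vector)"
  using norm_triangle_ineq[of "a - b" c] norm_triangle_ineq4[of a b] by linarith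

context attractor
begin

text \<open>Finitely many balls of radius \<eta> * \<rho> cover all possible displacements at 0, so
  in a long chain n members share one of them, with centre z. Every subsequence of the chain is
  admissible, hence so are the prefixes of the selected list.\<close>

lemma aligned_translations:
  assumes nw: "\<not> wsp Ss" and nh: "\<not> in_hyperplane F" and \<eta>: "0 < \<eta>" and \<rho>: "0 < \<rho>"
  obtains h z \<phi>s where "length \<phi>s = n"
    "\<forall>\<phi>\<in>set \<phi>s. near_translation \<eta> \<rho> \<phi> \<and> norm (disp \<phi> 0 - z) \<le> \<eta> * \<rho>"
    "\<forall>j. h \<circ> foldr (\<circ>) (take j \<phi>s) id \<in> maps Ss"
proof -
  have \<eta>\<rho>: "0 < \<eta> * \<rho>" using \<eta> \<rho> by simp
  obtain Z where Z: "finite Z" "cball (0 :: real ^ 'n) \<rho> \<subseteq> (\<Union>z\<in>Z. ball z (\<eta> * \<rho>))"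
    using separated_net[OF bounded_cball \<eta>\<rho>, of 0 \<rho>] by metis
  obtain h \<psi>s where h: "length \<psi>s = Suc (card Z * n)" "\<forall>\<psi>\<in>set \<psi>s. near_translation \<eta> \<rho> \<psi>"
    "\<forall>xs. subseq xs \<psi>s \<longrightarrow> h \<circ> foldr (\<circ>) xs id \<in> maps Ss"
    using translation_chain[OF nw nh \<eta> \<rho>] by blast
  have "\<exists>z\<in>Z. disp \<psi> 0 \<in> ball z (\<eta> * \<rho>)" if "\<psi> \<in> set \<psi>s" for \<psi>
  proof -
    have "disp \<psi> 0 \<in> cball 0 \<rho>" using h(2) that by (simp add: near_translation_def)
    then show ?thesis using Z(2) by blast
  qed
  moreover have "card Z * n < length \<psi>s" using h(1) by simp
  ultimately obtain z where z: "z \<in> Z" "n < length (filter (\<lambda>\<psi>. disp \<psi> 0 \<in> ball z (\<eta> * \<rho>)) \<psi>s)"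
    by (rule filter_pigeonhole[OF Z(1)])
  define \<phi>s where "\<phi>s = take n (filter (\<lambda>\<psi>. disp \<psi> 0 \<in> ball z (\<eta> * \<rho>)) \<psi>s)"
  show ?thesis
  proof (rule that[of \<phi>s z h])
    show "length \<phi>s = n" using z(2) by (simp add: \<phi>s_def)
    show "\<forall>\<phi>\<in>set \<phi>s. near_translation \<eta> \<rho> \<phi> \<and> norm (disp \<phi> 0 - z) \<le> \<eta> * \<rho>"
    proof
      fix \<phi> assume "\<phi> \<in> set \<phi>s"
      then have "\<phi> \<in> set \<psi>s" "disp \<phi> 0 \<in> ball z (\<eta> * \<rho>)" by (auto simp: \<phi>s_def dest: in_set_takeD)
      then show "near_translation \<eta> \<rho> \<phi> \<and> norm (disp \<phi> 0 - z) \<le> \<eta> * \<rho>"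
        using h(2) by (simp add: dist_norm norm_minus_commute less_imp_le)
    qed
    show "\<forall>j. h \<circ> foldr (\<circ>) (take j \<phi>s) id \<in> maps Ss"
    proof
      fix j
      have "subseq (take j \<phi>s) \<psi>s"
        unfolding \<phi>s_def
        by (intro subseq_order.order_trans[OF prefix_imp_subseq[OF take_is_prefix]]
            subseq_order.order_trans[OF prefix_imp_subseq[OF take_is_prefix]] subseq_filter_left)
      then show "h \<circ> foldr (\<circ>) (take j \<phi>s) id \<in> maps Ss" using h(3) by blast
    qed
  qed
qed

text \<open>A binary tree: each piece has two points whose projections along z are apart by a fixed
  fraction of its ratio, small pieces around them keep separated projections, and the construction
  repeats in both. As z is not known in advance, the constants are uniform in z. In dimension at
  least 2 some vector orthogonal to z survives the projection.\<close>

lemma transversal_spread: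
  assumes d: "CARD('n) \<ge> 2" and nh: "\<not> in_hyperplane F"
  obtains \<kappa> b where "0 < \<kappa>" "\<kappa> \<le> 1" "0 < b" "b < 1"
    "\<forall>z k. \<forall>f\<in>maps Ss. z \<noteq> 0 \<longrightarrow> (\<exists>P\<subseteq>f ` F. finite P \<and> card P = 2 ^ k \<and>
       (\<forall>p\<in>P. \<forall>q\<in>P. p \<noteq> q \<longrightarrow> \<kappa> * b ^ k * ratio f \<le> norm (perp z (p - q))))"
proof -
  obtain K where K: "1 \<le> K" "\<And>A :: real ^ 'n \<Rightarrow> real ^ 'n. linear A \<Longrightarrow>
       \<exists>p\<in>F. \<exists>q\<in>F. \<forall>x. norm (A x) \<le> K * norm x * norm (A (p - q))"
    using linear_bound_by_differences[OF F_nonempty nh] by blast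
  \<comment> \<open>Relative to ratio f, passing to points of the two subpieces moves each end by at
    most 2 * rad * \<tau>. Together this uses half of the gap 1 / K; \<kappa> is the other
    half.\<close>
  define \<tau> where "\<tau> = 1 / (8 * K * rad)"
  have Kr: "1 \<le> K * rad" using mult_mono[of 1 K 1 rad] K(1) rad(1) by simp
  have \<tau>: "0 < \<tau>" "\<tau> \<le> 1" "4 * rad * \<tau> = 1 / (2 * K)"
    using Kr K(1) rad(1) by (auto simp: \<tau>_def field_simps)
  define b where "b = cmin * \<tau>"
  define \<kappa> where "\<kappa> = 1 / (2 * K)"
  have \<kappa>: "0 < \<kappa>" "\<kappa> \<le> 1" using K(1) by (auto simp: \<kappa>_def field_simps)
  have b: "0 < b" "b < 1"
    using cmin \<tau> mult_less_le_imp_less[of cmin 1 \<tau> 1] by (auto simp: b_def)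
  have "\<exists>P\<subseteq>f ` F. finite P \<and> card P = 2 ^ k \<and>
       (\<forall>p\<in>P. \<forall>q\<in>P. p \<noteq> q \<longrightarrow> \<kappa> * b ^ k * ratio f \<le> norm (perp z (p - q)))"
    if f: "f \<in> maps Ss" and z: "z \<noteq> 0" for f z k
    using f
  proof (induction k arbitrary: f)
    case 0
    obtain p where "p \<in> F" using F_nonempty by blast
    then show ?case by (intro exI[of _ "{f p}"]) auto
  next
    case (Suc k)
    have sf: "f \<in> similitudes" "0 < ratio f" using Suc.prems maps_similitude ratio_pos by blast+
    from similitudesE[OF sf(1)] obtain L where L: "linear L" "\<And>x y. f x - f y = L (x - y)"
      "\<And>x. norm (L x) = ratio f * norm x" "ratio f > 0" by blast
    have "2 \<le> DIM(real ^ 'n)" using d by simp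
    then obtain e0 :: "real ^ 'n" where e0: "e0 \<noteq> 0" "orthogonal z e0"
      using orthogonal_to_vector_exists by blast
    have pe: "perp z e0 = e0" using e0(2) by (simp add: perp_def orthogonal_def inner_commute)
    \<comment> \<open>The linear part of f maps u to e0, which the projection does not shorten.
      Tested at u, the bound by differences yields ratio f \<le> K * norm (perp z (f p - f
      q)).\<close>
    define u where "u = inv f e0 - inv f 0"
    have Lu: "L u = e0" unfolding u_def L(2)[symmetric] by (simp add: inv_similitude_cancel(2)[OF sf(1), of e0] inv_similitude_cancel(2)[OF sf(1), of 0])
    have nu: "norm e0 = ratio f * norm u" using L(3)[of u] unfolding Lu .
    have "linear (\<lambda>x. perp z (L x))" using linear_compose[OF L(1) perp_linear[of z]] by (simp add: o_def)
    from K(2)[OF this] obtain p q where pq: "p \<in> F" "q \<in> F"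
      "\<forall>x. norm (perp z (L x)) \<le> K * norm x * norm (perp z (L (p - q)))" by blast
    have "ratio f * norm u \<le> K * norm u * norm (perp z (L (p - q)))"
      using pq(3)[rule_format, of u] unfolding Lu pe nu .
    moreover have "0 < norm u" using nu e0(1) by (metis mult_zero_right norm_eq_zero zero_less_norm_iff)
    ultimately have "ratio f \<le> K * norm (perp z (L (p - q)))"
      by (simp add: mult.assoc mult.left_commute[of K] mult.commute[of "ratio f"])
    then have far: "ratio f / K \<le> norm (perp z (f p - f q))"
      unfolding L(2) using K(1) by (simp add: field_simps)
    obtain g1 where g1: "g1 \<in> maps Ss" "p \<in> g1 ` F" "b \<le> ratio g1" "ratio g1 \<le> \<tau>"
      unfolding b_def using pq(1) \<tau>(1,2) by (rule piece)
    obtain g2 where g2: "g2 \<in> maps Ss" "q \<in> g2 ` F" "b \<le> ratio g2" "ratio g2 \<le> \<tau>"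
      unfolding b_def using pq(2) \<tau>(1,2) by (rule piece)
    have m: "f \<circ> g1 \<in> maps Ss" "f \<circ> g2 \<in> maps Ss" using Suc.prems g1(1) g2(1) maps_comp by blast+
    have r: "ratio (f \<circ> g1) = ratio f * ratio g1" "ratio (f \<circ> g2) = ratio f * ratio g2"
      using ratio_comp sf(1) maps_similitude g1(1) g2(1) by blast+
    obtain P1 where P1: "P1 \<subseteq> (f \<circ> g1) ` F" "finite P1" "card P1 = 2 ^ k"
      "\<forall>p\<in>P1. \<forall>q\<in>P1. p \<noteq> q \<longrightarrow> \<kappa> * b ^ k * ratio (f \<circ> g1) \<le> norm (perp z (p - q))"
      using Suc.IH[OF m(1)] by blast
    obtain P2 where P2: "P2 \<subseteq> (f \<circ> g2) ` F" "finite P2" "card P2 = 2 ^ k"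
      "\<forall>p\<in>P2. \<forall>q\<in>P2. p \<noteq> q \<longrightarrow> \<kappa> * b ^ k * ratio (f \<circ> g2) \<le> norm (perp z (p - q))"
      using Suc.IH[OF m(2)] by blast
    have scale: "\<kappa> * b ^ Suc k * ratio f \<le> \<kappa> * b ^ k * (ratio f * t)" if "b \<le> t" for t
    proof -
      have "(\<kappa> * b ^ k * ratio f) * b \<le> (\<kappa> * b ^ k * ratio f) * t"
        using that \<kappa> b sf(2) by (intro mult_left_mono) auto
      then show ?thesis by (simp add: algebra_simps)
    qed
    have close: "norm (x - f c) < ratio f * (2 * rad * \<tau>)"
      if g: "g \<in> maps Ss" "ratio g \<le> \<tau>" and c: "c \<in> g ` F" and x: "x \<in> (f \<circ> g) ` F" for g c x
    proof -
      obtain y where y: "y \<in> g ` F" "x = f y" using x by (metis image_comp imageE)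
      have "dist y c < 2 * rad * ratio g" using g(1) y(1) c by (rule map_dist)
      also have "\<dots> \<le> 2 * rad * \<tau>" using g(2) rad(1) by (intro mult_left_mono) auto
      finally have "ratio f * dist y c < ratio f * (2 * rad * \<tau>)" using sf(2) by (rule mult_strict_left_mono)
      then show ?thesis unfolding y(2) dist_norm[symmetric] similitude_dist[OF sf(1)] .
    qed
    have cross: "\<kappa> * ratio f \<le> norm (perp z (x - y))" if x: "x \<in> P1" and y: "y \<in> P2" for x y
    proof -
      have x': "norm (x - f p) < ratio f * (2 * rad * \<tau>)" using close[OF g1(1,4,2)] P1(1) x by blast
      have y': "norm (y - f q) < ratio f * (2 * rad * \<tau>)" using close[OF g2(1,4,2)] P2(1) y by blast
      have eq: "perp z (f p - f q) = perp z (x - y) - perp z (x - f p) + perp z (y - f q)"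
        by (simp add: linear_diff[OF perp_linear])
      have "norm (perp z (f p - f q)) \<le> norm (perp z (x - y)) + norm (perp z (x - f p)) + norm (perp z (y - f q))"
        unfolding eq by (rule norm_diff_add_le)
      moreover have "norm (perp z (x - f p)) \<le> norm (x - f p)" "norm (perp z (y - f q)) \<le> norm (y - f q)"
        using norm_perp_le[OF z, of _ 0] by simp_all
      ultimately have "ratio f / K \<le> norm (perp z (x - y)) + ratio f * (4 * rad * \<tau>)"
        using far x' y' by (simp add: algebra_simps)
      then show ?thesis unfolding \<tau>(3) \<kappa>_def using K(1) by (simp add: field_simps)
    qed
    have disj: "P1 \<inter> P2 = {}"
    proof (rule ccontr)
      assume "P1 \<inter> P2 \<noteq> {}"
      then obtain x where "x \<in> P1" "x \<in> P2" by blast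
      then have "\<kappa> * ratio f \<le> norm (perp z (x - x))" by (rule cross)
      moreover have "norm (perp z (x - x)) = 0" by (simp add: perp_def)
      ultimately show False using \<kappa>(1) sf(2) by (metis linorder_not_le mult_pos_pos)
    qed
    have cross': "\<kappa> * b ^ Suc k * ratio f \<le> norm (perp z (x - y))" if "x \<in> P1" "y \<in> P2" for x y
    proof -
      have "b ^ Suc k \<le> 1" using b by (intro power_le_one) auto
      then have "\<kappa> * b ^ Suc k * ratio f \<le> \<kappa> * 1 * ratio f"
        using \<kappa> sf(2) by (intro mult_right_mono mult_left_mono) auto
      then show ?thesis using cross[OF that] by simp
    qed
    have sep: "\<kappa> * b ^ Suc k * ratio f \<le> norm (perp z (x - y))"
      if xy: "x \<in> P1 \<union> P2" "y \<in> P1 \<union> P2" "x \<noteq> y" for x y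
    proof -
      have sym: "norm (perp z (x - y)) = norm (perp z (y - x))"
        using linear_neg[OF perp_linear, of z "x - y"] norm_minus_cancel[of "perp z (x - y)"] by simp
      consider "x \<in> P1" "y \<in> P1" | "x \<in> P2" "y \<in> P2" | "x \<in> P1" "y \<in> P2" | "x \<in> P2" "y \<in> P1"
        using xy(1,2) by blast
      then show ?thesis
      proof cases
        case 1
        then have "\<kappa> * b ^ k * (ratio f * ratio g1) \<le> norm (perp z (x - y))"
          using P1(4) xy(3) unfolding r by blast
        then show ?thesis using scale[OF g1(3)] by linarith
      next
        case 2
        then have "\<kappa> * b ^ k * (ratio f * ratio g2) \<le> norm (perp z (x - y))"
          using P2(4) xy(3) unfolding r by blast
        then show ?thesis using scale[OF g2(3)] by linarith
      next
        case 3
        then show ?thesis by (rule cross')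
      next
        case 4
        then show ?thesis unfolding sym by (intro cross')
      qed
    qed
    show ?case
    proof (intro exI[of _ "P1 \<union> P2"] conjI)
      have "g1 ` F \<subseteq> F" "g2 ` F \<subseteq> F" using g1(1) g2(1) maps_image by blast+
      moreover have "(f \<circ> g1) ` F = f ` g1 ` F" "(f \<circ> g2) ` F = f ` g2 ` F" by (simp_all only: image_comp)
      ultimately have "(f \<circ> g1) ` F \<subseteq> f ` F" "(f \<circ> g2) ` F \<subseteq> f ` F" by (simp_all only: image_mono)
      then show "P1 \<union> P2 \<subseteq> f ` F" using P1(1) P2(1) by (meson Un_least order_trans)
      show "finite (P1 \<union> P2)" using P1 P2 by simp
      show "card (P1 \<union> P2) = 2 ^ Suc k" using P1 P2 disj by (simp add: card_Un_disjoint)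
    qed (use sep in blast)
  qed
  then show ?thesis using that[OF \<kappa> b] by blast
qed

text \<open>The points form a grid: j counts shifts by z, and p runs through a set spread
  transversally to z. For p \<noteq> q the projection separates whatever the shifts are; for p = q a
  nonzero multiple of z does. The assumption is made for every z because z emerges only inside the
  proof.\<close>

lemma many_separated_points:
  assumes nw: "\<not> wsp Ss" and nh: "\<not> in_hyperplane F" and \<rho>: "0 < \<rho>" "\<rho> \<le> 1"
    and P: "\<And>z. z \<noteq> 0 \<Longrightarrow> \<exists>P\<subseteq>F. finite P \<and> card P = m \<and>
       (\<forall>p\<in>P. \<forall>q\<in>P. p \<noteq> q \<longrightarrow> \<rho> \<le> norm (perp z (p - q)))"
    and m: "0 < m"
  obtains x s Y where "x \<in> F" "0 < s" "finite Y" "Y \<subseteq> F \<inter> cball x (s * (2 * rad + 6))"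
    "real m / \<rho> \<le> real (card Y)"
    "\<forall>y\<in>Y. \<forall>y'\<in>Y. y \<noteq> y' \<longrightarrow> s * (cmin / 16 * \<rho>) \<le> dist y y'"
proof -
  define a where "a = cmin / 4"
  have a: "0 < a" "a \<le> 1 / 4" using cmin(1,2) by (auto simp: a_def)
  \<comment> \<open>At most 2 / \<rho> compositions, each with error \<eta> * \<rho> * (rad + 6),
    then accumulate no more than a * \<rho> / 8.\<close>
  define \<eta> where "\<eta> = a * \<rho> / (16 * (rad + 6))"
  have a\<rho>: "0 < a * \<rho>" "a * \<rho> \<le> 1 / 4" using a \<rho> mult_mono[of a "1/4" \<rho> 1] by auto
  have \<eta>: "0 < \<eta>" "16 * \<eta> * (rad + 6) = a * \<rho>" using a\<rho> rad(1) by (auto simp: \<eta>_def field_simps)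
  have "16 * \<eta> * 7 \<le> 16 * \<eta> * (rad + 6)" using \<eta>(1) rad(1) by (intro mult_left_mono) auto
  moreover have "a * \<rho> \<le> a * 1" using a \<rho> by (intro mult_left_mono) auto
  ultimately have \<eta>1: "112 * \<eta> \<le> a" "\<eta> \<le> 1" using \<eta> a by linarith+
  define n where "n = nat \<lceil>1 / \<rho>\<rceil>"
  have n: "1 / \<rho> \<le> real n" "real n * \<rho> \<le> 2"
  proof -
    show "1 / \<rho> \<le> real n" unfolding n_def by linarith
    have "real n \<le> 1 / \<rho> + 1" unfolding n_def using \<rho> by (simp add: of_nat_nat ceiling_correct)
    then have "real n * \<rho> \<le> (1 / \<rho> + 1) * \<rho>" using \<rho> by (intro mult_right_mono) auto
    also have "\<dots> = 1 + \<rho>" using \<rho> by (simp add: field_simps)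
    finally show "real n * \<rho> \<le> 2" using \<rho> by simp
  qed
  obtain h z \<phi>s where \<phi>s: "length \<phi>s = n"
    "\<forall>\<phi>\<in>set \<phi>s. near_translation \<eta> \<rho> \<phi> \<and> norm (disp \<phi> 0 - z) \<le> \<eta> * \<rho>"
    "\<forall>j. h \<circ> foldr (\<circ>) (take j \<phi>s) id \<in> maps Ss"
    using nw nh \<eta>(1) \<rho>(1) by (rule aligned_translations)
  have "0 < n" using n(1) \<rho> by (metis divide_pos_pos not_le of_nat_0_less_iff order_less_le_trans zero_less_one)
  then have "\<phi>s ! 0 \<in> set \<phi>s" using \<phi>s(1) by simp
  then have nt: "a * \<rho> \<le> norm (disp (\<phi>s ! 0) 0)" "norm (disp (\<phi>s ! 0) 0) \<le> \<rho>"
    "norm (disp (\<phi>s ! 0) 0 - z) \<le> \<eta> * \<rho>"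
    using \<phi>s(2) by (auto simp: near_translation_def a_def)
  have "\<eta> * \<rho> \<le> \<rho>" using \<eta>1 \<rho> by (simp add: mult_left_le_one_le \<eta>(1) less_imp_le)
  then have z2: "norm z \<le> 2 * \<rho>"
    using nt(2,3) norm_triangle_sub[of z "disp (\<phi>s ! 0) 0"] norm_minus_commute[of z "disp (\<phi>s ! 0) 0"] by linarith
  have "\<eta> * \<rho> \<le> a / 2 * \<rho>" using \<eta>1 \<eta>(1) \<rho> a by (intro mult_right_mono) auto
  then have z1: "a * \<rho> / 2 \<le> norm z"
    using nt(1,3) norm_triangle_sub[of "disp (\<phi>s ! 0) 0" z] by linarith
  then have z0: "z \<noteq> 0" using a\<rho> by auto
  obtain P where P': "P \<subseteq> F" "finite P" "card P = m"
    "\<forall>p\<in>P. \<forall>q\<in>P. p \<noteq> q \<longrightarrow> \<rho> \<le> norm (perp z (p - q))" using P[OF z0] by blast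
  \<comment> \<open>The start lies within \<open>rad\<close>, the drift is at most n * (2 * \<rho>)
    \<le> 4, and the error is at most 1.\<close>
  define R where "R = rad + 4 + 1"
  define y where "y j p = foldr (\<circ>) (take j \<phi>s) id p" for j p
  have err: "norm (y j p - p - real j *\<^sub>R z) \<le> a * \<rho> / 8" if j: "j < n" and p: "p \<in> F" for j p
  proof -
    have len: "length (take j \<phi>s) = j" using j \<phi>s(1) by simp
    have nerr: "real n * (\<eta> * \<rho> * (1 + R)) \<le> a * \<rho> / 8"
    proof -
      have "(real n * \<rho>) * (\<eta> * (rad + 6)) \<le> 2 * (\<eta> * (rad + 6))"
        using n(2) \<eta>(1) rad(1) by (intro mult_right_mono) auto
      then show ?thesis using \<eta>(2) by (simp add: R_def algebra_simps)
    qed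
    have "norm (foldr (\<circ>) (take j \<phi>s) id p - p - real (length (take j \<phi>s)) *\<^sub>R z)
        \<le> real (length (take j \<phi>s)) * (\<eta> * \<rho> * (1 + R))"
    proof (rule foldr_disp[where n = n and M = 4 and B = rad])
      have "real n * norm z \<le> real n * (2 * \<rho>)" using z2 by (intro mult_left_mono) auto
      then show "real n * norm z \<le> 4" using n(2) by simp
      show "real n * (\<eta> * \<rho> * (1 + R)) \<le> 1" using nerr a\<rho> by simp
      show "norm p \<le> rad" using rad(2) p by (auto simp: subset_iff intro: less_imp_le)
      show "norm (disp f 0 - z) \<le> \<eta> * \<rho>" if "f \<in> set (take j \<phi>s)" for f
        using \<phi>s(2) in_set_takeD[OF that] by blast
      show "norm (disp f u - disp f v) \<le> \<eta> * \<rho> * norm (u - v)" if "f \<in> set (take j \<phi>s)" for f u v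
        using \<phi>s(2) in_set_takeD[OF that] unfolding near_translation_def by blast
    qed (use \<eta> \<rho> j \<phi>s(1) in \<open>auto simp: R_def\<close>)
    also have "\<dots> = real j * (\<eta> * \<rho> * (1 + R))" by (simp only: len)
    also have "\<dots> \<le> real n * (\<eta> * \<rho> * (1 + R))"
      using j \<eta> \<rho> rad(1) by (intro mult_right_mono) (auto simp: R_def)
    also have "\<dots> \<le> a * \<rho> / 8" by (rule nerr)
    finally show ?thesis by (simp only: len y_def)
  qed
  \<comment> \<open>Two errors of a * \<rho> / 8 are subtracted from the separation a * \<rho> / 2
    of the ideal grid.\<close>
  have sep: "a * \<rho> / 4 \<le> dist (y j p) (y i q)"
    if ji: "j < n" "i < n" and pq: "p \<in> P" "q \<in> P" and ne: "(j, p) \<noteq> (i, q)" for j i p q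
  proof -
    define u where "u = (p - q) + (real j - real i) *\<^sub>R z"
    have eq: "u = (y j p - y i q) - (y j p - p - real j *\<^sub>R z) + (y i q - q - real i *\<^sub>R z)"
      by (simp add: u_def algebra_simps)
    have "norm u \<le> norm (y j p - y i q) + norm (y j p - p - real j *\<^sub>R z) + norm (y i q - q - real i *\<^sub>R z)"
      unfolding eq by (rule norm_diff_add_le)
    moreover have "norm (y j p - p - real j *\<^sub>R z) \<le> a * \<rho> / 8" using ji pq P'(1) by (intro err) auto
    moreover have "norm (y i q - q - real i *\<^sub>R z) \<le> a * \<rho> / 8" using ji pq P'(1) by (intro err) auto
    moreover have "a * \<rho> / 2 \<le> norm u"
    proof (cases "p = q")
      case True
      then have "j \<noteq> i" using ne by simp
      then have "1 \<le> \<bar>real j - real i\<bar>" by linarith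
      then have "1 * norm z \<le> \<bar>real j - real i\<bar> * norm z" by (intro mult_right_mono) auto
      then show ?thesis using True z1 by (simp add: u_def)
    next
      case False
      then have "\<rho> \<le> norm (perp z (p - q))" using P'(4) pq by blast
      also have "\<dots> \<le> norm u" unfolding u_def by (rule norm_perp_le[OF z0])
      finally have "\<rho> \<le> norm u" .
      moreover have "a * \<rho> \<le> 1 * \<rho>" using a \<rho> by (intro mult_right_mono) auto
      ultimately show ?thesis using \<rho> by linarith
    qed
    ultimately show ?thesis by (simp add: dist_norm)
  qed
  define T where "T = (\<lambda>(j, p). y j p) ` ({..<n} \<times> P)"
  have inj: "inj_on (\<lambda>(j, p). y j p) ({..<n} \<times> P)"
  proof (rule inj_onI, rule ccontr)
    fix s t assume st: "s \<in> {..<n} \<times> P" "t \<in> {..<n} \<times> P"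
      "(case s of (j, p) \<Rightarrow> y j p) = (case t of (j, p) \<Rightarrow> y j p)" "s \<noteq> t"
    obtain j p i q where eq: "s = (j, p)" "t = (i, q)" by (metis surj_pair)
    have "a * \<rho> / 4 \<le> dist (y j p) (y i q)" using st(1,2,4) unfolding eq by (intro sep) auto
    then show False using st(3) a\<rho> unfolding eq by simp
  qed
  have "h \<circ> foldr (\<circ>) (take 0 \<phi>s) id \<in> maps Ss" using \<phi>s(3) by blast
  then have hm: "h \<in> maps Ss" by (simp only: take_0 foldr.simps comp_id id_apply)
  have sh: "h \<in> similitudes" "0 < ratio h" using hm maps_similitude ratio_pos by blast+
  have "P \<noteq> {}" using P'(3) m by auto
  then obtain p0 where p0: "p0 \<in> P" by blast
  then have p0F: "p0 \<in> F" using P'(1) by blast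
  show ?thesis
  proof (rule that[of "h p0" "ratio h" "h ` T"])
    show "h p0 \<in> F" using maps_image[OF hm] p0F by blast
    show "finite (h ` T)" using P'(2) by (simp add: T_def)
    show "h ` T \<subseteq> F \<inter> cball (h p0) (ratio h * (2 * rad + 6))"
    proof
      fix x assume "x \<in> h ` T"
      then obtain j p where jp: "j < n" "p \<in> P" "x = h (y j p)" by (auto simp: T_def)
      have pF: "p \<in> F" using jp(2) P'(1) by blast
      have "(h \<circ> foldr (\<circ>) (take j \<phi>s) id) ` F \<subseteq> F" using \<phi>s(3) maps_image by blast
      then have "(h \<circ> foldr (\<circ>) (take j \<phi>s) id) p \<in> F" using pF by blast
      then have "x \<in> F" unfolding jp(3) y_def by (simp only: o_apply)
      moreover have "dist (h p0) x \<le> ratio h * (2 * rad + 6)"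
      proof -
        have eq: "p0 - y j p = (p0 - p) - real j *\<^sub>R z - (y j p - p - real j *\<^sub>R z)"
          by simp
        have "norm (p0 - y j p) \<le> norm ((p0 - p) - real j *\<^sub>R z) + norm (y j p - p - real j *\<^sub>R z)"
          unfolding eq by (rule norm_triangle_ineq4)
        with norm_triangle_ineq4[of "p0 - p" "real j *\<^sub>R z"]
        have "norm (p0 - y j p) \<le> norm (p0 - p) + norm (real j *\<^sub>R z) + norm (y j p - p - real j *\<^sub>R z)"
          by linarith
        moreover have "real j * norm z \<le> real n * (2 * \<rho>)" using jp(1) z2 by (intro mult_mono) auto
        then have "norm (real j *\<^sub>R z) \<le> 4" using n(2) by simp
        moreover have "norm (y j p - p - real j *\<^sub>R z) \<le> 1" using err[OF jp(1) pF] a\<rho> by simp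
        moreover have "norm (p0 - p) < 2 * rad" using F_dist[OF p0F pF] by (simp add: dist_norm)
        ultimately have "dist p0 (y j p) \<le> 2 * rad + 6" unfolding dist_norm by linarith
        then show ?thesis unfolding jp(3) similitude_dist[OF sh(1)] using sh(2) by (intro mult_left_mono) auto
      qed
      ultimately show "x \<in> F \<inter> cball (h p0) (ratio h * (2 * rad + 6))" by simp
    qed
    have "card (h ` T) = card T" using similitude_inj[OF sh(1)] by (intro card_image) (auto intro: inj_on_subset)
    also have "\<dots> = n * m" unfolding T_def card_image[OF inj] by (simp add: card_cartesian_product P'(3))
    finally have "real (card (h ` T)) = real n * real m" by simp
    moreover have "1 / \<rho> * real m \<le> real n * real m" using n(1) by (intro mult_right_mono) auto
    ultimately show "real m / \<rho> \<le> real (card (h ` T))" by simp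
    show "\<forall>y\<in>h ` T. \<forall>y'\<in>h ` T. y \<noteq> y' \<longrightarrow> ratio h * (cmin / 16 * \<rho>) \<le> dist y y'"
    proof (intro ballI impI)
      fix u v assume "u \<in> h ` T" "v \<in> h ` T" and uv: "u \<noteq> v"
      then obtain j p i q where jp: "j < n" "p \<in> P" "u = h (y j p)" and iq: "i < n" "q \<in> P" "v = h (y i q)"
        by (auto simp: T_def)
      have "a * \<rho> / 4 \<le> dist (y j p) (y i q)" using uv jp iq by (intro sep) auto
      then have "cmin / 16 * \<rho> \<le> dist (y j p) (y i q)" by (simp add: a_def)
      then show "ratio h * (cmin / 16 * \<rho>) \<le> dist u v"
        unfolding jp(3) iq(3) similitude_dist[OF sh(1)] using sh(2) by (intro mult_left_mono) auto
    qed
  qed (rule sh(2))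
qed

lemma not_wsp_imp_assouad_dim:
  assumes d: "CARD('n) \<ge> 2" and nh: "\<not> in_hyperplane F" and nw: "\<not> wsp Ss"
  shows "1 < assouad_dim F"
proof -
  obtain \<kappa> b where \<kappa>: "0 < \<kappa>" "\<kappa> \<le> 1" and b: "0 < b" "b < 1" and
    spread: "\<forall>z k. \<forall>f\<in>maps Ss. z \<noteq> 0 \<longrightarrow> (\<exists>P\<subseteq>f ` F. finite P \<and> card P = 2 ^ k \<and>
       (\<forall>p\<in>P. \<forall>q\<in>P. p \<noteq> q \<longrightarrow> \<kappa> * b ^ k * ratio f \<le> norm (perp z (p - q))))"
    using d nh by (rule transversal_spread)
  \<comment> \<open>\<beta> solves b powr (1 - \<beta>) = 3 / 2, a value between 1 and 2. At \<rho>
    = \<kappa> * b ^ k the 2 ^ k / \<rho> separated points outgrow \<rho> powr - \<beta>, which is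
    of order (3 / 2) ^ k / \<rho>.\<close>
  define \<beta> where "\<beta> = 1 - ln (3 / 2) / ln b"
  have lnb: "ln b < 0" using b by (simp add: ln_less_zero)
  have \<beta>: "1 < \<beta>" using lnb by (simp add: \<beta>_def divide_less_0_iff)
  have b\<beta>: "b powr (1 - \<beta>) = 3 / 2"
    using b lnb by (simp add: \<beta>_def powr_def)
  have "\<not> assouad_dim F < ereal \<beta>"
  proof
    assume "assouad_dim F < ereal \<beta>"
    then obtain \<alpha> c where \<alpha>: "\<alpha> < \<beta>" and c: "\<And>r R x. 0 < r \<Longrightarrow> r < R \<Longrightarrow> x \<in> F \<Longrightarrow>
      \<exists>A. finite A \<and> cball x R \<inter> F \<subseteq> (\<Union>a\<in>A. cball a r) \<and> real (card A) \<le> c * (R / r) powr \<alpha>"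
      using assouad_dim_lessD[of F \<beta>] by metis
    \<comment> \<open>The factor 64 makes the separation of the points 4 * r, so that a ball of
      radius r holds at most one of them; \<open>C\<close> is \<rho> * (R / r).\<close>
    define C where "C = 64 * (2 * rad + 6) / cmin"
    have C: "1 \<le> C" using cmin(1,2) rad(1) by (simp add: C_def pos_le_divide_eq)
    define E where "E = \<bar>c\<bar> * C powr \<beta> * \<kappa> powr (1 - \<beta>)"
    have E: "(4 / 3) ^ k \<le> E" for k
    proof -
      define \<rho> where "\<rho> = \<kappa> * b ^ k"
      have \<rho>: "0 < \<rho>" "\<rho> \<le> 1"
        using \<kappa> b mult_mono[of \<kappa> 1 "b ^ k" 1] power_le_one[of b k] by (auto simp: \<rho>_def)
      have P: "\<exists>P\<subseteq>F. finite P \<and> card P = 2 ^ k \<and>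
         (\<forall>p\<in>P. \<forall>q\<in>P. p \<noteq> q \<longrightarrow> \<rho> \<le> norm (perp z (p - q)))" if "z \<noteq> 0" for z
        using spread[rule_format, OF maps_id that, of k] unfolding \<rho>_def ratio_id image_id mult_1_right by simp
      obtain x s Y where Y: "x \<in> F" "0 < s" "finite Y" "Y \<subseteq> F \<inter> cball x (s * (2 * rad + 6))"
        "real (2 ^ k) / \<rho> \<le> real (card Y)"
        "\<forall>y\<in>Y. \<forall>y'\<in>Y. y \<noteq> y' \<longrightarrow> s * (cmin / 16 * \<rho>) \<le> dist y y'"
        by (rule many_separated_points[OF nw nh \<rho> P]) auto
      define r where "r = s * (cmin / 64 * \<rho>)"
      define R where "R = s * (2 * rad + 6)"
      have r: "0 < r" using Y(2) cmin(1) \<rho> by (simp add: r_def)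
      have Rr: "R / r = C / \<rho>" using Y(2) by (simp add: R_def r_def C_def)
      have "1 * 1 < C * (1 / \<rho>)"
      proof -
        have "1 < C" using cmin(1,2) rad(1) by (simp add: C_def pos_less_divide_eq)
        then show ?thesis using \<rho> by (intro mult_less_le_imp_less) auto
      qed
      then have "1 < R / r" using Rr by simp
      then have rR: "r < R" using r by simp
      obtain A where A: "finite A" "cball x R \<inter> F \<subseteq> (\<Union>a\<in>A. cball a r)"
        "real (card A) \<le> c * (R / r) powr \<alpha>" using c[OF r rR Y(1)] by blast
      have "card Y \<le> card A"
      proof (rule separated_card(2))
        show "Y \<subseteq> (\<Union>a\<in>A. cball a r)" using Y(4) A(2) by (auto simp: R_def)
        show "s * (cmin / 16 * \<rho>) \<le> dist y y'" if "y \<in> Y" "y' \<in> Y" "y \<noteq> y'" for y y'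
          using Y(6) that by blast
        have "s * (cmin / 16 * \<rho>) = 4 * r" by (simp add: r_def)
        then show "2 * r < s * (cmin / 16 * \<rho>)" using r by linarith
      qed (rule A(1))
      then have "2 ^ k / \<rho> \<le> c * (R / r) powr \<alpha>" using A(3) Y(5) by simp
      also have "\<dots> \<le> \<bar>c\<bar> * (C / \<rho>) powr \<beta>"
        using \<alpha> \<open>1 < R / r\<close> unfolding Rr by (intro mult_mono powr_mono) auto
      also have "\<dots> = \<bar>c\<bar> * C powr \<beta> / \<rho> powr \<beta>" using C \<rho> by (simp add: powr_divide)
      finally have "2 ^ k / \<rho> * \<rho> \<le> \<bar>c\<bar> * C powr \<beta> / \<rho> powr \<beta> * \<rho>" using \<rho> by (intro mult_right_mono) auto
      then have "2 ^ k \<le> \<bar>c\<bar> * C powr \<beta> * \<rho> powr (1 - \<beta>)"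
        using \<rho> by (simp add: powr_diff)
      also have "\<rho> powr (1 - \<beta>) = \<kappa> powr (1 - \<beta>) * (b powr (1 - \<beta>)) ^ k"
        using \<kappa> b by (simp add: \<rho>_def powr_mult powr_power powr_powr powr_realpow[symmetric] mult.commute)
      also have "\<bar>c\<bar> * C powr \<beta> * (\<kappa> powr (1 - \<beta>) * (b powr (1 - \<beta>)) ^ k) = E * (3 / 2) ^ k"
        by (simp add: E_def b\<beta>)
      finally have "2 ^ k \<le> E * (3 / 2) ^ k" .
      moreover have "(2 :: real) ^ k = (4 / 3) ^ k * (3 / 2) ^ k" by (simp add: power_mult_distrib[symmetric])
      ultimately have "(4 / 3) ^ k * (3 / 2) ^ k \<le> E * (3 / 2 :: real) ^ k" by simp
      then show ?thesis by (rule mult_right_le_imp_le) simp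
    qed
    obtain k where "E < (4 / 3) ^ k" using real_arch_pow[of "4 / 3" E] by auto
    then show False using E[of k] by simp
  qed
  then have "ereal \<beta> \<le> assouad_dim F" by simp
  moreover have "1 < ereal \<beta>" using \<beta> by (simp add: one_ereal_def)
  ultimately show ?thesis by (rule less_le_trans[rotated])
qed

end


section \<open>The equivalences\<close>

theorem corollary1p7:
  assumes "CARD('n::finite) \<ge> 2"
  shows
    "(\<not> (\<exists>F :: (real ^ 'n) set.
            self_similar F \<and> \<not> in_hyperplane F \<and> \<not> set_wsp F \<and>
            hausdorff_dim F = 1 \<and> hausdorff_measure 1 F > 0)) \<and>
     (\<forall>F :: (real ^ 'n) set.
        self_similar F \<and> \<not> in_hyperplane F \<and> hausdorff_dim F = 1 \<longrightarrow>
          ((\<exists>Ss. ifs Ss \<and> is_attractor Ss F \<and> wsp Ss) \<longleftrightarrow>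
           (\<forall>Ss. ifs Ss \<and> is_attractor Ss F \<longrightarrow> wsp Ss)) \<and>
          ((\<forall>Ss. ifs Ss \<and> is_attractor Ss F \<longrightarrow> wsp Ss) \<longleftrightarrow>
           hausdorff_measure 1 F > 0) \<and>
          (hausdorff_measure 1 F > 0 \<longleftrightarrow>
           hausdorff_dim F = assouad_dim F))"
proof -
  \<comment> \<open>The implications run from (i) through (ii) and (iii) to (i'); the first conjunct
    closes the cycle, since (i') could otherwise hold vacuously.\<close>
  have main: "(\<exists>Ss. ifs Ss \<and> is_attractor Ss F) \<and>
      ((\<exists>Ss. ifs Ss \<and> is_attractor Ss F \<and> wsp Ss) \<longrightarrow> hausdorff_measure 1 F > 0) \<and>
      (hausdorff_measure 1 F > 0 \<longrightarrow> hausdorff_dim F = assouad_dim F) \<and>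
      (hausdorff_dim F = assouad_dim F \<longrightarrow> (\<forall>Ss. ifs Ss \<and> is_attractor Ss F \<longrightarrow> wsp Ss))"
    if F: "self_similar F" "\<not> in_hyperplane F" "hausdorff_dim F = 1" for F :: "(real ^ 'n) set"
  proof (intro conjI impI allI)
    have dim: "hausdorff_dim F = ereal 1" using F(3) by (simp add: one_ereal_def)
    have below: "pos_content t F" if "0 < t" "t < 1" for t
      using dim that by (rule pos_content_below_dim)
    show ex: "\<exists>Ss. ifs Ss \<and> is_attractor Ss F" using F(1) by (simp add: self_similar_def)
    then obtain Ss0 where Ss0: "ifs Ss0" "is_attractor Ss0 F" by blast
    interpret F: attractor Ss0 F by unfold_locales (fact Ss0)+
    have above: "\<not> pos_content t F" if "1 < t" for t
      using dim zero_less_one that F.F_compact by (rule not_pos_content_above_dim)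
    show "hausdorff_measure 1 F > 0" if wsp: "\<exists>Ss. ifs Ss \<and> is_attractor Ss F \<and> wsp Ss"
    proof -
      obtain Ss where Ss: "ifs Ss" "is_attractor Ss F" "wsp Ss" using wsp by blast
      \<comment> \<open>Content refers to \<open>F\<close> alone, so the weakly separated IFS may
        differ from \<open>Ss0\<close>.\<close>
      interpret W: attractor Ss F by unfold_locales (fact Ss)+
      have "pos_content 1 F" by (rule W.wsp_imp_pos_content[OF Ss(3) zero_less_one below])
      then show ?thesis by (intro hausdorff_measure_pos F.F_compact) auto
    qed
    show "hausdorff_dim F = assouad_dim F" if "hausdorff_measure 1 F > 0"
    proof -
      have "pos_content 1 F"
      proof (rule ccontr)
        assume "\<not> pos_content 1 F"
        then have "hausdorff_measure 1 F = 0" by (rule hausdorff_measure_eq_0) simp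
        then show False using that by simp
      qed
      then have "assouad_dim F \<le> ereal 1" using above by (intro F.assouad_dim_upper) auto
      moreover have "ereal 1 \<le> assouad_dim F" by (rule F.assouad_dim_lower[OF zero_less_one below])
      ultimately show ?thesis using dim by simp
    qed
    show "wsp Ss" if eq: "hausdorff_dim F = assouad_dim F" and Ss: "ifs Ss \<and> is_attractor Ss F" for Ss
    proof (rule ccontr)
      assume nw: "\<not> wsp Ss"
      interpret W: attractor Ss F using Ss by unfold_locales auto
      have "1 < assouad_dim F" using assms F(2) nw by (rule W.not_wsp_imp_assouad_dim)
      then show False using eq F(3) by simp
    qed
  qed
  show ?thesis
  proof (intro conjI allI impI notI)
    assume "\<exists>F :: (real ^ 'n) set. self_similar F \<and> \<not> in_hyperplane F \<and> \<not> set_wsp F \<and>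
            hausdorff_dim F = 1 \<and> hausdorff_measure 1 F > 0"
    then obtain F :: "(real ^ 'n) set" where F: "self_similar F" "\<not> in_hyperplane F" "hausdorff_dim F = 1"
      "\<not> set_wsp F" "hausdorff_measure 1 F > 0" by blast
    then show False using main[OF F(1-3)] unfolding set_wsp_def by blast
  next
    fix F :: "(real ^ 'n) set"
    assume "self_similar F \<and> \<not> in_hyperplane F \<and> hausdorff_dim F = 1"
    then have *: "self_similar F" "\<not> in_hyperplane F" "hausdorff_dim F = 1" by blast+
    note m = main[OF *]
    show "(\<exists>Ss. ifs Ss \<and> is_attractor Ss F \<and> wsp Ss) \<longleftrightarrow> (\<forall>Ss. ifs Ss \<and> is_attractor Ss F \<longrightarrow> wsp Ss)"
      using m by blast
    show "(\<forall>Ss. ifs Ss \<and> is_attractor Ss F \<longrightarrow> wsp Ss) \<longleftrightarrow> hausdorff_measure 1 F > 0"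
      using m by blast
    show "hausdorff_measure 1 F > 0 \<longleftrightarrow> hausdorff_dim F = assouad_dim F"
      using m by blast
  qed
qed

end
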